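(* Let $G$ be a finite complex reflection group acting on $\mathbb C^d$, let $\Omega\subseteq\mathbb C^d$ be a bounded $G$-invariant domain, let $\boldsymbol\theta$ be a basic polynomial map associated to $G$, let $\widetilde\omega:\boldsymbol\theta(\Omega)\to(0,\infty)$ be continuous and let $\omega=\widetilde\omega\circ\boldsymbol\theta$. Then for each one-dimensional representation $\varrho$ of $G$, the relative invariant subspace $R^G_\varrho(\mathbb A^2_\omega(\Omega))$ is isometrically isomorphic to the weighted Bergman space $\mathbb A^2_{\omega_\varrho}(\boldsymbol\theta(\Omega))$. Moreover, the reproducing kernel $\mathcal B_{\omega_\varrho}$ of $\mathbb A^2_{\omega_\varrho}(\boldsymbol\theta(\Omega))$ is given by $$\mathcal B_{\omega_\varrho}\big(\boldsymbol\theta(\boldsymbol z),\boldsymbol\theta(\boldsymbol w)\big)=\frac{1}{\ell_\varrho(\boldsymbol z)\,\overline{\ell_\varrho(\boldsymbol w)}}\sum_{\sigma\in G}\chi_\varrho(\sigma^{-1})\,\mathcal B_\omega(\sigma^{-1}\cdot\boldsymbol z,\boldsymbol w)\qquad\text{for }\boldsymbol z,\boldsymbol w\in\Omega,$$ where $\mathcal B_\omega$ is the reproducing kernel of $\mathbb A^2_\omega(\Omega)$ and $\chi_\varrho$ is the character of $\varrho$.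
   Context: A complex reflection on $\mathbb C^d$ is a linear map $\sigma$ of finite order in $GL(d,\mathbb C)$ such that $\mathrm{id}-\sigma$ has rank $1$. A finite complex reflection group is a finite subgroup $G\subset GL(d,\mathbb C)$ generated by complex reflections. $G$ acts on $\mathbb C^d$ by $\sigma\cdot\boldsymbol z=\sigma^{-1}\boldsymbol z$ (so $\sigma^{-1}\cdot\boldsymbol z=\sigma\boldsymbol z$) and on functions by $\sigma(f)(\boldsymbol z)=f(\sigma^{-1}\cdot\boldsymbol z)$. A domain $\Omega$ is $G$-invariant (a $G$-space) if it is preserved by this action. A basic polynomial map associated to $G$ is $\boldsymbol\theta=(\theta_1,\dots,\theta_d):\mathbb C^d\to\mathbb C^d$, where $\theta_1,\dots,\theta_d$ are algebraically independent homogeneous polynomials with $\mathbb C[z_1,\dots,z_d]^G=\mathbb C[\theta_1,\dots,\theta_d]$ (these exist by the Chevalley–Shephard–Todd theorem). For a $G$-invariant domain $\Omega$, $\boldsymbol\theta(\Omega)$ is a domain. $J_{\boldsymbol\theta}$ is the determinant of the complex Jacobian matrix of $\boldsymbol\theta$. The polynomial $\ell_\varrho$: let $H_1,\dots,H_t$ be the distinct reflecting hyperplanes of $G$ (the hyperplanes $\ker(\mathrm{id}-\sigma)$, $\sigma\in G$ a complex reflection), $\ell_i$ a linear form with zero set $H_i$, $G_i=\langle a_i\rangle$ the cyclic subgroup of elements of $G$ acting trivially on $H_i$. For a one-dimensional representation $\varrho$, let $c_i$ be the least non-negative integer with $\varrho(a_i)=(\det a_i)^{c_i}$, and set $\ell_\varrho=\prod_{i=1}^t\ell_i^{c_i}$.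 For a domain $D$ and weight $\nu>0$ (continuous, defined on $D$ off a closed set of measure zero), $\mathbb A^2_\nu(D)$ is the space of holomorphic $f$ on $D$ with $\int_D|f|^2\nu\,dV<\infty$, with the inner product of $L^2(\nu\,dV)$. $dV$ is Lebesgue measure normalized on $\Omega$; the same multiple of Lebesgue measure is used on $\boldsymbol\theta(\Omega)$. $R^G_\varrho(\mathbb A^2_\omega(\Omega))=\{f\in\mathbb A^2_\omega(\Omega):\sigma(f)=\chi_\varrho(\sigma)f\ \text{for all }\sigma\in G\}$. The weight $\omega_\varrho$ is defined on $\boldsymbol\theta(\Omega)\setminus\boldsymbol\theta(\bigcup_iH_i)$ by $\omega_\varrho(\boldsymbol\theta(\boldsymbol z))=\frac{|\ell_\varrho(\boldsymbol z)|^2}{|J_{\boldsymbol\theta}(\boldsymbol z)|^2}\,\widetilde\omega(\boldsymbol\theta(\boldsymbol z))$ (well defined). The sum in the kernel formula is divisible by $\ell_\varrho(\boldsymbol z)\overline{\ell_\varrho(\boldsymbol w)}$, and at zeros of $\ell_\varrho$ the quotient is understood as its (holomorphic in $\boldsymbol z$, antiholomorphic in $\boldsymbol w$) extension. *)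

theory Defs
  imports
    "HOL-Analysis.Analysis"
    "HOL-Algebra.Generated_Groups"
    "HOL-Library.Poly_Mapping"
begin

section \<open>Finite complex reflection groups\<close>

definition GL :: "(complex^'d^'d) monoid" where
  "GL = \<lparr>carrier = {A. invertible A}, mult = (**), one = mat 1\<rparr>"

definition complex_reflection :: "complex^'d^'d \<Rightarrow> bool" where
  "complex_reflection A \<longleftrightarrow>
     A \<in> carrier GL \<and> (\<exists>n::nat. n > 0 \<and> A [^]\<^bsub>GL\<^esub> n = \<one>\<^bsub>GL\<^esub>) \<and> rank (mat 1 - A) = 1"

definition finite_reflection_group :: "(complex^'d^'d) set \<Rightarrow> bool" where
  "finite_reflection_group G \<longleftrightarrow>
     finite G \<and> subgroup G GL \<and> G = generate GL {A \<in> G. complex_reflection A}"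

text \<open>Note the inverse: \<open>\<sigma>\<close> acts on points by \<open>z \<mapsto> \<sigma>\<inverse> z\<close>,
  and hence on functions by \<open>\<sigma>(f)(z) = f (\<sigma> z)\<close>.\<close>

definition act :: "complex^'d^'d \<Rightarrow> complex^'d \<Rightarrow> complex^'d" where
  "act \<sigma> z = (inv\<^bsub>GL\<^esub> \<sigma>) *v z"

definition act_fun :: "complex^'d^'d \<Rightarrow> (complex^'d \<Rightarrow> complex) \<Rightarrow> complex^'d \<Rightarrow> complex" where
  "act_fun \<sigma> f z = f (act (inv\<^bsub>GL\<^esub> \<sigma>) z)"

definition invariant_set :: "(complex^'d^'d) set \<Rightarrow> (complex^'d) set \<Rightarrow> bool" where
  "invariant_set G \<Omega> \<longleftrightarrow> (\<forall>\<sigma>\<in>G. act \<sigma> ` \<Omega> = \<Omega>)"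

definition cdomain :: "(complex^'d) set \<Rightarrow> bool" where
  "cdomain \<Omega> \<longleftrightarrow> open \<Omega> \<and> connected \<Omega> \<and> \<Omega> \<noteq> {}"

text \<open>A one-dimensional representation is a homomorphism into the multiplicative group of \<open>\<complex>\<close>;
  it is identified with its character.\<close>

definition mult_complex :: "complex monoid" where
  "mult_complex = \<lparr>carrier = - {0}, mult = (*), one = 1\<rparr>"

definition one_dim_rep :: "(complex^'d^'d) set \<Rightarrow> (complex^'d^'d \<Rightarrow> complex) \<Rightarrow> bool" where
  "one_dim_rep G \<rho> \<longleftrightarrow> \<rho> \<in> hom (GL\<lparr>carrier := G\<rparr>) mult_complex"

section \<open>Basic polynomial maps\<close>

text \<open>Polynomials in the variables \<open>z\<^sub>i\<close>, \<open>i :: 'd\<close>: finitely supported families of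
  coefficients indexed by exponent vectors. Over \<open>\<complex>\<close> a polynomial is determined
  by the function it induces, so polynomial identities are stated for the induced functions.\<close>

type_synonym 'd cpoly = "('d \<Rightarrow>\<^sub>0 nat) \<Rightarrow>\<^sub>0 complex"

definition eval_poly :: "'d::finite cpoly \<Rightarrow> complex^'d \<Rightarrow> complex" where
  "eval_poly p z =
     (\<Sum>m\<in>Poly_Mapping.keys p. Poly_Mapping.lookup p m * (\<Prod>i\<in>UNIV. (z $ i) ^ Poly_Mapping.lookup m i))"

definition homogeneous :: "'d::finite cpoly \<Rightarrow> bool" where
  "homogeneous p \<longleftrightarrow>
     (\<exists>n. \<forall>m\<in>Poly_Mapping.keys p. (\<Sum>i\<in>UNIV. Poly_Mapping.lookup m i) = n)"

definition invariant_poly_functions :: "(complex^'d^'d) set \<Rightarrow> (complex^'d \<Rightarrow> complex) set" where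
  "invariant_poly_functions G = {f. (\<exists>p. f = eval_poly p) \<and> (\<forall>\<sigma>\<in>G. act_fun \<sigma> f = f)}"

definition basic_polynomial_map ::
    "(complex^'d^'d) set \<Rightarrow> (complex^'d \<Rightarrow> complex^'d) \<Rightarrow> bool" where
  "basic_polynomial_map G \<theta> \<longleftrightarrow>
     (\<forall>i. \<exists>p. homogeneous p \<and> (\<forall>z. \<theta> z $ i = eval_poly p z)) \<and>
     (\<forall>q. (\<forall>z. eval_poly q (\<theta> z) = 0) \<longrightarrow> q = 0) \<and>
     invariant_poly_functions G = {\<lambda>z. eval_poly q (\<theta> z) | q. True}"

text \<open>For holomorphic \<open>\<theta>\<close> the Frechet derivative is complex linear, so the \<open>(i,j)\<close> entry of
  \<^term>\<open>matrix (frechet_derivative \<theta> (at z))\<close> is the complex partial derivative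
  \<open>\<partial>\<theta>\<^sub>i/\<partial>z\<^sub>j\<close>.\<close>

definition jacobian_det :: "(complex^'d \<Rightarrow> complex^'d) \<Rightarrow> complex^'d \<Rightarrow> complex" where
  "jacobian_det \<theta> z = det (matrix (frechet_derivative \<theta> (at z)))"

section \<open>Reflecting hyperplanes and the polynomial of a one-dimensional representation\<close>

definition reflecting_hyperplanes :: "(complex^'d^'d) set \<Rightarrow> (complex^'d) set set" where
  "reflecting_hyperplanes G =
     {{z. (mat 1 - \<sigma>) *v z = 0} | \<sigma>. \<sigma> \<in> G \<and> complex_reflection \<sigma>}"

definition pointwise_stabilizer ::
    "(complex^'d^'d) set \<Rightarrow> (complex^'d) set \<Rightarrow> (complex^'d^'d) set" where
  "pointwise_stabilizer G H = {\<sigma> \<in> G. \<forall>z\<in>H. act \<sigma> z = z}"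

definition linear_form :: "(complex^'d \<Rightarrow> complex) \<Rightarrow> bool" where
  "linear_form l \<longleftrightarrow> Vector_Spaces.linear (*s) (*) l"

text \<open>Here \<open>a H\<close> is a generator of the stabilizer of \<open>H\<close> and \<open>l H\<close> is a
  linear form with zero set \<open>H\<close>.\<close>

definition rep_poly ::
    "(complex^'d^'d) set \<Rightarrow> ((complex^'d) set \<Rightarrow> complex^'d^'d) \<Rightarrow>
     ((complex^'d) set \<Rightarrow> complex^'d \<Rightarrow> complex) \<Rightarrow> (complex^'d^'d \<Rightarrow> complex) \<Rightarrow>
     complex^'d \<Rightarrow> complex" where
  "rep_poly G a l \<rho> z =
     (\<Prod>H\<in>reflecting_hyperplanes G. l H z ^ (LEAST c::nat. \<rho> (a H) = det (a H) ^ c))"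

section \<open>Weighted Bergman spaces\<close>

definition holomorphic_several :: "(complex^'d \<Rightarrow> complex) \<Rightarrow> (complex^'d) set \<Rightarrow> bool" where
  "holomorphic_several f D \<longleftrightarrow>
     (\<forall>z\<in>D. \<exists>f'. linear_form f' \<and> (f has_derivative f') (at z))"

text \<open>Lebesgue measure, scaled so that \<open>\<Omega>\<close> has volume \<open>1\<close>.\<close>

definition dV :: "(complex^'d) set \<Rightarrow> (complex^'d) measure" where
  "dV \<Omega> = density lebesgue (\<lambda>_. ennreal (1 / measure lebesgue \<Omega>))"

text \<open>Functions on \<open>D\<close> are represented by total functions that vanish off \<open>D\<close>, so that equality
  in the space is equality on \<open>D\<close>. The values of \<open>\<nu>\<close> on a null set are irrelevant.\<close>

definition bergman_space ::
    "(complex^'d) measure \<Rightarrow> (complex^'d) set \<Rightarrow> (complex^'d \<Rightarrow> real) \<Rightarrow> (complex^'d \<Rightarrow> complex) set"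
  where
  "bergman_space M D \<nu> =
     {f. holomorphic_several f D \<and> (\<forall>z. z \<notin> D \<longrightarrow> f z = 0) \<and>
         set_integrable M D (\<lambda>z. (cmod (f z))\<^sup>2 * \<nu> z)}"

definition bergman_inner ::
    "(complex^'d) measure \<Rightarrow> (complex^'d) set \<Rightarrow> (complex^'d \<Rightarrow> real) \<Rightarrow>
     (complex^'d \<Rightarrow> complex) \<Rightarrow> (complex^'d \<Rightarrow> complex) \<Rightarrow> complex" where
  "bergman_inner M D \<nu> f g = (LINT z:D|M. f z * cnj (g z) * complex_of_real (\<nu> z))"

definition bergman_kernel ::
    "(complex^'d) measure \<Rightarrow> (complex^'d) set \<Rightarrow> (complex^'d \<Rightarrow> real) \<Rightarrow>
     complex^'d \<Rightarrow> complex^'d \<Rightarrow> complex" where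
  "bergman_kernel M D \<nu> z w =
     (THE k. k \<in> bergman_space M D \<nu> \<and>
        (\<forall>f\<in>bergman_space M D \<nu>. f w = bergman_inner M D \<nu> f k)) z"

definition relative_invariant_subspace ::
    "(complex^'d^'d) set \<Rightarrow> (complex^'d^'d \<Rightarrow> complex) \<Rightarrow>
     (complex^'d) measure \<Rightarrow> (complex^'d) set \<Rightarrow> (complex^'d \<Rightarrow> real) \<Rightarrow> (complex^'d \<Rightarrow> complex) set"
  where
  "relative_invariant_subspace G \<rho> M \<Omega> \<omega> =
     {f \<in> bergman_space M \<Omega> \<omega>. \<forall>\<sigma>\<in>G. \<forall>z\<in>\<Omega>. act_fun \<sigma> f z = \<rho> \<sigma> * f z}"

text \<open>The value does not depend on the preimage \<open>z\<close> of \<open>u\<close>. The image of the reflecting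
  hyperplanes, where the weight is not defined, is a null set; the value there is a dummy.\<close>

definition rep_weight ::
    "(complex^'d^'d) set \<Rightarrow> (complex^'d) set \<Rightarrow> (complex^'d \<Rightarrow> complex^'d) \<Rightarrow>
     (complex^'d \<Rightarrow> complex) \<Rightarrow> (complex^'d \<Rightarrow> real) \<Rightarrow> complex^'d \<Rightarrow> real" where
  "rep_weight G \<Omega> \<theta> p \<omega>t u =
     (if u \<in> \<theta> ` \<Omega> - \<theta> ` \<Union>(reflecting_hyperplanes G) then
        (let z = (SOME z. z \<in> \<Omega> \<and> \<theta> z = u)
         in (cmod (p z))\<^sup>2 / (cmod (jacobian_det \<theta> z))\<^sup>2 * \<omega>t u)
      else 0)"

text \<open>A unitary map between two spaces of functions with the given inner products.\<close>

definition isometrically_isomorphic ::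
    "('a \<Rightarrow> complex) set \<Rightarrow> (('a \<Rightarrow> complex) \<Rightarrow> ('a \<Rightarrow> complex) \<Rightarrow> complex) \<Rightarrow>
     ('b \<Rightarrow> complex) set \<Rightarrow> (('b \<Rightarrow> complex) \<Rightarrow> ('b \<Rightarrow> complex) \<Rightarrow> complex) \<Rightarrow> bool" where
  "isometrically_isomorphic H1 ip1 H2 ip2 \<longleftrightarrow>
     (\<exists>T. bij_betw T H1 H2 \<and>
          (\<forall>f\<in>H1. \<forall>g\<in>H1. T (\<lambda>z. f z + g z) = (\<lambda>z. T f z + T g z)) \<and>
          (\<forall>c. \<forall>f\<in>H1. T (\<lambda>z. c * f z) = (\<lambda>z. c * T f z)) \<and>
          (\<forall>f\<in>H1. \<forall>g\<in>H1. ip2 (T f) (T g) = ip1 f g))"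

text \<open>\<open>Q\<close> is the extension to \<open>\<Omega> \<times> \<Omega>\<close>, holomorphic in \<open>z\<close> and antiholomorphic in \<open>w\<close>, of
  \<open>S z w / (p z * cnj (p w))\<close>. It is unique since the zero set of \<open>p\<close>
  has dense complement.\<close>

definition extends_quotient ::
    "(complex^'d) set \<Rightarrow> (complex^'d \<Rightarrow> complex) \<Rightarrow> (complex^'d \<Rightarrow> complex^'d \<Rightarrow> complex) \<Rightarrow>
     (complex^'d \<Rightarrow> complex^'d \<Rightarrow> complex) \<Rightarrow> bool" where
  "extends_quotient \<Omega> p S Q \<longleftrightarrow>
     (\<forall>w\<in>\<Omega>. holomorphic_several (\<lambda>z. Q z w) \<Omega>) \<and>
     (\<forall>z\<in>\<Omega>. holomorphic_several (\<lambda>w. cnj (Q z w)) \<Omega>) \<and>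
     (\<forall>z\<in>\<Omega>. \<forall>w\<in>\<Omega>. p z \<noteq> 0 \<and> p w \<noteq> 0 \<longrightarrow>
        Q z w = 1 / (p z * cnj (p w)) * S z w)"

end

theory Submission
  imports Defs "HOL-Complex_Analysis.Conformal_Mappings"
begin

text \<open>
  Write \<open>l\<^sub>\<rho>\<close> for the product of the linear forms with the exponents that belong to \<open>\<rho>\<close>, and \<open>J\<close> for the
  Jacobian determinant of \<open>\<theta>\<close>. The isometry is the inverse of \<open>h \<mapsto> |G|\<^sup>-\<^sup>1\<^sup>/\<^sup>2 l\<^sub>\<rho> (h \<circ> \<theta>)\<close>. Four facts make this map
  unitary from the Bergman space of \<open>\<theta>(\<Omega>)\<close> onto the relative invariants and give the kernel formula.

  Relative invariants are divisible by \<open>l\<^sub>\<rho>\<close> (\<open>relative_invariant_divisible\<close>). If \<open>a\<close> generates the stabilizer of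
  a reflecting hyperplane, a relative invariant \<open>f\<close> satisfies \<open>f(a z) = (det a)\<^sup>c f(z)\<close>, where the exponent \<open>c\<close> is minimal.
  As long as the factor is not \<open>1\<close>, the function vanishes on the hyperplane, which \<open>a\<close> fixes pointwise, and division
  by the linear form lowers the exponent by one. Different hyperplanes are treated independently, as the linear forms are
  pairwise not proportional. The polynomial \<open>l\<^sub>\<rho>\<close> transforms by \<open>\<rho>\<close> itself; this is checked on reflections, which permute
  the other hyperplanes (\<open>L_semi_invariant\<close>). So the quotient \<open>f / l\<^sub>\<rho>\<close> is invariant.

  Invariant holomorphic functions are holomorphic functions of \<open>\<theta>\<close> (\<open>invariant_holomorphic_descends\<close>). Averages of
  interpolation polynomials show that \<open>\<theta>\<close> separates the orbits and has invertible derivative at the points with trivial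
  stabilizer. By homogeneity, preimages of bounded sets are bounded; hence \<open>\<theta>\<close> is closed, surjective and open.
  Off the zero set of a polynomial \<open>\<Delta>\<close> it has local holomorphic inverses, and a continuous function that is
  holomorphic off this zero set is holomorphic. The last step is Riemann's extension theorem, in which
  averages over roots of unity on a small circle, uniformly convergent by Cauchy's inequalities, replace an integral that
  depends on parameters.

  Integrals over \<open>\<Omega>\<close> and \<open>\<theta>(\<Omega>)\<close> are related by \<open>\<integral>\<^sub>\<Omega> |J|\<^sup>2 (F \<circ> \<theta>) = |G| \<integral>\<^bsub>\<theta>(\<Omega>)\<^esub> F\<close> (\<open>integral_over_quotient\<close>). The real
  Jacobian is the squared modulus of the complex one, and the inequalities \<open>\<langle>z, v\<rangle> < \<langle>A z, v\<rangle>\<close> for a generic vector \<open>v\<close> define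
  a fundamental domain. With the weight \<open>\<omega>\<^sub>\<rho>\<close> the factor \<open>|J|\<^sup>2\<close> cancels, and \<open>|l\<^sub>\<rho>|\<^sup>2\<close> remains.

  The kernels represent evaluations. Evaluations are bounded by the mean value property, so Riesz's theorem, proved
  by the parallelogram law and the completeness of the Bergman space, applies. On \<open>\<theta>(\<Omega>)\<close>, where the weight can degenerate
  near the image of the hyperplanes, boundedness is obtained from the relative invariants, at zeros of \<open>l\<^sub>\<rho>\<close> by
  Cauchy's estimate on a circle that avoids the zeros. Finally, the group average of the kernel of \<open>\<Omega>\<close> represents \<open>|G|\<close> times the
  evaluation on the relative invariants (\<open>averaged_kernel\<close>), and so does the multiple of the transported kernel
  that appears in the formula. Two representers of one functional are equal.
\<close>

section \<open>Holomorphic functions of several variables\<close>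

lemma linear_form_iff:
  "linear_form f \<longleftrightarrow> (\<forall>x y. f (x + y) = f x + f y) \<and> (\<forall>c x. f (c *s x) = c * f x)"
  for f :: "complex^'d \<Rightarrow> complex"
  unfolding linear_form_def Vector_Spaces.linear_def module_hom_def module_hom_axioms_def
  by (simp add: vec.vector_space_axioms vector_space_over_itself.vector_space_axioms
      vec.module_axioms vector_space_over_itself.module_axioms)

lemma linear_form_0 [simp]: "linear_form (\<lambda>x. 0)"
  by (simp add: linear_form_iff)

lemma linear_form_add: "linear_form f \<Longrightarrow> f (x + y) = f x + f y"
  and linear_form_scale: "linear_form f \<Longrightarrow> f (c *s x) = c * f x"
  by (simp_all add: linear_form_iff)

lemma linear_form_zero: "linear_form f \<Longrightarrow> f 0 = 0"
  by (metis linear_form_scale mult_zero_left vector_smult_lzero)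

lemma linear_form_diff: "linear_form f \<Longrightarrow> f (x - y) = f x - f y"
  by (metis linear_form_add add_diff_cancel_right' diff_add_cancel)

lemma scaleR_eq_smult: "c *\<^sub>R (x :: complex^'d) = complex_of_real c *s x"
  by (vector scaleR_conv_of_real)

lemma linear_form_linear: "linear_form f \<Longrightarrow> linear f"
  by (intro linearI) (auto simp: linear_form_iff scaleR_eq_smult scaleR_conv_of_real)

lemma linear_form_bounded_linear: "linear_form f \<Longrightarrow> bounded_linear f"
  for f :: "complex^'d \<Rightarrow> complex"
  using linear_form_linear linear_conv_bounded_linear by blast

lemma norm_smult [simp]: "norm (c *s (x :: complex^'d)) = cmod c * norm x"
  by (simp add: norm_vec_def L2_set_def norm_mult power_mult_distrib real_sqrt_mult
      flip: sum_distrib_left)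

lemma bounded_linear_smult_left: "bounded_linear (\<lambda>c::complex. c *s (x :: complex^'d))"
  by (rule bounded_linear_intro[where K = "norm x"])
    (auto simp: vector_sadd_rdistrib scaleR_eq_smult vector_smult_assoc scaleR_conv_of_real)

lemma continuous_on_smult [continuous_intros]:
  "continuous_on A f \<Longrightarrow> continuous_on A g \<Longrightarrow> continuous_on A (\<lambda>x. f x *s (g x :: complex^'d))"
  unfolding vector_scalar_mult_def by (intro continuous_intros)

lemma holomorphic_several_subset:
  "holomorphic_several f D \<Longrightarrow> E \<subseteq> D \<Longrightarrow> holomorphic_several f E"
  by (auto simp: holomorphic_several_def)

lemma holomorphic_several_continuous_on:
  "holomorphic_several f D \<Longrightarrow> continuous_on D f"
  unfolding holomorphic_several_def
  by (meson continuous_at_imp_continuous_on has_derivative_continuous)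

lemma holomorphic_several_transform:
  assumes "holomorphic_several f D" "open D" "\<And>z. z \<in> D \<Longrightarrow> f z = g z"
  shows "holomorphic_several g D"
  using assms unfolding holomorphic_several_def
  by (meson has_derivative_transform_within_open)

lemma holomorphic_several_const [simp]: "holomorphic_several (\<lambda>z. c) D"
  unfolding holomorphic_several_def by (metis (no_types) has_derivative_const linear_form_0)

lemma holomorphic_several_linear_form: "linear_form l \<Longrightarrow> holomorphic_several l D"
  unfolding holomorphic_several_def
  using bounded_linear_imp_has_derivative linear_form_bounded_linear by blast

lemma holomorphic_several_add:
  assumes "holomorphic_several f D" "holomorphic_several g D"
  shows "holomorphic_several (\<lambda>z. f z + g z) D"
  unfolding holomorphic_several_def
proof
  fix z assume "z \<in> D"
  then obtain f' g' where "linear_form f'" "linear_form g'"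
    "(f has_derivative f') (at z)" "(g has_derivative g') (at z)"
    using assms unfolding holomorphic_several_def by meson
  then show "\<exists>h. linear_form h \<and> ((\<lambda>z. f z + g z) has_derivative h) (at z)"
    by (intro exI[of _ "\<lambda>x. f' x + g' x"])
      (auto intro: has_derivative_add simp: linear_form_iff algebra_simps)
qed

lemma holomorphic_several_mult:
  assumes "holomorphic_several f D" "holomorphic_several g D"
  shows "holomorphic_several (\<lambda>z. f z * g z) D"
  unfolding holomorphic_several_def
proof
  fix z assume "z \<in> D"
  then obtain f' g' where "linear_form f'" "linear_form g'"
    "(f has_derivative f') (at z)" "(g has_derivative g') (at z)"
    using assms unfolding holomorphic_several_def by meson
  then show "\<exists>h. linear_form h \<and> ((\<lambda>z. f z * g z) has_derivative h) (at z)"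
    by (intro exI[of _ "\<lambda>x. f z * g' x + f' x * g z"])
      (auto intro: has_derivative_mult simp: linear_form_iff algebra_simps)
qed

lemma holomorphic_several_cmult:
  "holomorphic_several f D \<Longrightarrow> holomorphic_several (\<lambda>z. c * f z) D"
  by (intro holomorphic_several_mult) auto

lemma holomorphic_several_diff:
  assumes "holomorphic_several f D" "holomorphic_several g D"
  shows "holomorphic_several (\<lambda>z. f z - g z) D"
  using holomorphic_several_add[OF assms(1) holomorphic_several_cmult[OF assms(2), of "-1"]] by simp

lemma holomorphic_several_power:
  "holomorphic_several f D \<Longrightarrow> holomorphic_several (\<lambda>z. f z ^ n) D"
  by (induction n) (auto intro: holomorphic_several_mult)

lemma holomorphic_several_sum:
  "(\<And>i. i \<in> I \<Longrightarrow> holomorphic_several (f i) D) \<Longrightarrow> holomorphic_several (\<lambda>z. \<Sum>i\<in>I. f i z) D"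
  by (induction I rule: infinite_finite_induct) (auto intro: holomorphic_several_add)

lemma holomorphic_several_prod:
  "(\<And>i. i \<in> I \<Longrightarrow> holomorphic_several (f i) D) \<Longrightarrow> holomorphic_several (\<lambda>z. \<Prod>i\<in>I. f i z) D"
  by (induction I rule: infinite_finite_induct) (auto intro: holomorphic_several_mult)

lemma holomorphic_several_inverse:
  assumes "holomorphic_several f D" "\<And>z. z \<in> D \<Longrightarrow> f z \<noteq> 0"
  shows "holomorphic_several (\<lambda>z. inverse (f z)) D"
  unfolding holomorphic_several_def
proof
  fix z assume z: "z \<in> D"
  then obtain f' where "linear_form f'" "(f has_derivative f') (at z)"
    using assms unfolding holomorphic_several_def by meson
  then show "\<exists>h. linear_form h \<and> ((\<lambda>z. inverse (f z)) has_derivative h) (at z)"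
    using Deriv.has_derivative_inverse[where f = f and f' = f' and S = UNIV, OF assms(2)[OF z]]
    by (intro exI[of _ "\<lambda>h. - (inverse (f z) * f' h * inverse (f z))"])
      (auto simp: linear_form_iff algebra_simps)
qed

lemma holomorphic_several_divide:
  assumes "holomorphic_several f D" "holomorphic_several g D" "\<And>z. z \<in> D \<Longrightarrow> g z \<noteq> 0"
  shows "holomorphic_several (\<lambda>z. f z / g z) D"
  using holomorphic_several_mult[OF assms(1) holomorphic_several_inverse[OF assms(2,3)]]
  by (simp add: divide_inverse)

lemma holomorphic_map_derivative:
  fixes \<phi> :: "complex^'m \<Rightarrow> complex^'d"
  assumes "\<And>i. holomorphic_several (\<lambda>z. \<phi> z $ i) D" "z \<in> D"
  obtains \<phi>' where "(\<phi> has_derivative \<phi>') (at z)"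
    "\<And>c x. \<phi>' (c *s x) = c *s \<phi>' x"
proof -
  have "\<forall>i. \<exists>h. linear_form h \<and> ((\<lambda>z. \<phi> z $ i) has_derivative h) (at z)"
    using assms unfolding holomorphic_several_def by blast
  then obtain h where h: "\<And>i. linear_form (h i)" "\<And>i. ((\<lambda>z. \<phi> z $ i) has_derivative h i) (at z)"
    by metis
  have "(\<phi> has_derivative (\<lambda>x. \<chi> i. h i x)) (at z)"
    by (subst has_derivative_componentwise_within)
      (auto simp: Basis_vec_def inner_axis intro!: has_derivative_inner_left h(2))
  then show ?thesis
    by (rule that) (simp add: vec_eq_iff h(1) linear_form_scale)
qed

lemma holomorphic_several_compose:
  fixes \<phi> :: "complex^'m \<Rightarrow> complex^'d"
  assumes f: "holomorphic_several f E" and \<phi>: "\<And>i. holomorphic_several (\<lambda>z. \<phi> z $ i) D"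
    and sub: "\<phi> ` D \<subseteq> E"
  shows "holomorphic_several (\<lambda>z. f (\<phi> z)) D"
  unfolding holomorphic_several_def
proof
  fix z assume z: "z \<in> D"
  obtain \<phi>' where \<phi>': "(\<phi> has_derivative \<phi>') (at z)" "\<And>c x. \<phi>' (c *s x) = c *s \<phi>' x"
    using holomorphic_map_derivative[OF \<phi> z] by blast
  obtain f' where f': "linear_form f'" "(f has_derivative f') (at (\<phi> z))"
    using f sub z unfolding holomorphic_several_def by blast
  have "linear_form (\<lambda>x. f' (\<phi>' x))"
    using f'(1) has_derivative_bounded_linear[OF \<phi>'(1)]
    by (auto simp: linear_form_iff \<phi>' bounded_linear.linear linear_add)
  then show "\<exists>h. linear_form h \<and> ((\<lambda>z. f (\<phi> z)) has_derivative h) (at z)"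
    using has_derivative_compose[OF \<phi>'(1) f'(2)] by blast
qed

lemma holomorphic_several_matrix:
  "holomorphic_several (\<lambda>z. ((A :: complex^'m^'d) *v z + b) $ i) D"
proof -
  have "linear_form (\<lambda>z. (A *v z) $ i)"
    by (simp add: linear_form_iff matrix_vector_right_distrib vec.scale)
  then show ?thesis
    by (auto intro: holomorphic_several_add holomorphic_several_linear_form)
qed

lemma holomorphic_several_line_deriv:
  assumes "(f has_derivative f') (at (z + \<zeta> *s v))" "linear_form f'"
  shows "((\<lambda>\<zeta>. f (z + \<zeta> *s v)) has_field_derivative f' v) (at \<zeta>)"
proof -
  have "((\<lambda>\<zeta>. z + \<zeta> *s v) has_derivative (\<lambda>\<zeta>. \<zeta> *s v)) (at \<zeta>)"
    by (rule has_derivative_eq_rhs[OF has_derivative_add[OF has_derivative_const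
            bounded_linear_imp_has_derivative[OF bounded_linear_smult_left]]]) auto
  from has_derivative_compose[OF this assms(1)] show ?thesis
    unfolding has_field_derivative_def
    by (rule has_derivative_eq_rhs) (auto simp: fun_eq_iff linear_form_scale[OF assms(2)])
qed

lemma holomorphic_several_line:
  assumes f: "holomorphic_several f D" and S: "\<And>\<zeta>. \<zeta> \<in> S \<Longrightarrow> z + \<zeta> *s v \<in> D"
  shows "(\<lambda>\<zeta>. f (z + \<zeta> *s v)) holomorphic_on S"
  unfolding holomorphic_on_def
proof
  fix \<zeta> assume "\<zeta> \<in> S"
  from S[OF this] obtain f' where f': "linear_form f'" "(f has_derivative f') (at (z + \<zeta> *s v))"
    using f unfolding holomorphic_several_def by blast
  have "((\<lambda>\<zeta>. f (z + \<zeta> *s v)) has_field_derivative f' v) (at \<zeta>)"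
    by (rule holomorphic_several_line_deriv[OF f'(2,1)])
  then show "(\<lambda>\<zeta>. f (z + \<zeta> *s v)) field_differentiable at \<zeta> within S"
    unfolding field_differentiable_def by - (rule exI, erule has_field_derivative_at_within)
qed

section \<open>Averages over roots of unity\<close>

lemma sum_roots_of_unity_power:
  assumes "0 < n" "n < N"
  shows "(\<Sum>k<N. cis (2 * pi * real k / real N) ^ n) = 0"
proof -
  let ?w = "cis (2 * pi * real n / real N)"
  have N: "N > 0" using assms by simp
  have ne: "?w \<noteq> 1"
  proof
    assume "?w = 1"
    then have "cos (2 * pi * real n / real N) = 1"
      by (simp add: complex_eq_iff)
    then obtain m :: int where m: "2 * pi * real n / real N = of_int m * 2 * pi"
      using cos_one_2pi_int by blast
    then have "real n = of_int m * real N"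
      using N by (simp add: field_simps)
    then have "int n = m * int N"
      by (metis of_int_eq_iff of_int_mult of_int_of_nat_eq)
    then have "int N dvd int n" by simp
    then show False using assms by (auto dest: zdvd_imp_le)
  qed
  have "cis (2 * pi * real k / real N) ^ n = ?w ^ k" for k
    unfolding Complex.DeMoivre by (rule arg_cong[of _ _ cis]) simp
  then have "(\<Sum>k<N. cis (2 * pi * real k / real N) ^ n) = (\<Sum>k<N. ?w ^ k)" by simp
  also have "\<dots> = (?w ^ N - 1) / (?w - 1)"
    using ne by (rule geometric_sum)
  also have "?w ^ N = 1"
  proof -
    have "?w ^ N = cis (2 * pi * real n)"
      using N by (simp add: Complex.DeMoivre)
    then show ?thesis by (simp add: cis_multiple_2pi)
  qed
  finally show ?thesis by simp
qed

text \<open>In the power series of \<open>g\<close> at \<open>0\<close> the average over the \<open>N\<close>-th roots of unity kills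
  the terms of order \<open>1, \<dots>, N - 1\<close>; Cauchy's inequalities bound the rest by a geometric series.\<close>

lemma mean_roots_of_unity:
  assumes g: "g holomorphic_on ball 0 R" and cont: "continuous_on (cball 0 R) g"
    and B: "\<And>\<zeta>. cmod \<zeta> = R \<Longrightarrow> cmod (g \<zeta>) \<le> B"
    and \<xi>: "cmod \<xi> \<le> r" and r: "0 < r" "r < R" and N: "0 < N"
  shows "cmod ((\<Sum>k<N. g (cis (2 * pi * real k / real N) * \<xi>)) / of_nat N - g 0)
          \<le> B * (r / R) ^ N / (1 - r / R)"
proof -
  let ?a = "\<lambda>n. (deriv ^^ n) g 0 / fact n" and ?w = "\<lambda>k. cis (2 * pi * real k / real N)"
  let ?c = "\<lambda>n. (\<Sum>k<N. ?w k ^ n) / of_nat N" and ?q = "r / R"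
  have "cmod (?w k * \<xi>) < R" for k
    using \<xi> r by (simp add: norm_mult)
  then have "(\<lambda>n. ?a n * (?w k * \<xi>) ^ n) sums g (?w k * \<xi>)" for k
    using holomorphic_power_series[OF g, of "?w k * \<xi>"] by (auto simp: dist_norm)
  then have "(\<lambda>n. \<Sum>k<N. ?a n * (?w k * \<xi>) ^ n) sums (\<Sum>k<N. g (?w k * \<xi>))"
    by (intro sums_sum) auto
  then have "(\<lambda>n. (\<Sum>k<N. ?a n * (?w k * \<xi>) ^ n) / of_nat N) sums ((\<Sum>k<N. g (?w k * \<xi>)) / of_nat N)"
    by (intro sums_divide)
  moreover have "(\<Sum>k<N. ?a n * (?w k * \<xi>) ^ n) / of_nat N = ?a n * \<xi> ^ n * ?c n" for n
    by (simp add: power_mult_distrib sum_distrib_left sum_distrib_right mult_ac sum_divide_distrib)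
  ultimately have s: "(\<lambda>n. ?a n * \<xi> ^ n * ?c n) sums ((\<Sum>k<N. g (?w k * \<xi>)) / of_nat N)"
    by simp
  have c0: "?c 0 = 1" using N by simp
  have c1: "cmod (?c n) \<le> 1" for n
  proof -
    have "cmod (\<Sum>k<N. ?w k ^ n) \<le> (\<Sum>k<N. 1)"
      by (rule sum_norm_le) (simp add: norm_power)
    then show ?thesis using N by (simp add: norm_divide)
  qed
  have q: "0 < ?q" "?q < 1" using r by auto
  have B0: "0 \<le> B"
    using B[of "complex_of_real R"] r norm_ge_zero[of "g (complex_of_real R)"] by (simp del: norm_ge_zero)
  have bound: "cmod (?a n * \<xi> ^ n) \<le> B * ?q ^ n" for n
  proof -
    have "cmod ((deriv ^^ n) g 0) \<le> fact n * B / R ^ n"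
      by (rule Cauchy_inequality[OF g cont]) (use r B in auto)
    then have "cmod (?a n) \<le> B / R ^ n"
      by (simp add: norm_divide field_simps)
    then have "cmod (?a n) * cmod \<xi> ^ n \<le> B / R ^ n * r ^ n"
      by (intro mult_mono power_mono \<xi>) (use B0 r in auto)
    then show ?thesis by (simp only: norm_mult norm_power power_divide) simp
  qed
  \<comment> \<open>The terms of index \<open>0 < n < N\<close> vanish, so the tail starts at \<open>n = N\<close>.\<close>
  have head: "(\<Sum>n<N. ?a n * \<xi> ^ n * ?c n) = g 0"
  proof -
    have "(\<Sum>n<N. ?a n * \<xi> ^ n * ?c n) = (\<Sum>n\<in>{0}. ?a n * \<xi> ^ n * ?c n)"
      using N sum_roots_of_unity_power[of _ N] by (intro sum.mono_neutral_right) auto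
    then show ?thesis using c0 by simp
  qed
  have "(\<lambda>n. ?a (n + N) * \<xi> ^ (n + N) * ?c (n + N)) sums
      ((\<Sum>k<N. g (?w k * \<xi>)) / of_nat N - g 0)"
    using sums_iff_shift[of "\<lambda>n. ?a n * \<xi> ^ n * ?c n" N] s head
    by (simp add: sums_iff_shift')
  then have "((\<Sum>k<N. g (?w k * \<xi>)) / of_nat N - g 0) =
      suminf (\<lambda>n. ?a (n + N) * \<xi> ^ (n + N) * ?c (n + N))" by (simp add: sums_iff)
  also have "cmod \<dots> \<le> suminf (\<lambda>n. B * ?q ^ (n + N))"
  proof (rule norm_suminf_le)
    fix n
    have "cmod (?a (n + N) * \<xi> ^ (n + N)) * cmod (?c (n + N)) \<le> B * ?q ^ (n + N) * 1"
      using q B0 by (intro mult_mono bound c1) auto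
    then show "cmod (?a (n + N) * \<xi> ^ (n + N) * ?c (n + N)) \<le> B * ?q ^ (n + N)"
      by (simp only: norm_mult mult_1_right)
    show "summable (\<lambda>n. B * ?q ^ (n + N))"
      using q by (simp add: power_add summable_mult summable_mult2 summable_geometric)
  qed
  also have "\<dots> = B * ?q ^ N / (1 - ?q)"
  proof -
    have "(\<lambda>n. B * ?q ^ N * ?q ^ n) sums (B * ?q ^ N * (1 / (1 - ?q)))"
      using q by (intro sums_mult geometric_sums) auto
    then show ?thesis by (simp add: sums_iff power_add mult_ac)
  qed
  finally show ?thesis .
qed


section \<open>Limits and removable singularities\<close>

lemma holomorphic_several_deriv_bound:
  assumes f: "holomorphic_several f (ball p (2 * s))" and x: "x \<in> ball p s" and s: "s > 0"
    and B: "\<And>z. z \<in> ball p (2 * s) \<Longrightarrow> cmod (f z) \<le> B"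
    and f': "(f has_derivative f') (at x)" "linear_form f'"
  shows "cmod (f' h) \<le> 2 * B / s * norm h"
proof (cases "h = 0")
  case True
  then show ?thesis using linear_form_zero[OF f'(2)] by simp
next
  case False
  define r where "r = s / 2 / norm h"
  have r: "r > 0" using s False by (simp add: r_def)
  have sub: "x + \<zeta> *s h \<in> ball p (2 * s)" if "cmod \<zeta> \<le> r" for \<zeta>
  proof -
    have "cmod \<zeta> * norm h \<le> s / 2"
      using that False by (simp add: r_def field_simps)
    moreover have "dist p (x + \<zeta> *s h) \<le> dist p x + cmod \<zeta> * norm h"
      using dist_triangle[of p "x + \<zeta> *s h" x] by (simp add: dist_norm)
    ultimately show ?thesis using x s by simp
  qed
  have hol: "(\<lambda>\<zeta>. f (x + \<zeta> *s h)) holomorphic_on (cball 0 r)"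
    by (rule holomorphic_several_line[OF f]) (use sub in auto)
  have "cmod ((deriv ^^ 1) (\<lambda>\<zeta>. f (x + \<zeta> *s h)) 0) \<le> fact 1 * B / r ^ 1"
  proof (rule Cauchy_inequality)
    show "(\<lambda>\<zeta>. f (x + \<zeta> *s h)) holomorphic_on ball 0 r"
      using hol by (rule holomorphic_on_subset) auto
    show "continuous_on (cball 0 r) (\<lambda>\<zeta>. f (x + \<zeta> *s h))"
      using hol by (rule holomorphic_on_imp_continuous_on)
  qed (use r B sub in auto)
  moreover have "deriv (\<lambda>\<zeta>. f (x + \<zeta> *s h)) 0 = f' h"
    by (rule DERIV_imp_deriv, rule holomorphic_several_line_deriv) (use f' in auto)
  ultimately have "cmod (f' h) \<le> B / r" by simp
  also have "\<dots> = 2 * B / s * norm h" by (simp add: r_def)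
  finally show ?thesis .
qed

text \<open>By Cauchy's inequality on complex lines, uniform convergence of the functions forces
  uniform convergence of the derivatives.\<close>

lemma holomorphic_several_uniform_limit:
  fixes f :: "nat \<Rightarrow> complex^'d \<Rightarrow> complex"
  assumes hol: "\<And>n. holomorphic_several (f n) D" and D: "open D"
    and lim: "uniform_limit D f g sequentially"
  shows "holomorphic_several g D"
  unfolding holomorphic_several_def
proof
  fix p assume p: "p \<in> D"
  obtain s0 where s0: "s0 > 0" "ball p s0 \<subseteq> D"
    using D p openE by blast
  define s where "s = s0 / 2"
  have s: "s > 0" "ball p (2 * s) \<subseteq> D" using s0 by (auto simp: s_def)
  have sub: "ball p s \<subseteq> D" using s s0 by (auto simp: s_def)
  have "\<exists>h. linear_form h \<and> (f n has_derivative h) (at z)" if "z \<in> ball p s" for n z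
    using hol[of n] that sub unfolding holomorphic_several_def by blast
  then have "\<forall>n. \<exists>F. \<forall>z\<in>ball p s. linear_form (F z) \<and> (f n has_derivative F z) (at z)"
    by (intro allI bchoice) blast
  from choice[OF this] obtain f' where f': "\<And>n z. z \<in> ball p s \<Longrightarrow> linear_form (f' n z)"
    "\<And>n z. z \<in> ball p s \<Longrightarrow> (f n has_derivative f' n z) (at z)"
    by blast
  have cauchy: "\<exists>N. \<forall>m\<ge>N. \<forall>n\<ge>N. \<forall>x\<in>ball p s. \<forall>h. cmod (f' m x h - f' n x h) \<le> e * norm h"
    if e: "e > 0" for e
  proof -
    have "e * s / 2 > 0" using e s by simp
    then have "\<exists>N. \<forall>x\<in>D. \<forall>m\<ge>N. \<forall>n\<ge>N. dist (f m x) (f n x) < e * s / 2"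
      using uniformly_convergent_Cauchy[of D f] uniformly_convergentI[OF lim]
      unfolding uniformly_Cauchy_on_def by blast
    then obtain N where N: "\<And>x m n. x \<in> D \<Longrightarrow> m \<ge> N \<Longrightarrow> n \<ge> N \<Longrightarrow> dist (f m x) (f n x) < e * s / 2"
      by blast
    have "cmod (f' m x h - f' n x h) \<le> e * norm h"
      if "m \<ge> N" "n \<ge> N" "x \<in> ball p s" for m n x h
    proof -
      have "cmod (f' m x h - f' n x h) \<le> 2 * (e * s / 2) / s * norm h"
      proof (rule holomorphic_several_deriv_bound[where f = "\<lambda>z. f m z - f n z" and p = p and x = x])
        show "holomorphic_several (\<lambda>z. f m z - f n z) (ball p (2 * s))"
          using hol s by (intro holomorphic_several_diff) (auto intro: holomorphic_several_subset)
        show "((\<lambda>z. f m z - f n z) has_derivative (\<lambda>h. f' m x h - f' n x h)) (at x)"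
          using f'(2)[OF that(3)] by (intro has_derivative_diff)
        show "linear_form (\<lambda>h. f' m x h - f' n x h)"
          using f'(1)[OF that(3)] by (auto simp: linear_form_iff algebra_simps)
        show "cmod (f m z - f n z) \<le> e * s / 2" if "z \<in> ball p (2 * s)" for z
          using N[of z m n] that \<open>m \<ge> N\<close> \<open>n \<ge> N\<close> s(2) by (force simp: dist_norm)
      qed (use s that in auto)
      then show ?thesis using s by simp
    qed
    then show ?thesis by blast
  qed
  define g' where "g' x h = lim (\<lambda>n. f' n x h)" for x h
  have g': "(\<lambda>n. f' n x h) \<longlonglongrightarrow> g' x h" if x: "x \<in> ball p s" for x h
  proof -
    have "Cauchy (\<lambda>n. f' n x h)"
      unfolding Cauchy_def
    proof (intro allI impI)
      fix e :: real assume e: "e > 0"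
      have "e / (2 * (norm h + 1)) > 0"
        using e by (intro divide_pos_pos mult_pos_pos add_nonneg_pos) auto
      then obtain N where N: "\<And>m n. m \<ge> N \<Longrightarrow> n \<ge> N \<Longrightarrow>
          cmod (f' m x h - f' n x h) \<le> e / (2 * (norm h + 1)) * norm h"
        using cauchy x by meson
      have "e / (2 * (norm h + 1)) * norm h < e"
      proof -
        have "norm h / (2 * (norm h + 1)) < 1"
          by (subst divide_less_eq_1_pos) (auto intro: add_nonneg_pos)
        then have "e * (norm h / (2 * (norm h + 1))) < e * 1"
          using e by (intro mult_strict_left_mono)
        then show ?thesis by simp
      qed
      then show "\<exists>M. \<forall>m\<ge>M. \<forall>n\<ge>M. dist (f' m x h) (f' n x h) < e"
        unfolding dist_norm using N by (meson le_less_trans)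
    qed
    then show ?thesis
      unfolding g'_def by (simp add: Cauchy_convergent_iff convergent_LIMSEQ_iff)
  qed
  have nle: "\<forall>\<^sub>F n in sequentially. \<forall>x\<in>ball p s. \<forall>h. cmod (f' n x h - g' x h) \<le> e * norm h"
    if e: "e > 0" for e
  proof -
    obtain N where N: "\<And>m n x h. m \<ge> N \<Longrightarrow> n \<ge> N \<Longrightarrow> x \<in> ball p s \<Longrightarrow> cmod (f' m x h - f' n x h) \<le> e * norm h"
      using cauchy[OF e] by blast
    have "cmod (f' m x h - g' x h) \<le> e * norm h" if "m \<ge> N" "x \<in> ball p s" for m x h
    proof (rule tendsto_upperbound)
      show "(\<lambda>n. cmod (f' m x h - f' n x h)) \<longlonglongrightarrow> cmod (f' m x h - g' x h)"
        by (intro tendsto_intros g' that)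
      show "\<forall>\<^sub>F n in sequentially. cmod (f' m x h - f' n x h) \<le> e * norm h"
        using N that unfolding eventually_sequentially by blast
    qed simp
    then show ?thesis unfolding eventually_sequentially by blast
  qed
  have pt: "(\<lambda>n. f n x) \<longlonglongrightarrow> g x" if "x \<in> D" for x
    using tendsto_uniform_limitI[OF lim that] .
  have "\<exists>G. \<forall>x\<in>ball p s. (\<lambda>n. f n x) \<longlonglongrightarrow> G x \<and> (G has_derivative g' x) (at x within ball p s)"
    by (rule has_derivative_sequence[where f' = f' and ?x0.0 = p])
      (use s p f'(2) nle pt in \<open>auto intro: has_derivative_at_withinI\<close>)
  then obtain G where G: "\<And>x. x \<in> ball p s \<Longrightarrow> (\<lambda>n. f n x) \<longlonglongrightarrow> G x"
    "\<And>x. x \<in> ball p s \<Longrightarrow> (G has_derivative g' x) (at x within ball p s)" by blast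
  have "G x = g x" if "x \<in> ball p s" for x
    using LIMSEQ_unique[OF G(1)[OF that] pt] that sub by blast
  moreover have "(G has_derivative g' p) (at p)"
    using G(2)[of p] s at_within_open[of p "ball p s"] by simp
  ultimately have "(g has_derivative g' p) (at p)"
    using s by (intro has_derivative_transform_within_open[where f = G and s = "ball p s" and g = g]) auto
  moreover have "linear_form (g' p)"
    unfolding linear_form_iff
  proof (intro conjI allI)
    have ps: "p \<in> ball p s" using s by simp
    fix x y c
    have "(\<lambda>n. f' n p x + f' n p y) \<longlonglongrightarrow> g' p (x + y)"
      using g'[OF ps, of "x + y"] f'(1)[OF ps] by (simp add: linear_form_add)
    then show "g' p (x + y) = g' p x + g' p y"
      using LIMSEQ_unique tendsto_add[OF g'[OF ps] g'[OF ps]] by blast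
    have "(\<lambda>n. c * f' n p x) \<longlonglongrightarrow> g' p (c *s x)"
      using g'[OF ps, of "c *s x"] f'(1)[OF ps] by (simp add: linear_form_scale)
    then show "g' p (c *s x) = c * g' p x"
      using LIMSEQ_unique tendsto_mult_left[OF g'[OF ps]] by blast
  qed
  ultimately show "\<exists>h. linear_form h \<and> (g has_derivative h) (at p)" by blast
qed

text \<open>The function is the uniform limit of its averages over the points \<open>z + \<zeta> v\<close>,
  \<open>\<zeta>\<close> running through the \<open>N\<close>-th roots of \<open>r\<^sup>N\<close>. These averages only involve points
  at which holomorphy is known.\<close>

lemma holomorphic_several_from_circles:
  assumes U: "open U" and r: "0 < r" "r < R"
    and line: "\<And>z. z \<in> U \<Longrightarrow> (\<lambda>\<zeta>. g (z + \<zeta> *s v)) holomorphic_on cball 0 R"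
    and B: "\<And>z \<zeta>. z \<in> U \<Longrightarrow> cmod \<zeta> = R \<Longrightarrow> cmod (g (z + \<zeta> *s v)) \<le> B"
    and hol: "\<And>\<zeta>. cmod \<zeta> = r \<Longrightarrow> holomorphic_several g ((\<lambda>z. z + \<zeta> *s v) ` U)"
  shows "holomorphic_several g U"
proof (rule holomorphic_several_uniform_limit[OF _ U])
  let ?w = "\<lambda>N k. cis (2 * pi * real k / real N)"
  let ?A = "\<lambda>N z. (\<Sum>k<Suc N. g (z + (?w (Suc N) k * of_real r) *s v)) / of_nat (Suc N)"
  show "holomorphic_several (?A N) U" for N
  proof -
    have "holomorphic_several (\<lambda>z. g (z + (?w (Suc N) k * of_real r) *s v)) U" for k
    proof (rule holomorphic_several_compose[OF hol[of "?w (Suc N) k * of_real r"]])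
      show "cmod (?w (Suc N) k * of_real r) = r" using r by (simp add: norm_mult)
      show "holomorphic_several (\<lambda>z. (z + (?w (Suc N) k * of_real r) *s v) $ i) U" for i
        using holomorphic_several_matrix[of "mat 1" "(?w (Suc N) k * of_real r) *s v" i U] by simp
    qed auto
    then have "holomorphic_several (\<lambda>z. (\<Sum>k<Suc N. g (z + (?w (Suc N) k * of_real r) *s v)) * (1 / of_nat (Suc N))) U"
      by (intro holomorphic_several_mult holomorphic_several_sum) auto
    then show ?thesis by simp
  qed
  show "uniform_limit U ?A g sequentially"
  proof (rule uniform_limitI)
    fix e :: real assume e: "e > 0"
    have "(\<lambda>N. B / (1 - r / R) * (r / R) ^ N) \<longlonglongrightarrow> B / (1 - r / R) * 0"
      using r by (intro tendsto_mult_left LIMSEQ_realpow_zero) auto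
    then have "(\<lambda>N. B / (1 - r / R) * (r / R) ^ Suc N) \<longlonglongrightarrow> 0"
      using LIMSEQ_Suc by fastforce
    then have "\<forall>\<^sub>F N in sequentially. B / (1 - r / R) * (r / R) ^ Suc N < e"
      using e by (rule order_tendstoD)
    then show "\<forall>\<^sub>F N in sequentially. \<forall>z\<in>U. dist (?A N z) (g z) < e"
    proof eventually_elim
      case (elim N)
      have "cmod (?A N z - g z) < e" if z: "z \<in> U" for z
      proof -
        have "cmod ((\<Sum>k<Suc N. g (z + (?w (Suc N) k * of_real r) *s v)) / of_nat (Suc N) - g (z + 0 *s v))
            \<le> B * (r / R) ^ Suc N / (1 - r / R)"
        proof (rule mean_roots_of_unity[where g = "\<lambda>\<zeta>. g (z + \<zeta> *s v)" and r = r and R = R])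
          show "(\<lambda>\<zeta>. g (z + \<zeta> *s v)) holomorphic_on ball 0 R"
            using line[OF z] by (rule holomorphic_on_subset) auto
          show "continuous_on (cball 0 R) (\<lambda>\<zeta>. g (z + \<zeta> *s v))"
            using line[OF z] by (rule holomorphic_on_imp_continuous_on)
        qed (use r B z in auto)
        moreover have "B * (r / R) ^ Suc N / (1 - r / R) < e"
          using elim by (simp only: times_divide_eq_left)
        ultimately show ?thesis by simp
      qed
      then show ?case by (simp add: dist_norm)
    qed
  qed
qed

lemma compact_disc_tube:
  fixes p v :: "complex^'d"
  assumes "open W" "compact C" "\<And>\<zeta>. \<zeta> \<in> C \<Longrightarrow> p + \<zeta> *s v \<in> W"
  obtains e where "e > 0" "\<And>z \<zeta>. z \<in> ball p e \<Longrightarrow> \<zeta> \<in> C \<Longrightarrow> z + \<zeta> *s v \<in> W"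
proof -
  have "compact ((\<lambda>\<zeta>. p + \<zeta> *s v) ` C)"
    by (intro compact_continuous_image continuous_intros assms)
  then obtain e where e: "e > 0" "(\<Union>x\<in>(\<lambda>\<zeta>. p + \<zeta> *s v) ` C. ball x e) \<subseteq> W"
    using compact_subset_open_imp_ball_epsilon_subset[of "(\<lambda>\<zeta>. p + \<zeta> *s v) ` C" W] assms by blast
  show ?thesis
  proof (rule that[OF e(1)])
    fix z \<zeta> assume "z \<in> ball p e" "\<zeta> \<in> C"
    then have "z + \<zeta> *s v \<in> ball (p + \<zeta> *s v) e" by (simp add: dist_norm)
    then show "z + \<zeta> *s v \<in> W" using e(2) \<open>\<zeta> \<in> C\<close> by blast
  qed
qed

lemma holomorphic_several_localI:
  assumes "\<And>p. p \<in> D \<Longrightarrow> \<exists>U. p \<in> U \<and> holomorphic_several g U"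
  shows "holomorphic_several g D"
  using assms unfolding holomorphic_several_def by blast

text \<open>Riemann's extension theorem for continuous functions. Some complex line through a given
  point meets the exceptional set in an isolated point; a small circle around it on that line, and its
  translates, avoid the exceptional set, and on parallel lines the singularities are removable.\<close>

theorem holomorphic_several_removable:
  fixes g \<Delta> :: "complex^'d \<Rightarrow> complex"
  assumes D: "open D" and g: "continuous_on D g" and \<Delta>: "holomorphic_several \<Delta> D"
    and hol: "holomorphic_several g {z \<in> D. \<Delta> z \<noteq> 0}"
    and dir: "\<And>p. p \<in> D \<Longrightarrow> \<exists>v. \<forall>\<^sub>F \<zeta> in at 0. \<Delta> (p + \<zeta> *s v) \<noteq> 0"
  shows "holomorphic_several g D"
proof (rule holomorphic_several_localI)
  fix p assume p: "p \<in> D"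
  have openN: "open {z \<in> D. \<Delta> z \<noteq> 0}"
  proof -
    have "open (D \<inter> \<Delta> -` (- {0}))"
      by (rule continuous_open_preimage[OF holomorphic_several_continuous_on[OF \<Delta>] D]) auto
    moreover have "D \<inter> \<Delta> -` (- {0}) = {z \<in> D. \<Delta> z \<noteq> 0}" by auto
    ultimately show ?thesis by simp
  qed
  obtain v d where d: "d > 0" "\<And>\<zeta>. \<zeta> \<noteq> 0 \<Longrightarrow> cmod \<zeta> < d \<Longrightarrow> \<Delta> (p + \<zeta> *s v) \<noteq> 0"
    using dir[OF p] unfolding eventually_at by (auto simp: dist_norm)
  obtain e0 where e0: "e0 > 0" "ball p e0 \<subseteq> D"
    using D p openE by blast
  define q where "q = e0 / (norm v + 1)"
  have nv: "norm v + 1 > 0" using add_nonneg_pos[of "norm v" 1] by simp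
  have q: "q > 0" using e0 nv by (simp add: q_def)
  define \<rho> where "\<rho> = min d q / 2"
  have \<rho>: "\<rho> > 0" "\<rho> < d" "\<rho> < q"
    using d(1) q by (auto simp: \<rho>_def min_def)
  have inD: "p + \<zeta> *s v \<in> D" if "cmod \<zeta> \<le> \<rho>" for \<zeta>
  proof -
    have "cmod \<zeta> < q" using that \<rho> by linarith
    then have "cmod \<zeta> * (norm v + 1) < e0"
      using nv by (simp add: q_def pos_less_divide_eq)
    moreover have "cmod \<zeta> * (norm v + 1) = cmod \<zeta> * norm v + cmod \<zeta>"
      by (simp add: distrib_left)
    ultimately have "cmod \<zeta> * norm v < e0"
      using norm_ge_zero[of \<zeta>] by linarith
    then show ?thesis using e0 by (auto simp: dist_norm)
  qed
  \<comment> \<open>Holomorphy is known near the circle of radius \<open>r\<close>, the bound is taken on radius \<open>2 r\<close>, and singularities are removed in the disc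
    of radius \<open>3 r\<close>.\<close>
  define r where "r = \<rho> / 4"
  have r: "r > 0" "\<rho> = 4 * r" using \<rho> by (auto simp: r_def)
  obtain e1 where e1: "e1 > 0" "\<And>z \<zeta>. z \<in> ball p e1 \<Longrightarrow> cmod \<zeta> \<le> \<rho> \<Longrightarrow> z + \<zeta> *s v \<in> D"
    using compact_disc_tube[OF D, of "cball 0 \<rho>" p v] inD by (auto simp: dist_norm)
  obtain e2 where e2: "e2 > 0"
    "\<And>z \<zeta>. z \<in> ball p e2 \<Longrightarrow> cmod \<zeta> = r \<Longrightarrow> z + \<zeta> *s v \<in> {z \<in> D. \<Delta> z \<noteq> 0}"
  proof (rule compact_disc_tube[OF openN, of "sphere 0 r" p v])
    fix \<zeta> :: complex assume "\<zeta> \<in> sphere 0 r"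
    then show "p + \<zeta> *s v \<in> {z \<in> D. \<Delta> z \<noteq> 0}"
      using inD[of \<zeta>] d(2)[of \<zeta>] \<rho> r by auto
  qed (auto simp: dist_norm)
  define e where "e = min e1 e2 / 2"
  have e: "e > 0" "cball p e \<subseteq> ball p e1" "cball p e \<subseteq> ball p e2"
    using e1 e2 by (auto simp: e_def)
  have eb: "z \<in> ball p e1" "z \<in> ball p e2" if "z \<in> ball p e" for z
    using that e1(1) e2(1) by (auto simp: e_def)
  let ?U = "ball p e"
  let ?C = "(\<lambda>x. fst x + snd x *s v) ` (cball p e \<times> cball 0 \<rho>)"
  have "compact ?C"
    by (intro compact_continuous_image compact_Times continuous_intros) auto
  moreover have "?C \<subseteq> D"
    using e e1(2) by (force simp: subset_eq)
  ultimately have "compact (g ` ?C)"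
    by - (rule compact_continuous_image[OF continuous_on_subset[OF g]]; assumption)
  then have "bounded (g ` ?C)" by (rule compact_imp_bounded)
  then obtain B where B: "\<And>y. y \<in> g ` ?C \<Longrightarrow> cmod y \<le> B"
    unfolding bounded_iff by blast
  have "holomorphic_several g ?U"
  proof (rule holomorphic_several_from_circles[where r = r and R = "2 * r" and v = v and B = B])
    fix z assume z: "z \<in> ?U"
    have inD': "z + \<zeta> *s v \<in> D" if "\<zeta> \<in> ball 0 \<rho>" for \<zeta>
      using e1(2)[OF eb(1)[OF z], of \<zeta>] that by simp
    define F where "F \<zeta> = \<Delta> (z + \<zeta> *s v)" for \<zeta>
    define K where "K = {\<zeta> \<in> cball 0 (3 * r). F \<zeta> = 0}"
    have F: "F holomorphic_on ball 0 \<rho>"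
      unfolding F_def by (rule holomorphic_several_line[OF \<Delta>]) (use inD' in auto)
    have rr: "of_real r \<in> ball (0::complex) \<rho>" "F (of_real r) \<noteq> 0"
      using e2(2)[OF eb(2)[OF z], of "of_real r"] r by (auto simp: F_def)
    have finK: "finite K"
    proof (cases "F constant_on ball 0 \<rho>")
      case True
      then have "F \<zeta> \<noteq> 0" if "\<zeta> \<in> ball 0 \<rho>" for \<zeta>
        using that rr unfolding constant_on_def by metis
      then have "K = {}" using r by (auto simp: K_def)
      then show ?thesis by simp
    next
      case False
      show ?thesis unfolding K_def
        by (rule holomorphic_compact_finite_zeros[OF F _ _ _ _ False]) (use r in auto)
    qed
    have "(\<lambda>\<zeta>. g (z + \<zeta> *s v)) holomorphic_on ball 0 (3 * r)"
    proof (rule no_isolated_singularity[OF _ _ _ finK])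
      show "continuous_on (ball 0 (3 * r)) (\<lambda>\<zeta>. g (z + \<zeta> *s v))"
        by (rule continuous_on_compose2[OF g]) (use inD' r in \<open>auto intro!: continuous_intros\<close>)
      show "(\<lambda>\<zeta>. g (z + \<zeta> *s v)) holomorphic_on ball 0 (3 * r) - K"
        by (rule holomorphic_several_line[OF hol]) (use inD' r in \<open>auto simp: K_def F_def\<close>)
    qed simp
    then show "(\<lambda>\<zeta>. g (z + \<zeta> *s v)) holomorphic_on cball 0 (2 * r)"
      by (rule holomorphic_on_subset) (use r in auto)
    show "cmod (g (z + \<zeta> *s v)) \<le> B" if "cmod \<zeta> = 2 * r" for \<zeta>
    proof (rule B)
      have "(z, \<zeta>) \<in> cball p e \<times> cball 0 \<rho>" using z that r by auto
      then show "g (z + \<zeta> *s v) \<in> g ` ?C"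
        by force
    qed
  next
    fix \<zeta> :: complex assume "cmod \<zeta> = r"
    then show "holomorphic_several g ((\<lambda>z. z + \<zeta> *s v) ` ?U)"
      using e2(2)[OF eb(2), of _ \<zeta>] by (intro holomorphic_several_subset[OF hol]) blast
  qed (use r in auto)
  then show "\<exists>U. p \<in> U \<and> holomorphic_several g U"
    using e by (meson centre_in_ball)
qed

text \<open>On a complex line transversal to the hyperplane, the singularity of \<open>f / l\<close> is removable;
  circles around it give holomorphy in all variables.\<close>

theorem holomorphic_several_divide_linear_form:
  fixes f l :: "complex^'d \<Rightarrow> complex"
  assumes D: "open D" and f: "holomorphic_several f D" and l: "linear_form l" and v: "l v = 1"
    and zero: "\<And>z. z \<in> D \<Longrightarrow> l z = 0 \<Longrightarrow> f z = 0"
  obtains g where "holomorphic_several g D" "\<And>z. z \<in> D \<Longrightarrow> f z = l z * g z"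
proof -
  \<comment> \<open>On the hyperplane the value is the limit of \<open>f / l\<close> along the direction \<open>v\<close>.\<close>
  define g where "g z = (if l z = 0 then deriv (\<lambda>\<zeta>. f (z + \<zeta> *s v)) 0 else f z / l z)" for z
  have contl: "continuous_on D l" for D
    using holomorphic_several_continuous_on holomorphic_several_linear_form[OF l] by blast
  have lline: "l (z + \<zeta> *s v) = l z + \<zeta>" for z \<zeta>
    using l v by (simp add: linear_form_add linear_form_scale)
  have openN: "open {z \<in> D. l z \<noteq> 0}"
  proof -
    have "open (D \<inter> l -` (- {0}))"
      by (rule continuous_open_preimage[OF contl D]) auto
    moreover have "D \<inter> l -` (- {0}) = {z \<in> D. l z \<noteq> 0}" by auto
    ultimately show ?thesis by simp
  qed
  have hol: "holomorphic_several g {z \<in> D. l z \<noteq> 0}"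
  proof (rule holomorphic_several_transform[OF _ openN])
    show "holomorphic_several (\<lambda>z. f z / l z) {z \<in> D. l z \<noteq> 0}"
      by (rule holomorphic_several_divide[OF _ holomorphic_several_linear_form[OF l]])
        (auto intro: holomorphic_several_subset[OF f])
  qed (auto simp: g_def)
  have "\<exists>U. p \<in> U \<and> holomorphic_several g U" if p: "p \<in> D" for p
  proof (cases "l p = 0")
    case False
    then show ?thesis using hol p by (intro exI[of _ "{z \<in> D. l z \<noteq> 0}"]) simp
  next
    case True
    obtain e0 where e0: "e0 > 0" "cball p e0 \<subseteq> D"
      using D p open_contains_cball by blast
    have nv: "norm v > 0" using v linear_form_zero[OF l] by auto
    define r where "r = e0 / (3 * norm v)"
    have r: "r > 0" using e0 nv by (simp add: r_def)
    have inD: "p + \<zeta> *s v \<in> D" if "\<zeta> \<in> cball 0 (3 * r)" for \<zeta>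
    proof -
      have "cmod \<zeta> * norm v \<le> e0"
        using that nv by (simp add: r_def field_simps)
      then show ?thesis using e0 by (auto simp: dist_norm)
    qed
    obtain e1 where e1: "e1 > 0" "\<And>z \<zeta>. z \<in> ball p e1 \<Longrightarrow> \<zeta> \<in> cball 0 (3 * r) \<Longrightarrow> z + \<zeta> *s v \<in> D"
      using compact_disc_tube[OF D compact_cball inD] by metis
    have "isCont l p"
      using bounded_linear_imp_has_derivative has_derivative_continuous linear_form_bounded_linear[OF l] by blast
    then obtain e2 where e2: "e2 > 0" "\<And>z. z \<in> ball p e2 \<Longrightarrow> cmod (l z) < r"
      using r True unfolding continuous_at_eps_delta by (auto simp: dist_norm norm_minus_commute)
    define e where "e = min e1 e2 / 2"
    have e: "e > 0" "cball p e \<subseteq> ball p e1" "cball p e \<subseteq> ball p e2"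
      using e1 e2 by (auto simp: e_def)
    have eb: "z \<in> ball p e1" "z \<in> ball p e2" if "z \<in> ball p e" for z
      using that e1(1) e2(1) by (auto simp: e_def)
    let ?U = "ball p e"
    let ?C = "(\<lambda>x. fst x + snd x *s v) ` (cball p e \<times> cball 0 (3 * r))"
    have "compact ?C"
      by (intro compact_continuous_image compact_Times continuous_intros) auto
    moreover have "?C \<subseteq> D"
      using e e1(2) by (force simp: subset_eq)
    ultimately have "compact (f ` ?C)"
      by - (rule compact_continuous_image[OF continuous_on_subset[OF holomorphic_several_continuous_on[OF f]]]; assumption)
    then have "bounded (f ` ?C)" by (rule compact_imp_bounded)
    then obtain B where B: "\<And>y. y \<in> f ` ?C \<Longrightarrow> cmod y \<le> B"
      unfolding bounded_iff by blast
    have "holomorphic_several g ?U"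
    proof (rule holomorphic_several_from_circles[where r = r and R = "2 * r" and v = v and B = "B / r"])
      fix z assume z: "z \<in> ?U"
      have lz: "cmod (l z) < r" using e2(2)[OF eb(2)[OF z]] .
      have inD': "z + \<zeta> *s v \<in> D" if "\<zeta> \<in> cball 0 (3 * r)" for \<zeta>
        using e1(2)[OF eb(1)[OF z] that] .
      let ?F = "\<lambda>\<zeta>. f (z + \<zeta> *s v)" and ?a = "- l z"
      have F: "?F holomorphic_on ball 0 (3 * r)"
        by (rule holomorphic_several_line[OF f]) (use inD' in auto)
      have a: "?a \<in> ball 0 (3 * r)" using lz r by auto
      have "(\<lambda>\<zeta>. g (z + \<zeta> *s v)) holomorphic_on ball 0 (3 * r)"
      proof (rule pole_theorem_open_0[OF F])
        show "?F ?a = 0"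
          using zero[of "z + ?a *s v"] inD'[of ?a] a lline[of z ?a] by auto
        have "deriv ?F ?a = deriv (\<lambda>\<zeta>. ?F (\<zeta> + ?a)) 0"
          unfolding deriv_shift_0[of ?F ?a] by (rule arg_cong2[where f = deriv]) (auto simp: fun_eq_iff add.commute)
        also have "(\<lambda>\<zeta>. ?F (\<zeta> + ?a)) = (\<lambda>\<zeta>. f (z + ?a *s v + \<zeta> *s v))"
          by (simp add: vector_sadd_rdistrib algebra_simps)
        finally show "g (z + ?a *s v) = deriv ?F ?a"
          using lline[of z ?a] by (simp add: g_def)
        show "?F \<zeta> = (\<zeta> - ?a) * g (z + \<zeta> *s v)" if "\<zeta> \<in> ball 0 (3 * r) - {?a}" for \<zeta>
          using that lline[of z \<zeta>] by (auto simp: g_def add_eq_0_iff add.commute)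
      qed simp
      then show "(\<lambda>\<zeta>. g (z + \<zeta> *s v)) holomorphic_on cball 0 (2 * r)"
        by (rule holomorphic_on_subset) (use r in auto)
      show "cmod (g (z + \<zeta> *s v)) \<le> B / r" if \<zeta>: "cmod \<zeta> = 2 * r" for \<zeta>
      proof -
        have "(z, \<zeta>) \<in> cball p e \<times> cball 0 (3 * r)" using z \<zeta> r by auto
        then have "f (z + \<zeta> *s v) \<in> f ` ?C"
          by force
        then have fB: "cmod (f (z + \<zeta> *s v)) \<le> B" by (rule B)
        have "cmod (l z + \<zeta>) \<ge> r"
          using norm_diff_ineq[of \<zeta> "l z"] lz \<zeta> by (simp add: add.commute)
        moreover from this have "l z + \<zeta> \<noteq> 0" using r by auto
        ultimately show ?thesis
          using fB r order_trans[OF norm_ge_zero fB]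
          by (simp add: g_def lline norm_divide frac_le)
      qed
    next
      fix \<zeta> :: complex assume \<zeta>: "cmod \<zeta> = r"
      have "z + \<zeta> *s v \<in> {z \<in> D. l z \<noteq> 0}" if "z \<in> ?U" for z
      proof -
        have "cmod (l z) < r" using e2(2)[OF eb(2)[OF that]] .
        then have "l z + \<zeta> \<noteq> 0" using \<zeta> by (auto simp: add_eq_0_iff)
        then show ?thesis using e1(2)[OF eb(1)[OF that], of \<zeta>] \<zeta> r by (simp add: lline)
      qed
      then show "holomorphic_several g ((\<lambda>z. z + \<zeta> *s v) ` ?U)"
        by (intro holomorphic_several_subset[OF hol]) auto
    qed (use r in auto)
    then show ?thesis using e by (meson centre_in_ball)
  qed
  then have "holomorphic_several g D" by (rule holomorphic_several_localI)
  then show ?thesis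
    by (rule that) (auto simp: g_def zero)
qed

section \<open>Change of variables for holomorphic maps\<close>

text \<open>A bijection between orthonormal bases extends to a linear isometry. Preimages of boxes are boxes with the same side
  lengths, so Lebesgue measure is preserved.\<close>

lemma euclidean_coordinates:
  assumes "DIM('a::euclidean_space) = DIM('b::euclidean_space)"
  obtains \<Phi> :: "'a::euclidean_space \<Rightarrow> 'b::euclidean_space" and \<Psi> :: "'b \<Rightarrow> 'a" where
    "linear \<Phi>" "linear \<Psi>" "\<And>x. \<Psi> (\<Phi> x) = x" "\<And>y. \<Phi> (\<Psi> y) = y" "\<And>x. norm (\<Phi> x) = norm x"
    "distr lborel lborel \<Phi> = lborel" "distr lborel lborel \<Psi> = lborel"
proof -
  obtain \<beta> :: "'a \<Rightarrow> 'b" where \<beta>: "bij_betw \<beta> Basis Basis"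
    using assms finite_same_card_bij[of "Basis :: 'a set" "Basis :: 'b set"] by auto
  define \<gamma> where "\<gamma> = inv_into Basis \<beta>"
  have \<gamma>: "bij_betw \<gamma> Basis Basis"
    unfolding \<gamma>_def by (rule bij_betw_inv_into[OF \<beta>])
  have \<beta>\<gamma>: "b \<in> Basis \<Longrightarrow> \<beta> (\<gamma> b) = b" "b \<in> Basis \<Longrightarrow> \<gamma> b \<in> Basis" for b
    using \<beta> \<gamma> unfolding \<gamma>_def
    by (auto simp: bij_betw_inv_into_right dest: bij_betwE)
  have \<gamma>\<beta>: "b \<in> Basis \<Longrightarrow> \<gamma> (\<beta> b) = b" "b \<in> Basis \<Longrightarrow> \<beta> b \<in> Basis" for b
    using \<beta> unfolding \<gamma>_def by (auto simp: bij_betw_inv_into_left dest: bij_betwE)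
  define \<Phi> where "\<Phi> x = (\<Sum>b\<in>Basis. (x \<bullet> \<gamma> b) *\<^sub>R b)" for x
  define \<Psi> where "\<Psi> y = (\<Sum>b\<in>Basis. (y \<bullet> \<beta> b) *\<^sub>R b)" for y
  have lin: "linear \<Phi>" "linear \<Psi>"
    by (auto intro!: linearI simp: \<Phi>_def \<Psi>_def inner_add_left scaleR_add_left sum.distrib scaleR_sum_right)
  have in1: "\<Phi> x \<bullet> b = x \<bullet> \<gamma> b" if "b \<in> Basis" for x b
    using that by (simp add: \<Phi>_def)
  have in2: "\<Psi> y \<bullet> b = y \<bullet> \<beta> b" if "b \<in> Basis" for y b
    using that by (simp add: \<Psi>_def)
  have inv: "\<Psi> (\<Phi> x) = x" "\<Phi> (\<Psi> y) = y" for x y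
    by (rule euclidean_eqI, simp add: in1 in2 \<beta>\<gamma> \<gamma>\<beta>)+
  have nrm: "norm (\<Phi> x) = norm x" for x
  proof -
    have "(\<Sum>b\<in>Basis. (x \<bullet> \<gamma> b)\<^sup>2) = (\<Sum>b\<in>Basis. (x \<bullet> b)\<^sup>2)"
      using sum.reindex_bij_betw[OF \<gamma>, of "\<lambda>b. (x \<bullet> b)\<^sup>2"] .
    then show ?thesis
      unfolding norm_eq_sqrt_inner euclidean_inner[of x x] euclidean_inner[of "\<Phi> x" "\<Phi> x"]
        by (simp add: in1 power2_eq_square)
  qed
  have meas: "\<Phi> \<in> borel \<rightarrow>\<^sub>M borel" "\<Psi> \<in> borel \<rightarrow>\<^sub>M borel"
    using lin by (auto intro!: borel_measurable_continuous_onI linear_continuous_on simp: linear_conv_bounded_linear)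
  have vim: "\<Phi> -` box l u = box (\<Psi> l) (\<Psi> u)" for l u
  proof -
    have "\<Phi> x \<in> box l u \<longleftrightarrow> x \<in> box (\<Psi> l) (\<Psi> u)" for x
      unfolding mem_box using \<beta>\<gamma> \<gamma>\<beta> by (simp add: in1 in2) metis
    then show ?thesis by auto
  qed
  have eq1: "lborel = distr lborel lborel \<Phi>"
  proof (rule lborel_eqI)
    fix l u :: 'b assume le: "\<And>b. b \<in> Basis \<Longrightarrow> l \<bullet> b \<le> u \<bullet> b"
    have "emeasure (distr lborel lborel \<Phi>) (box l u) = emeasure lborel (box (\<Psi> l) (\<Psi> u))"
      using meas by (subst emeasure_distr) (auto simp: vim)
    also have "\<dots> = (\<Prod>b\<in>Basis. (\<Psi> u - \<Psi> l) \<bullet> b)"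
      by (rule emeasure_lborel_box) (simp add: in2 le \<gamma>\<beta>)
    also have "(\<Prod>b\<in>Basis. (\<Psi> u - \<Psi> l) \<bullet> b) = (\<Prod>b\<in>Basis. (u - l) \<bullet> \<beta> b)"
      by (intro prod.cong) (auto simp: in2 inner_diff_left)
    also have "\<dots> = (\<Prod>b\<in>Basis. (u - l) \<bullet> b)"
      using prod.reindex_bij_betw[OF \<beta>, of "\<lambda>b. (u - l) \<bullet> b"] .
    finally show "emeasure (distr lborel lborel \<Phi>) (box l u) = (\<Prod>b\<in>Basis. (u - l) \<bullet> b)" .
  qed simp
  have "distr lborel lborel \<Psi> = distr (distr lborel lborel \<Phi>) lborel \<Psi>"
    using eq1 by simp
  also have "\<dots> = distr lborel lborel (\<Psi> \<circ> \<Phi>)"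
    using meas by (intro distr_distr) auto
  also have "\<dots> = lborel"
    using inv by (simp add: o_def distr_id)
  finally have eq2: "distr lborel lborel \<Psi> = lborel" .
  show ?thesis
    by (rule that[OF lin inv nrm eq1[symmetric] eq2])
qed

lemma lebesgue_distr:
  fixes \<Phi> :: "'a::euclidean_space \<Rightarrow> 'b::euclidean_space"
  assumes "linear \<Phi>" and d: "distr lborel lborel \<Phi> = lborel"
  shows "\<Phi> \<in> lebesgue \<rightarrow>\<^sub>M lebesgue" "distr lebesgue lebesgue \<Phi> = lebesgue"
proof -
  have b: "\<Phi> \<in> borel \<rightarrow>\<^sub>M borel"
    using assms(1) by (auto intro!: borel_measurable_continuous_onI linear_continuous_on simp: linear_conv_bounded_linear)
  then have m: "\<Phi> \<in> lborel \<rightarrow>\<^sub>M lborel" by simp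
  have eq: "distr lebesgue lborel \<Phi> = lborel"
    using distr_completion[OF m] d by simp
  have m': "\<Phi> \<in> lebesgue \<rightarrow>\<^sub>M lborel"
    using m by (rule measurable_completion)
  show "\<Phi> \<in> lebesgue \<rightarrow>\<^sub>M lebesgue"
    by (rule completion.measurable_completion2[OF m']) (simp add: eq)
  show "distr lebesgue lebesgue \<Phi> = lebesgue"
    using completion.completion_distr_eq[OF m'] eq by simp
qed

text \<open>The transport of a nonmeasurable integrand is nonmeasurable, in which case both integrals are \<open>0\<close> by convention.\<close>

lemma set_integral_lebesgue_transport:
  fixes f :: "'b::euclidean_space \<Rightarrow> 'c::{banach, second_countable_topology}" and \<Phi> :: "'a::euclidean_space \<Rightarrow> 'b"
  assumes lin: "linear \<Phi>" "linear \<Psi>" and inv: "\<And>x. \<Psi> (\<Phi> x) = x" "\<And>y. \<Phi> (\<Psi> y) = y"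
    and d: "distr lborel lborel \<Phi> = lborel" "distr lborel lborel \<Psi> = lborel"
  shows "set_integrable lebesgue (\<Phi> ` S) f \<longleftrightarrow> set_integrable lebesgue S (\<lambda>x. f (\<Phi> x))"
    and "(LINT y:\<Phi> ` S|lebesgue. f y) = (LINT x:S|lebesgue. f (\<Phi> x))"
proof -
  note m = lebesgue_distr[OF lin(1) d(1)] and m' = lebesgue_distr[OF lin(2) d(2)]
  define G where "G y = indicator (\<Phi> ` S) y *\<^sub>R f y" for y
  have "inj \<Phi>" by (metis inv(1) injI)
  then have g: "G (\<Phi> x) = indicator S x *\<^sub>R f (\<Phi> x)" for x
    by (simp add: G_def indicator_def inj_image_mem_iff)
  have "integrable lebesgue G = integrable lebesgue (\<lambda>x. G (\<Phi> x)) \<and>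
      integral\<^sup>L lebesgue G = integral\<^sup>L lebesgue (\<lambda>x. G (\<Phi> x))"
  proof (cases "G \<in> borel_measurable lebesgue")
    case True
    from integrable_distr_eq[OF m(1) True] integral_distr[OF m(1) True] show ?thesis
      unfolding m(2) by simp
  next
    case False
    have "(\<lambda>x. G (\<Phi> x)) \<notin> borel_measurable lebesgue"
    proof
      assume "(\<lambda>x. G (\<Phi> x)) \<in> borel_measurable lebesgue"
      from measurable_compose[OF m'(1) this] False show False by (simp add: inv)
    qed
    with False have "\<not> integrable lebesgue G" "\<not> integrable lebesgue (\<lambda>x. G (\<Phi> x))"
      by (auto dest: borel_measurable_integrable)
    then show ?thesis by (simp add: not_integrable_integral_eq)
  qed
  then show "set_integrable lebesgue (\<Phi> ` S) f \<longleftrightarrow> set_integrable lebesgue S (\<lambda>x. f (\<Phi> x))"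
    and "(LINT y:\<Phi> ` S|lebesgue. f y) = (LINT x:S|lebesgue. f (\<Phi> x))"
    unfolding set_integrable_def set_lebesgue_integral_def g[symmetric] G_def[symmetric] by simp_all
qed

subsection \<open>The real determinant of a complex linear map\<close>

definition matrix_shear :: "'d \<Rightarrow> complex^'d \<Rightarrow> complex^'d^'d" where
  "matrix_shear k w = matrix (\<lambda>x. x + (x $ k) *s w)"

definition matrix_scale :: "'d set \<Rightarrow> complex \<Rightarrow> complex^'d^'d" where
  "matrix_scale K c = matrix (\<lambda>x. \<chi> i. if i \<in> K then c * x $ i else x $ i)"

definition matrix_swap :: "'d \<Rightarrow> 'd \<Rightarrow> complex^'d^'d" where
  "matrix_swap j k = matrix (\<lambda>x. \<chi> i. x $ (if i = j then k else if i = k then j else i))"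

lemma matrix_linear_mult:
  fixes f :: "complex^'d \<Rightarrow> complex^'d"
  assumes "\<And>x y. f (x + y) = f x + f y" "\<And>c x. f (c *s x) = c *s f x"
  shows "matrix f *v x = f x"
  using assms by (intro matrix_works) (simp add: Vector_Spaces.linear_def module_hom_def
      module_hom_axioms_def vec.vector_space_axioms vec.module_axioms)

lemma matrix_shear_mult [simp]: "matrix_shear k w *v x = x + (x $ k) *s w"
  unfolding matrix_shear_def by (rule matrix_linear_mult) (auto simp: vec_eq_iff algebra_simps)

lemma matrix_scale_mult [simp]:
  "matrix_scale K c *v x = (\<chi> i. if i \<in> K then c * x $ i else x $ i)"
  unfolding matrix_scale_def by (rule matrix_linear_mult) (auto simp: vec_eq_iff algebra_simps)

lemma matrix_swap_mult [simp]:
  "matrix_swap j k *v x = (\<chi> i. x $ (if i = j then k else if i = k then j else i))"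
  unfolding matrix_swap_def by (rule matrix_linear_mult) (auto simp: vec_eq_iff algebra_simps)

lemma matrix_scalar_mult_vec [simp]: "mat c *v x = c *s (x :: complex^'d)"
  by (simp add: vec_eq_iff matrix_vector_mult_def mat_def if_distrib[of "\<lambda>x. x * _"] cong: if_cong)

lemma mult_axis: "((A :: complex^'d^'d) *v axis k 1) $ i = A $ i $ k"
  by (simp add: matrix_vector_mult_def axis_def if_distrib[of "\<lambda>x. _ * x"] cong: if_cong)

lemma matrix_eqI: "(\<And>x. A *v x = B *v x) \<Longrightarrow> A = (B :: complex^'d^'d)"
  by (simp add: matrix_eq)

lemma mult_vec_assoc: "(A ** B) *v x = A *v (B *v (x :: complex^'d))"
  by (simp add: matrix_vector_mul_assoc)

text \<open>These properties are shared by \<open>|det A|\<^sup>2\<close> and by the absolute value of the determinant of \<open>A\<close> as a real linear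
  map. They fix the values on scalings of one coordinate and on shears.\<close>

locale multiplicative_matrix_norm =
  fixes f :: "complex^'d^'d \<Rightarrow> real"
  assumes mult: "f (A ** B) = f A * f B" and nonneg: "f A \<ge> 0"
    and scalar: "t > 0 \<Longrightarrow> f (mat (of_real t)) = (t ^ 2) ^ CARD('d)"
    and unit: "cmod c = 1 \<Longrightarrow> f (matrix_scale {k} c) = 1"
begin

lemma one: "f (mat 1) = 1"
  using scalar[of 1] by simp

lemma inverse_pair: "A ** B = mat 1 \<Longrightarrow> f A * f B = 1"
  using mult[of A B] one by simp

lemma swap: "f (matrix_swap j k) = 1"
proof -
  have "matrix_swap j k ** matrix_swap j k = mat 1"
    by (rule matrix_eqI) (auto simp: mult_vec_assoc vec_eq_iff)
  then have "f (matrix_swap j k) ^ 2 = 1 ^ 2"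
    using inverse_pair by (simp add: power2_eq_square)
  then show ?thesis using nonneg by (metis power2_eq_imp_eq zero_le_one)
qed

text \<open>The coordinate scalings with a given positive factor are conjugate under swaps, and their product is
  a scalar matrix.\<close>

lemma scale: assumes "c \<noteq> 0" shows "f (matrix_scale {k} c) = cmod c ^ 2"
proof -
  let ?t = "complex_of_real (cmod c)"
  have t: "cmod c > 0" using assms by simp
  have same: "f (matrix_scale {j} ?t) = f (matrix_scale {k} ?t)" for j
  proof -
    have "matrix_scale {j} ?t = matrix_swap j k ** (matrix_scale {k} ?t ** matrix_swap j k)"
      by (rule matrix_eqI) (auto simp: mult_vec_assoc vec_eq_iff)
    then show ?thesis by (simp add: mult swap)
  qed
  have K: "finite K \<Longrightarrow> f (matrix_scale K ?t) = f (matrix_scale {k} ?t) ^ card K" for K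
  proof (induction K rule: finite_induct)
    case empty
    have "matrix_scale ({} :: 'd set) ?t = mat 1"
      by (rule matrix_eqI) (auto simp: vec_eq_iff)
    then show ?case by (simp add: one)
  next
    case (insert j K)
    have "matrix_scale (insert j K) ?t = matrix_scale {j} ?t ** matrix_scale K ?t"
      using insert by (intro matrix_eqI) (auto simp: mult_vec_assoc vec_eq_iff)
    then show ?case using insert by (simp add: mult same[of j])
  qed
  have "matrix_scale (UNIV :: 'd set) ?t = mat ?t"
    by (rule matrix_eqI) (auto simp: vec_eq_iff)
  then have "f (matrix_scale {k} ?t) ^ CARD('d) = (cmod c ^ 2) ^ CARD('d)"
    using K[of UNIV] scalar[OF t] by simp
  then have pos: "f (matrix_scale {k} ?t) = cmod c ^ 2"
    using nonneg by (auto dest: power_eq_imp_eq_base)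
  have "matrix_scale {k} c = matrix_scale {k} ?t ** matrix_scale {k} (sgn c)"
    by (rule matrix_eqI) (auto simp: mult_vec_assoc vec_eq_iff sgn_div_norm scaleR_conv_of_real assms)
  then show ?thesis
    using pos unit[of "sgn c"] assms by (simp add: mult norm_sgn)
qed

text \<open>A shear is conjugate to its own square.\<close>

lemma shear: assumes "w $ k = 0" shows "f (matrix_shear k w) = 1"
proof -
  have "matrix_shear k w ** matrix_shear k w =
      matrix_scale {k} (1/2) ** (matrix_shear k w ** matrix_scale {k} 2)"
    using assms by (intro matrix_eqI) (auto simp: mult_vec_assoc vec_eq_iff)
  then have "f (matrix_shear k w) * f (matrix_shear k w) =
      f (matrix_scale {k} (1/2)) * (f (matrix_shear k w) * f (matrix_scale {k} 2))"
    by (metis mult)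
  moreover have "f (matrix_scale {k} (1/2)) = 1 / 4" "f (matrix_scale {k} 2) = 4"
    using scale[of "1/2" k] scale[of 2 k] by (simp_all add: power2_eq_square norm_divide)
  ultimately have "f (matrix_shear k w) * f (matrix_shear k w) = f (matrix_shear k w)" by simp
  moreover have "f (matrix_shear k w) \<noteq> 0"
  proof -
    have "matrix_shear k w ** matrix_shear k (- w) = mat 1"
      using assms by (intro matrix_eqI) (auto simp: mult_vec_assoc vec_eq_iff)
    then show ?thesis using inverse_pair by fastforce
  qed
  ultimately show ?thesis by simp
qed

end

text \<open>An invertible matrix is a product of shears and scalings of one coordinate.\<close>

lemma multiplicative_matrix_norm_unique:
  fixes A :: "complex^'d^'d"
  assumes "multiplicative_matrix_norm f" "multiplicative_matrix_norm h" and "invertible A"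
  shows "f A = h A"
proof -
  interpret f: multiplicative_matrix_norm f by fact
  interpret h: multiplicative_matrix_norm h by fact
  \<comment> \<open>Gaussian elimination on the columns, by induction on the number of columns not yet reduced.\<close>
  have "f A = h A" if "invertible A" "\<And>j. j \<notin> K \<Longrightarrow> A *v axis j 1 = axis j 1" "card K = n"
    for A :: "complex^'d^'d" and K n
    using that
  proof (induction n arbitrary: A K)
    case 0
    then have "A *v axis j 1 = axis j 1" for j by (simp add: card_eq_0_iff)
    then have "A $ i $ j = mat 1 $ i $ j" for i j
      using mult_axis[of A j i] by (simp add: mat_def axis_def)
    then have "A = mat 1" by (simp add: vec_eq_iff)
    then show ?case by (simp add: f.one h.one)
  next
    case (Suc n)
    then obtain k where k: "k \<in> K" by fastforce
    have inj: "A *v x = A *v y \<Longrightarrow> x = y" for x y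
      using Suc.prems(1) by (metis invertible_def matrix_vector_mul_assoc matrix_vector_mul_lid)
    have step: "f A = h A" if A: "invertible A" "\<And>j. j \<notin> K \<Longrightarrow> A *v axis j 1 = axis j 1" "A $ k $ k \<noteq> 0"
      for A :: "complex^'d^'d"
    proof -
      define u where "u = A *v axis k 1"
      have uk: "u $ k \<noteq> 0"
        using A(3) by (simp add: u_def mult_axis)
      define w where "w = (\<chi> i. if i = k then 0 else u $ i / u $ k)"
      define B where "B = matrix_shear k w ** matrix_scale {k} (u $ k)"
      define C where "C = matrix_scale {k} (1 / u $ k) ** matrix_shear k (- w)"
      have BC: "B ** C = mat 1" "C ** B = mat 1"
        unfolding B_def C_def using uk
        by - (rule matrix_eqI, simp add: mult_vec_assoc vec_eq_iff w_def)+
      have "f (C ** A) = h (C ** A)"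
      proof (rule Suc.IH)
        show "invertible (C ** A)"
          using A(1) BC by (meson invertible_def invertible_mult)
        fix j assume j: "j \<notin> K - {k}"
        show "(C ** A) *v axis j 1 = axis j 1"
        proof (cases "j = k")
          case True
          then show ?thesis
            using uk by (simp add: mult_vec_assoc flip: u_def)
              (auto simp: C_def mult_vec_assoc vec_eq_iff w_def axis_def)
        next
          case False
          then have "A *v axis j 1 = axis j 1" using A(2) j by blast
          then show ?thesis
            using False by (auto simp: C_def mult_vec_assoc vec_eq_iff w_def axis_def)
        qed
      next
        show "card (K - {k}) = n" using Suc.prems k by simp
      qed
      moreover have "A = B ** (C ** A)"
        using BC by (simp add: matrix_mul_assoc)
      moreover have "f B = h B"
        unfolding B_def f.mult h.mult
        using uk by (simp add: f.shear h.shear f.scale h.scale w_def)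
      ultimately show ?thesis by (metis f.mult h.mult)
    qed
    show ?case
    proof (cases "A $ k $ k = 0")
      case False
      then show ?thesis using step Suc.prems by blast
    next
      case True
      have "\<exists>i\<in>K. A $ i $ k \<noteq> 0"
      proof (rule ccontr)
        assume contr: "\<not> ?thesis"
        define y where "y = A *v axis k 1"
        have y: "y $ i = 0" if "i \<in> K" for i
          using contr that by (simp add: y_def mult_axis)
        have "A *v y = y"
        proof -
          have "y = (\<Sum>j\<in>UNIV. y $ j *s axis j 1)"
            by (simp add: basis_expansion)
          then have "A *v y = (\<Sum>j\<in>UNIV. A *v (y $ j *s axis j 1))"
            by (metis vec.sum)
          also have "\<dots> = (\<Sum>j\<in>UNIV. y $ j *s axis j 1)"
          proof (rule sum.cong)
            fix j
            show "A *v (y $ j *s axis j 1) = y $ j *s axis j 1"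
              using y[of j] Suc.prems(2)[of j] by (cases "j \<in> K") (auto simp: vec.scale)
          qed simp
          finally show ?thesis by (simp add: basis_expansion)
        qed
        then have "y = axis k 1" using inj unfolding y_def by blast
        then show False using y[OF k] by (simp add: axis_def)
      qed
      then obtain i where i: "i \<in> K" "A $ i $ k \<noteq> 0" by blast
      then have ik: "i \<noteq> k" using True by auto
      \<comment> \<open>Adding row \<open>i\<close> to row \<open>k\<close> produces a nonzero pivot.\<close>
      let ?S = "matrix_shear i (axis k 1) :: complex^'d^'d" and ?T = "matrix_shear i (- axis k 1) :: complex^'d^'d"
      have TS: "?T ** ?S = mat 1" "?S ** ?T = mat 1"
        using ik by - (rule matrix_eqI, simp add: mult_vec_assoc vec_eq_iff axis_def)+
      have "f (?S ** A) = h (?S ** A)"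
      proof (rule step)
        show "invertible (?S ** A)"
          using Suc.prems(1) TS by (meson invertible_def invertible_mult)
        show "(?S ** A) *v axis j 1 = axis j 1" if "j \<notin> K" for j
          using Suc.prems(2)[OF that] i that by (auto simp: mult_vec_assoc vec_eq_iff axis_def)
        have "(?S ** A) $ k $ k = ((?S ** A) *v axis k 1) $ k"
          by (simp add: mult_axis)
        also have "\<dots> = A $ k $ k + A $ i $ k"
          by (simp add: mult_vec_assoc) (simp add: mult_axis)
        finally show "(?S ** A) $ k $ k \<noteq> 0" using i True by simp
      qed
      moreover have "A = ?T ** (?S ** A)"
        using TS by (simp add: matrix_mul_assoc)
      moreover have "f ?T = 1" "h ?T = 1"
        using ik by (auto intro!: f.shear h.shear simp: axis_def)
      ultimately show ?thesis by (metis f.mult h.mult)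
    qed
  qed
  from this[of A UNIV] assms(3) show ?thesis by simp
qed

lemma multiplicative_matrix_norm_det:
  "multiplicative_matrix_norm (\<lambda>A :: complex^'d^'d. cmod (det A) ^ 2)"
proof
  show "cmod (det (A ** B)) ^ 2 = cmod (det A) ^ 2 * cmod (det B) ^ 2" for A B :: "complex^'d^'d"
    by (simp add: det_mul norm_mult power_mult_distrib)
  show "cmod (det (mat (of_real t) :: complex^'d^'d)) ^ 2 = (t ^ 2) ^ CARD('d)" if "t > 0" for t
  proof -
    have "det (mat (of_real t) :: complex^'d^'d) = (\<Prod>i\<in>UNIV. (mat (of_real t) :: complex^'d^'d) $ i $ i)"
      by (rule det_diagonal) (simp add: mat_def)
    then show ?thesis using that
      by (simp add: mat_def norm_power power_mult[symmetric] mult.commute)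
  qed
  show "cmod (det (matrix_scale {k} c :: complex^'d^'d)) ^ 2 = 1" if "cmod c = 1" for k :: 'd and c
  proof -
    have e: "(matrix_scale {k} c :: complex^'d^'d) $ i $ j = (if i = j then (if i = k then c else 1) else 0)" for i j
      by (simp add: matrix_scale_def matrix_def axis_def)
    have "det (matrix_scale {k} c :: complex^'d^'d) = (\<Prod>i\<in>UNIV. if i = k then c else 1)"
      by (subst det_diagonal) (auto simp: e)
    then show ?thesis using that by simp
  qed
qed auto

text \<open>In real coordinates the absolute value of the determinant of a complex matrix is multiplicative, \<open>1\<close>
  on norm preserving maps and \<open>t\<^sup>2\<^sup>d\<close> on scalars \<open>t\<close>, which determines it.\<close>

lemma real_det_complex_matrix:
  fixes A :: "complex^'d^'d" and \<Phi> :: "complex^'d \<Rightarrow> real^'n::{finite,wellorder}"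
  assumes lin: "linear \<Phi>" "linear \<Psi>" and inv: "\<And>x. \<Psi> (\<Phi> x) = x" "\<And>y. \<Phi> (\<Psi> y) = y"
    and nrm: "\<And>x. norm (\<Phi> x) = norm x" and n: "CARD('n) = 2 * CARD('d)" and A: "invertible A"
  shows "\<bar>det (matrix (\<lambda>y. \<Phi> (A *v \<Psi> y)))\<bar> = cmod (det A) ^ 2"
proof -
  have linA: "linear (\<lambda>y. \<Phi> (A *v \<Psi> y))" for A
  proof (rule linearI)
    fix x y c
    show "\<Phi> (A *v \<Psi> (x + y)) = \<Phi> (A *v \<Psi> x) + \<Phi> (A *v \<Psi> y)"
      by (simp add: linear_add[OF lin(1)] linear_add[OF lin(2)] matrix_vector_right_distrib)
    show "\<Phi> (A *v \<Psi> (c *\<^sub>R x)) = c *\<^sub>R \<Phi> (A *v \<Psi> x)"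
      by (simp add: linear_scale[OF lin(2)] scaleR_eq_smult vec.scale flip: linear_scale[OF lin(1)])
  qed
  let ?R = "\<lambda>A. \<bar>det (matrix (\<lambda>y. \<Phi> (A *v \<Psi> y)))\<bar>"
  have "multiplicative_matrix_norm ?R"
  proof
    fix A B :: "complex^'d^'d"
    have "(\<lambda>y. \<Phi> ((A ** B) *v \<Psi> y)) = (\<lambda>y. \<Phi> (A *v \<Psi> y)) \<circ> (\<lambda>y. \<Phi> (B *v \<Psi> y))"
      by (simp add: fun_eq_iff inv mult_vec_assoc)
    then show "?R (A ** B) = ?R A * ?R B"
      by (simp add: matrix_compose[OF linA linA] det_mul abs_mult)
  next
    fix t :: real assume t: "t > 0"
    have "\<Phi> (mat (of_real t) *v \<Psi> y) = t *\<^sub>R y" for y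
      using linear_scale[OF lin(1), of t "\<Psi> y"] by (simp add: scaleR_eq_smult inv)
    then have e: "matrix (\<lambda>y. \<Phi> (mat (of_real t) *v \<Psi> y)) $ i $ j = (if i = j then t else 0)" for i j
      by (simp add: matrix_def axis_def)
    have "det (matrix (\<lambda>y. \<Phi> (mat (of_real t) *v \<Psi> y))) = t ^ CARD('n)"
      by (subst det_diagonal) (auto simp: e simp del: matrix_scalar_mult_vec)
    then show "?R (mat (of_real t)) = (t ^ 2) ^ CARD('d)"
      using t by (simp add: n power_mult)
  next
    fix c :: complex and k :: 'd assume c: "cmod c = 1"
    have "norm (matrix_scale {k} c *v x) = norm x" for x
      unfolding norm_vec_def by (rule arg_cong2[where f = L2_set]) (auto simp: fun_eq_iff norm_mult c)
    moreover have "norm (\<Psi> y) = norm y" for y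
      using nrm[of "\<Psi> y"] inv by simp
    ultimately have "orthogonal_transformation (\<lambda>y. \<Phi> (matrix_scale {k} c *v \<Psi> y))"
      unfolding orthogonal_transformation using linA[of "matrix_scale {k} c"] nrm by simp
    then show "?R (matrix_scale {k} c) = 1"
      by (rule orthogonal_transformation_det)
  qed auto
  from multiplicative_matrix_norm_unique[OF this multiplicative_matrix_norm_det A] show ?thesis .
qed

lemma set_integral_bounded_linear_iso:
  fixes f :: "'a \<Rightarrow> 'b::{banach, second_countable_topology}"
    and J :: "'b \<Rightarrow> 'c::{banach, second_countable_topology}"
  assumes J: "bounded_linear J" and K: "bounded_linear K" and KJ: "\<And>x. K (J x) = x"
  shows "set_integrable M S (\<lambda>x. J (f x)) \<longleftrightarrow> set_integrable M S f"
    and "set_integrable M S f \<Longrightarrow> (LINT x:S|M. J (f x)) = J (LINT x:S|M. f x)"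
proof -
  have e: "indicator S x *\<^sub>R J (f x) = J (indicator S x *\<^sub>R f x)" for x
    by (simp add: linear_scale bounded_linear.linear[OF J])
  show "set_integrable M S (\<lambda>x. J (f x)) \<longleftrightarrow> set_integrable M S f"
    unfolding set_integrable_def e
  proof
    assume "integrable M (\<lambda>x. J (indicator S x *\<^sub>R f x))"
    from integrable_bounded_linear[OF K this] show "integrable M (\<lambda>x. indicator S x *\<^sub>R f x)"
      by (simp add: KJ)
  qed (rule integrable_bounded_linear[OF J])
  show "(LINT x:S|M. J (f x)) = J (LINT x:S|M. f x)" if "set_integrable M S f"
    using that unfolding set_integrable_def set_lebesgue_integral_def e
    by (rule integral_bounded_linear[OF J])
qed

text \<open>In real coordinates this is the change of variables formula with the real Jacobian, which is the squared modulus of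
  the complex one.\<close>

theorem change_of_variables_complex:
  fixes g :: "complex^'d \<Rightarrow> complex^'d" and F :: "complex^'d \<Rightarrow> complex"
  assumes S: "S \<in> sets lebesgue" and der: "\<And>x. x \<in> S \<Longrightarrow> (g has_derivative (*v) (A x)) (at x)"
    and A: "\<And>x. x \<in> S \<Longrightarrow> invertible (A x)" and inj: "inj_on g S"
  shows "set_integrable lebesgue (g ` S) F \<longleftrightarrow>
      set_integrable lebesgue S (\<lambda>x. of_real (cmod (det (A x)) ^ 2) * F (g x))"
    and "(LINT u:g ` S|lebesgue. F u) =
      (LINT x:S|lebesgue. of_real (cmod (det (A x)) ^ 2) * F (g x))"
proof -
  \<comment> \<open>The type \<open>'d bit0\<close> has twice as many elements as \<open>'d\<close>.\<close>
  have dim: "DIM(complex^'d) = DIM(real^'d bit0)" "DIM(complex) = DIM(real^2)"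
    by simp_all
  obtain \<Phi> :: "complex^'d \<Rightarrow> real^'d bit0" and \<Psi> where \<Phi>:
    "linear \<Phi>" "linear \<Psi>" "\<And>x. \<Psi> (\<Phi> x) = x" "\<And>y. \<Phi> (\<Psi> y) = y" "\<And>x. norm (\<Phi> x) = norm x"
    "distr lborel lborel \<Phi> = lborel" "distr lborel lborel \<Psi> = lborel"
    by (rule euclidean_coordinates[OF dim(1) that])
  obtain J :: "complex \<Rightarrow> real^2" and K where J: "linear J" "linear K" "\<And>x. K (J x) = x"
    by (rule euclidean_coordinates[OF dim(2) that])
  then have blJ: "bounded_linear J" "bounded_linear K"
    by (simp_all add: linear_conv_bounded_linear)
  have bl: "bounded_linear \<Phi>" "bounded_linear \<Psi>"
    using \<Phi> by (simp_all add: linear_conv_bounded_linear)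
  note tr = set_integral_lebesgue_transport[OF \<Phi>(1-4,6,7)]
  note iso = set_integral_bounded_linear_iso[OF blJ J(3), where M = lebesgue]
  let ?h = "\<lambda>y. \<Phi> (g (\<Psi> y))" and ?h' = "\<lambda>y v. \<Phi> (A (\<Psi> y) *v \<Psi> v)"
  let ?f = "\<lambda>y. J (F (\<Psi> y))"
  let ?w = "\<lambda>y. \<bar>det (matrix (?h' y))\<bar>"
  have im: "?h ` \<Phi> ` S = \<Phi> ` g ` S"
    by (simp add: image_image \<Phi>(3))
  have w: "?w (\<Phi> x) = cmod (det (A x)) ^ 2" if "x \<in> S" for x
    unfolding \<Phi>(3) by (rule real_det_complex_matrix[OF \<Phi>(1-5) _ A[OF that]]) simp
  have cov: "set_integrable lebesgue (\<Phi> ` S) (\<lambda>y. ?w y *\<^sub>R ?f (?h y)) \<and>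
      integral (\<Phi> ` S) (\<lambda>y. ?w y *\<^sub>R ?f (?h y)) = b \<longleftrightarrow>
      set_integrable lebesgue (?h ` \<Phi> ` S) ?f \<and> integral (?h ` \<Phi> ` S) ?f = b" for b
  proof (rule has_absolute_integral_change_of_variables[where S = "\<Phi> ` S" and g = ?h and g' = ?h' and f = ?f])
    have "y \<in> \<Phi> ` S \<longleftrightarrow> \<Psi> y \<in> S" for y
      by (metis \<Phi>(3,4) imageE imageI)
    then have "\<Phi> ` S = \<Psi> -` S" by (auto simp only: vimage_def mem_Collect_eq)
    then show "\<Phi> ` S \<in> sets lebesgue"
      using measurable_sets[OF lebesgue_distr(1)[OF \<Phi>(2,7)] S] by simp
    show "inj_on ?h (\<Phi> ` S)"
    proof (rule inj_onI)
      fix y y' assume "y \<in> \<Phi> ` S" "y' \<in> \<Phi> ` S" and eq: "?h y = ?h y'"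
      then obtain x x' where x: "y = \<Phi> x" "y' = \<Phi> x'" "x \<in> S" "x' \<in> S" by blast
      have "g (\<Psi> y) = g (\<Psi> y')" using eq \<Phi>(3) by metis
      then show "y = y'" using inj_onD[OF inj _ x(3,4)] x(1,2) \<Phi>(3) by simp
    qed
    fix y assume "y \<in> \<Phi> ` S"
    then have y: "\<Psi> y \<in> S" using \<Phi>(3) by auto
    have "(\<Psi> has_derivative \<Psi>) (at y within \<Phi> ` S)"
      by (rule bounded_linear_imp_has_derivative[OF bl(2)])
    from has_derivative_compose[OF this der[OF y]]
    show "(?h has_derivative ?h' y) (at y within \<Phi> ` S)"
      by (rule bounded_linear.has_derivative[OF bl(1)])
  qed
  have i1: "set_integrable lebesgue (?h ` \<Phi> ` S) ?f \<longleftrightarrow> set_integrable lebesgue (g ` S) F"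
    unfolding im tr \<Phi>(3) iso ..
  have congS: "set_integrable lebesgue S (\<lambda>x. ?w (\<Phi> x) *\<^sub>R ?f (?h (\<Phi> x))) \<longleftrightarrow>
      set_integrable lebesgue S (\<lambda>x. J (of_real (cmod (det (A x)) ^ 2) * F (g x)))"
    "(LINT x:S|lebesgue. ?w (\<Phi> x) *\<^sub>R ?f (?h (\<Phi> x))) =
      (LINT x:S|lebesgue. J (of_real (cmod (det (A x)) ^ 2) * F (g x)))"
  proof -
    have e: "?w (\<Phi> x) *\<^sub>R ?f (?h (\<Phi> x)) = J (of_real (cmod (det (A x)) ^ 2) * F (g x))" if "x \<in> S" for x
      unfolding w[OF that] using linear_scale[OF J(1)]
      by (simp add: \<Phi> flip: scaleR_conv_of_real of_real_power)
    have "(\<lambda>x. indicator S x *\<^sub>R (?w (\<Phi> x) *\<^sub>R ?f (?h (\<Phi> x)))) =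
        (\<lambda>x. indicator S x *\<^sub>R J (of_real (cmod (det (A x)) ^ 2) * F (g x)))"
      using e by (auto simp: fun_eq_iff indicator_def)
    then show "set_integrable lebesgue S (\<lambda>x. ?w (\<Phi> x) *\<^sub>R ?f (?h (\<Phi> x))) \<longleftrightarrow>
        set_integrable lebesgue S (\<lambda>x. J (of_real (cmod (det (A x)) ^ 2) * F (g x)))"
      "(LINT x:S|lebesgue. ?w (\<Phi> x) *\<^sub>R ?f (?h (\<Phi> x))) =
        (LINT x:S|lebesgue. J (of_real (cmod (det (A x)) ^ 2) * F (g x)))"
      unfolding set_integrable_def set_lebesgue_integral_def by auto
  qed
  have i2: "set_integrable lebesgue (\<Phi> ` S) (\<lambda>y. ?w y *\<^sub>R ?f (?h y)) \<longleftrightarrow>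
      set_integrable lebesgue S (\<lambda>x. of_real (cmod (det (A x)) ^ 2) * F (g x))"
    unfolding tr congS iso ..
  show eq: "set_integrable lebesgue (g ` S) F \<longleftrightarrow>
      set_integrable lebesgue S (\<lambda>x. of_real (cmod (det (A x)) ^ 2) * F (g x))"
    using cov i1 i2 by blast
  show "(LINT u:g ` S|lebesgue. F u) =
      (LINT x:S|lebesgue. of_real (cmod (det (A x)) ^ 2) * F (g x))"
  proof (cases "set_integrable lebesgue (g ` S) F")
    case True
    have "J (LINT u:g ` S|lebesgue. F u) = (LINT u:g ` S|lebesgue. J (F u))"
      by (rule iso(2)[OF True, symmetric])
    also have "\<dots> = (LINT y:?h ` \<Phi> ` S|lebesgue. ?f y)"
      unfolding im tr \<Phi>(3) ..
    also have "\<dots> = integral (?h ` \<Phi> ` S) ?f"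
      using True i1 by (intro set_lebesgue_integral_eq_integral(2)) blast
    also have "\<dots> = integral (\<Phi> ` S) (\<lambda>y. ?w y *\<^sub>R ?f (?h y))"
      using cov True i1 by blast
    also have "\<dots> = (LINT y:\<Phi> ` S|lebesgue. ?w y *\<^sub>R ?f (?h y))"
      using True eq i2 by (intro set_lebesgue_integral_eq_integral(2)[symmetric]) blast
    also have "\<dots> = J (LINT x:S|lebesgue. of_real (cmod (det (A x)) ^ 2) * F (g x))"
      unfolding tr congS using True eq by (intro iso(2)) blast
    finally show ?thesis using J(3) by metis
  next
    case False
    then show ?thesis
      using eq unfolding set_integrable_def set_lebesgue_integral_def
      by (metis (no_types, lifting) not_integrable_integral_eq)
  qed
qed

section \<open>Linear forms in general position\<close>

lemma linear_form_proportional: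
  assumes l: "linear_form l" "linear_form m" and v: "l v = 1" and ker: "\<And>z. l z = 0 \<Longrightarrow> m z = 0"
  shows "m z = m v * l z"
proof -
  have "l (z - l z *s v) = 0"
    by (simp add: l v linear_form_diff linear_form_scale)
  from ker[OF this] show ?thesis
    by (simp add: l linear_form_diff linear_form_scale mult.commute)
qed

lemma linear_form_unit_vector:
  assumes "linear_form l" "l z \<noteq> 0"
  obtains v where "l v = 1"
  using that[of "(1 / l z) *s z"] assms by (simp add: linear_form_scale)

text \<open>A vector space over an infinite field is not a finite union of proper subspaces.\<close>

lemma linear_forms_avoid_zero:
  assumes "finite I" and l: "\<And>i. i \<in> I \<Longrightarrow> linear_form (l i)"
    and W: "\<And>x y. x \<in> W \<Longrightarrow> y \<in> W \<Longrightarrow> x + y \<in> W" "\<And>c x. x \<in> W \<Longrightarrow> c *s x \<in> W" "0 \<in> W"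
    and nz: "\<And>i. i \<in> I \<Longrightarrow> \<exists>w\<in>W. l i w \<noteq> 0"
  shows "\<exists>v\<in>W. \<forall>i\<in>I. l i (v :: complex^'d) \<noteq> 0"
  using \<open>finite I\<close> l nz
proof (induction I)
  case empty
  then show ?case using W(3) by auto
next
  case (insert i I)
  then obtain v where v: "v \<in> W" "\<forall>j\<in>I. l j v \<noteq> 0" by auto
  obtain w where w: "w \<in> W" "l i w \<noteq> 0" using insert.prems(2)[of i] by auto
  show ?case
  proof (cases "l i v = 0")
    case False
    then show ?thesis using v by auto
  next
    case True
    have "finite ((\<lambda>j. - l j w / l j v) ` I)" using insert by simp
    then obtain t where t: "t \<notin> (\<lambda>j. - l j w / l j v) ` I"
      using ex_new_if_finite[OF infinite_UNIV_char_0] by blast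
    have "l j (w + t *s v) \<noteq> 0" if "j \<in> insert i I" for j
    proof (cases "j = i")
      case True
      then show ?thesis
        using w \<open>l i v = 0\<close> insert.prems(1)[OF that] by (simp add: linear_form_add linear_form_scale)
    next
      case False
      then have j: "j \<in> I" "l j v \<noteq> 0" using that v by auto
      have "l j w + t * l j v \<noteq> 0"
      proof
        assume "l j w + t * l j v = 0"
        then have "t = - l j w / l j v"
          using j(2) by (simp add: field_simps add_eq_0_iff)
        then show False using t j(1) by blast
      qed
      then show ?thesis
        using insert.prems(1)[OF that] by (simp add: linear_form_add linear_form_scale)
    qed
    moreover have "w + t *s v \<in> W" using W v w by blast
    ultimately show ?thesis by blast
  qed
qed

lemma linear_form_eventually_nonzero:
  assumes "linear_form l" "l v \<noteq> 0"
  shows "\<forall>\<^sub>F t in at 0. l (p + t *s v) \<noteq> 0"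
proof -
  have "\<forall>\<^sub>F t in at 0. t \<noteq> - l p / l v"
    by (rule eventually_neq_at_within)
  then show ?thesis
  proof eventually_elim
    case (elim t)
    show ?case
    proof
      assume "l (p + t *s v) = 0"
      then have "l p + t * l v = 0" using assms(1) by (simp add: linear_form_add linear_form_scale)
      then have "t = - l p / l v" using assms(2) by (simp add: field_simps add_eq_0_iff)
      then show False using elim by simp
    qed
  qed
qed

lemma prod_power_eventually_nonzero:
  assumes "finite I" "\<And>i. i \<in> I \<Longrightarrow> linear_form (l i)" "\<And>i. i \<in> I \<Longrightarrow> l i v \<noteq> 0"
  shows "\<forall>\<^sub>F t in at 0. (\<Prod>i\<in>I. l i (p + t *s v) ^ c i) \<noteq> 0"
proof -
  have "\<forall>\<^sub>F t in at 0. \<forall>i\<in>I. l i (p + t *s v) \<noteq> 0"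
    using assms by (intro eventually_ball_finite ballI linear_form_eventually_nonzero) auto
  then show ?thesis
    by eventually_elim (simp add: assms(1))
qed

lemma line_tendsto: "((\<lambda>t. p + t *s v) \<longlongrightarrow> (p :: complex^'d)) (at 0)"
proof -
  have "continuous_on UNIV (\<lambda>t. p + t *s v)" by (intro continuous_intros)
  then have "isCont (\<lambda>t. p + t *s v) 0" by (simp only: continuous_on_eq_continuous_at open_UNIV) simp
  from isContD[OF this] show ?thesis by simp
qed

lemma line_eventually_in_open:
  "open D \<Longrightarrow> p \<in> D \<Longrightarrow> \<forall>\<^sub>F t in at 0. p + t *s v \<in> (D :: (complex^'d) set)"
  by (rule topological_tendstoD[OF line_tendsto])

lemma continuous_eq_on_line:
  fixes f g :: "complex^'d \<Rightarrow> complex"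
  assumes "open D" "p \<in> D" "continuous_on D f" "continuous_on D g"
    and "\<forall>\<^sub>F t in at 0. p + t *s v \<in> D \<longrightarrow> f (p + t *s v) = g (p + t *s v)"
  shows "f p = g p"
proof -
  have lim: "((\<lambda>t. h (p + t *s v)) \<longlongrightarrow> h p) (at 0)" if "continuous_on D h" for h :: "complex^'d \<Rightarrow> complex"
  proof -
    have "isCont h p"
      using that assms(1,2) continuous_on_eq_continuous_at by blast
    then show ?thesis by (rule isCont_tendsto_compose[OF _ line_tendsto])
  qed
  have "\<forall>\<^sub>F t in at 0. f (p + t *s v) = g (p + t *s v)"
    using assms(5) line_eventually_in_open[OF assms(1,2), of v] by eventually_elim simp
  then have "((\<lambda>t. g (p + t *s v)) \<longlongrightarrow> f p) (at 0)"
    using lim[OF assms(3)] by (rule Lim_transform_eventually[rotated])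
  from tendsto_unique[OF _ this lim[OF assms(4)]] show ?thesis by simp
qed

subsection \<open>Divisibility by products of linear forms\<close>

text \<open>If \<open>f (A z) = \<eta> f z\<close> with \<open>\<eta> \<noteq> 1\<close> and \<open>A\<close> fixes the hyperplane \<open>l = 0\<close> pointwise, then \<open>f\<close>
  vanishes on it; dividing by \<open>l\<close> replaces \<open>\<eta>\<close> by \<open>\<eta> / \<mu>\<close>.\<close>

lemma divisible_by_power_of_linear_form:
  fixes f l :: "complex^'d \<Rightarrow> complex"
  assumes D: "open D" and AD: "\<And>z. z \<in> D \<Longrightarrow> A *v z \<in> D" and l: "linear_form l" "l v = 1"
    and fix0: "\<And>z. l z = 0 \<Longrightarrow> A *v z = z" and lA: "\<And>z. l (A *v z) = \<mu> * l z" and \<mu>: "\<mu> \<noteq> 0"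
    and f: "holomorphic_several f D" "\<And>z. z \<in> D \<Longrightarrow> f (A *v z) = \<mu> ^ c * f z"
    and c: "\<And>j. j < c \<Longrightarrow> \<mu> ^ c \<noteq> \<mu> ^ j"
  shows "\<exists>g. holomorphic_several g D \<and> (\<forall>z\<in>D. f z = l z ^ c * g z)"
  using f c
proof (induction c arbitrary: f)
  case 0
  then show ?case by auto
next
  case (Suc c)
  have z0: "f z = 0" if "z \<in> D" "l z = 0" for z
  proof -
    have "f z = \<mu> ^ Suc c * f z"
      using Suc.prems(2)[OF that(1)] fix0[OF that(2)] by simp
    moreover have "\<mu> ^ Suc c \<noteq> 1" using Suc.prems(3)[of 0] by simp
    ultimately show ?thesis by (metis mult_cancel_right1)
  qed
  obtain g where g: "holomorphic_several g D" "\<And>z. z \<in> D \<Longrightarrow> f z = l z * g z"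
    using holomorphic_several_divide_linear_form[OF D Suc.prems(1) l z0] by metis
  have contg: "continuous_on D g" by (rule holomorphic_several_continuous_on[OF g(1)])
  have gA: "g (A *v z) = \<mu> ^ c * g z" if z: "z \<in> D" for z
  proof (rule continuous_eq_on_line[where v = v, OF D z])
    show "continuous_on D (\<lambda>z. g (A *v z))"
      by (rule continuous_on_compose2[OF contg]) (use AD in \<open>auto intro!: continuous_intros\<close>)
    show "continuous_on D (\<lambda>z. \<mu> ^ c * g z)"
      by (intro continuous_intros contg)
    have "\<forall>\<^sub>F t in at 0. l (z + t *s v) \<noteq> 0"
      by (rule linear_form_eventually_nonzero) (simp_all add: l)
    then show "\<forall>\<^sub>F t in at 0. z + t *s v \<in> D \<longrightarrow> g (A *v (z + t *s v)) = \<mu> ^ c * g (z + t *s v)"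
    proof eventually_elim
      case (elim t)
      let ?x = "z + t *s v"
      show ?case
      proof
        assume x: "?x \<in> D"
        have "\<mu> * l ?x * g (A *v ?x) = \<mu> ^ Suc c * (l ?x * g ?x)"
          using Suc.prems(2)[OF x] g(2)[OF x] g(2)[OF AD[OF x]] lA by simp
        then have "(\<mu> * l ?x) * g (A *v ?x) = (\<mu> * l ?x) * (\<mu> ^ c * g ?x)"
          by (simp only: power_Suc mult_ac)
        then show "g (A *v ?x) = \<mu> ^ c * g ?x"
          using elim \<mu> by (simp only: mult_cancel_left) simp
      qed
    qed
  qed
  have "\<And>j. j < c \<Longrightarrow> \<mu> ^ c \<noteq> \<mu> ^ j"
    using Suc.prems(3)[of "Suc j" for j] by auto
  from Suc.IH[OF g(1) gA this] obtain h where h: "holomorphic_several h D" "\<And>z. z \<in> D \<Longrightarrow> g z = l z ^ c * h z"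
    by blast
  then show ?case using g(2) by (intro exI[of _ h]) (simp add: mult.assoc)
qed

text \<open>No line in the direction \<open>w\<close>, which is parallel to the hyperplane \<open>l = 0\<close>, has zeros of \<open>P\<close> accumulating at one of its
  points. So \<open>g\<close> vanishes on the hyperplane, and one factor \<open>l\<close> after the other can be cancelled.\<close>

lemma divide_power_coprime:
  fixes g l F P :: "complex^'d \<Rightarrow> complex"
  assumes D: "open D" and l: "linear_form l" "l v = 1"
    and w: "l w = 0" "\<And>p. \<forall>\<^sub>F t in at 0. P (p + t *s w) \<noteq> 0"
    and cont: "continuous_on D F" "continuous_on D P"
    and g: "holomorphic_several g D" "\<And>z. z \<in> D \<Longrightarrow> l z ^ c * F z = P z * g z"
  shows "\<exists>h. holomorphic_several h D \<and> (\<forall>z\<in>D. g z = l z ^ c * h z)"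
  using g
proof (induction c arbitrary: g)
  case 0
  then show ?case by auto
next
  case (Suc c)
  have z0: "g z = 0" if z: "z \<in> D" "l z = 0" for z
  proof (rule continuous_eq_on_line[where v = w and g = "\<lambda>z. 0", OF D z(1)])
    show "\<forall>\<^sub>F t in at 0. z + t *s w \<in> D \<longrightarrow> g (z + t *s w) = 0"
      using w(2)[of z]
    proof eventually_elim
      case (elim t)
      have "l (z + t *s w) = 0" using z w by (simp add: l linear_form_add linear_form_scale)
      then show ?case using Suc.prems(2)[of "z + t *s w"] elim by auto
    qed
  qed (auto intro: holomorphic_several_continuous_on Suc.prems)
  obtain g1 where g1: "holomorphic_several g1 D" "\<And>z. z \<in> D \<Longrightarrow> g z = l z * g1 z"
    using holomorphic_several_divide_linear_form[OF D Suc.prems(1) l z0] by metis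
  have eq: "l z ^ c * F z = P z * g1 z" if z: "z \<in> D" for z
  proof (rule continuous_eq_on_line[where v = v, OF D z])
    show "continuous_on D (\<lambda>z. l z ^ c * F z)"
      by (intro continuous_intros cont holomorphic_several_continuous_on holomorphic_several_linear_form l)
    show "continuous_on D (\<lambda>z. P z * g1 z)"
      by (intro continuous_intros cont holomorphic_several_continuous_on g1)
    have "\<forall>\<^sub>F t in at 0. l (z + t *s v) \<noteq> 0"
      by (rule linear_form_eventually_nonzero) (simp_all add: l)
    then show "\<forall>\<^sub>F t in at 0. z + t *s v \<in> D \<longrightarrow>
        l (z + t *s v) ^ c * F (z + t *s v) = P (z + t *s v) * g1 (z + t *s v)"
    proof eventually_elim
      case (elim t)
      let ?x = "z + t *s v"
      show ?case
      proof
        assume x: "?x \<in> D"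
        have "l ?x * (l ?x ^ c * F ?x) = l ?x * (P ?x * g1 ?x)"
          using Suc.prems(2)[OF x] g1(2)[OF x] by (simp add: mult_ac)
        then show "l ?x ^ c * F ?x = P ?x * g1 ?x"
          using elim by (simp only: mult_cancel_left) simp
      qed
    qed
  qed
  from Suc.IH[OF g1(1) eq] obtain h where h: "holomorphic_several h D" "\<And>z. z \<in> D \<Longrightarrow> g1 z = l z ^ c * h z"
    by blast
  then show ?case using g1(2) by (intro exI[of _ h]) (simp add: mult.assoc)
qed

text \<open>A generic vector of one hyperplane lies on none of the others, so the powers of the linear forms can be split off one
  after the other.\<close>

theorem divisible_by_product_of_linear_forms:
  fixes f :: "complex^'d \<Rightarrow> complex" and l :: "'i \<Rightarrow> complex^'d \<Rightarrow> complex"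
  assumes D: "open D" and I: "finite I" and l: "\<And>i. i \<in> I \<Longrightarrow> linear_form (l i)"
    and distinct: "\<And>i j. i \<in> I \<Longrightarrow> j \<in> I \<Longrightarrow> i \<noteq> j \<Longrightarrow> \<exists>w. l i w = 0 \<and> l j w \<noteq> 0"
    and nz: "\<And>i. i \<in> I \<Longrightarrow> \<exists>v. l i v = 1"
    and f: "holomorphic_several f D"
    and each: "\<And>i. i \<in> I \<Longrightarrow> \<exists>g. holomorphic_several g D \<and> (\<forall>z\<in>D. f z = l i z ^ c i * g z)"
  shows "\<exists>g. holomorphic_several g D \<and> (\<forall>z\<in>D. f z = (\<Prod>i\<in>I. l i z ^ c i) * g z)"
  using I l distinct nz each
proof (induction I)
  case empty
  then show ?case using f by auto
next
  case (insert i I)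
  obtain g where g: "holomorphic_several g D" "\<And>z. z \<in> D \<Longrightarrow> f z = (\<Prod>i\<in>I. l i z ^ c i) * g z"
    using insert.IH[OF insert.prems(1) insert.prems(2) insert.prems(3) insert.prems(4)] by auto
  obtain F where F: "holomorphic_several F D" "\<And>z. z \<in> D \<Longrightarrow> f z = l i z ^ c i * F z"
    using insert.prems(4)[of i] by blast
  have li: "linear_form (l i)" using insert.prems(1) by blast
  obtain v where v: "l i v = 1" using insert.prems(3)[of i] by blast
  have lj: "linear_form (l j)" if "j \<in> I" for j using insert.prems(1) that by blast
  have "\<exists>w\<in>{z. l i z = 0}. \<forall>j\<in>I. l j w \<noteq> 0"
  proof (rule linear_forms_avoid_zero[OF insert.hyps(1) lj])
    fix j assume "j \<in> I"
    then have "i \<noteq> j" "j \<in> insert i I" using insert.hyps by auto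
    then show "\<exists>w\<in>{z. l i z = 0}. l j w \<noteq> 0"
      using insert.prems(2)[of i j] by auto
  qed (auto simp: linear_form_add[OF li] linear_form_scale[OF li] linear_form_zero[OF li])
  then obtain w where w: "l i w = 0" "\<And>j. j \<in> I \<Longrightarrow> l j w \<noteq> 0" by auto
  have "\<exists>h. holomorphic_several h D \<and> (\<forall>z\<in>D. g z = l i z ^ c i * h z)"
  proof (rule divide_power_coprime[OF D li v w(1) _ _ _ g(1)])
    show "\<forall>\<^sub>F t in at 0. (\<Prod>j\<in>I. l j (p + t *s w) ^ c j) \<noteq> 0" for p
      by (rule prod_power_eventually_nonzero[OF insert.hyps(1) lj w(2)])
    show "l i z ^ c i * F z = (\<Prod>j\<in>I. l j z ^ c j) * g z" if "z \<in> D" for z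
      using g(2)[OF that] F(2)[OF that] by simp
    show "continuous_on D (\<lambda>z. \<Prod>j\<in>I. l j z ^ c j)"
      by (intro holomorphic_several_continuous_on holomorphic_several_prod
          holomorphic_several_power holomorphic_several_linear_form lj)
  qed (rule holomorphic_several_continuous_on[OF F(1)])
  then obtain h where h: "holomorphic_several h D" "\<And>z. z \<in> D \<Longrightarrow> g z = l i z ^ c i * h z" by blast
  have "f z = (\<Prod>j\<in>insert i I. l j z ^ c j) * h z" if "z \<in> D" for z
    using g(2)[OF that] h(2)[OF that] insert.hyps by (simp add: mult_ac)
  then show ?case using h(1) by blast
qed

section \<open>Finite matrix groups and their one-dimensional representations\<close>

lemma GL_simps [simp]: "carrier GL = {A. invertible A}" "A \<otimes>\<^bsub>GL\<^esub> B = A ** B" "\<one>\<^bsub>GL\<^esub> = mat 1"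
  by (simp_all add: GL_def)

lemma group_GL: "group (GL :: (complex^'d^'d) monoid)"
proof (rule groupI)
  have "invertible (mat 1 :: complex^'d^'d)"
    unfolding invertible_def by (rule exI[of _ "mat 1"]) simp
  then show "\<one>\<^bsub>GL\<^esub> \<in> carrier (GL :: (complex^'d^'d) monoid)" by simp
next
  fix A :: "complex^'d^'d" assume "A \<in> carrier GL"
  then obtain B where "A ** B = mat 1" "B ** A = mat 1" by (auto simp: invertible_def)
  then show "\<exists>B\<in>carrier GL. B \<otimes>\<^bsub>GL\<^esub> A = \<one>\<^bsub>GL\<^esub>"
    by (auto simp: invertible_def)
qed (auto simp: invertible_mult matrix_mul_assoc)

locale finite_matrix_group =
  fixes G :: "(complex^'d^'d) set"
  assumes fin: "finite G" and sub: "subgroup G GL"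
begin

abbreviation iv :: "complex^'d^'d \<Rightarrow> complex^'d^'d" where "iv A \<equiv> inv\<^bsub>GL\<^esub> A"

lemma one_in: "mat 1 \<in> G" and mult_in: "A \<in> G \<Longrightarrow> B \<in> G \<Longrightarrow> A ** B \<in> G"
  and iv_in: "A \<in> G \<Longrightarrow> iv A \<in> G" and invertible: "A \<in> G \<Longrightarrow> invertible A"
  using subgroup.one_closed[OF sub] subgroup.m_closed[OF sub] subgroup.m_inv_closed[OF sub]
    subgroup.subset[OF sub] by auto

lemma iv_mult: assumes "A \<in> G" shows "iv A ** A = mat 1" "A ** iv A = mat 1" "iv (iv A) = A"
  using group.l_inv[OF group_GL, of A] group.r_inv[OF group_GL, of A] group.inv_inv[OF group_GL, of A]
    invertible[OF assms] by auto

lemma iv_mult_vec: assumes "A \<in> G" shows "iv A *v (A *v z) = z" "A *v (iv A *v z) = z"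
  using iv_mult[OF assms] by (simp_all flip: mult_vec_assoc)

lemma act_iv: "A \<in> G \<Longrightarrow> act (iv A) z = A *v z"
  by (simp add: act_def iv_mult)

lemma act_fun_eq: "A \<in> G \<Longrightarrow> act_fun A f z = f (A *v z)"
  by (simp add: act_fun_def act_iv)

lemma left_mult_bij: assumes "A \<in> G" shows "bij_betw ((**) A) G G"
proof (rule bij_betwI[where g = "(**) (iv A)"])
  show "iv A ** (A ** B) = B" "A ** (iv A ** B) = B" for B
    using iv_mult[OF assms] by (simp_all add: matrix_mul_assoc)
qed (auto simp: assms mult_in iv_in)

lemma right_mult_bij: assumes "A \<in> G" shows "bij_betw (\<lambda>B. B ** A) G G"
proof (rule bij_betwI[where g = "\<lambda>B. B ** iv A"])
  show "(B ** A) ** iv A = B" "(B ** iv A) ** A = B" for B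
    using iv_mult[OF assms] by (simp_all flip: matrix_mul_assoc)
qed (auto simp: assms mult_in iv_in)

lemma character_power_card:
  fixes \<psi> :: "complex^'d^'d \<Rightarrow> complex"
  assumes "\<And>A B. A \<in> G \<Longrightarrow> B \<in> G \<Longrightarrow> \<psi> (A ** B) = \<psi> A * \<psi> B" "\<And>A. A \<in> G \<Longrightarrow> \<psi> A \<noteq> 0"
    and A: "A \<in> G"
  shows "\<psi> A ^ card G = 1"
proof -
  have "(\<Prod>B\<in>G. \<psi> B) = (\<Prod>B\<in>G. \<psi> (A ** B))"
    using prod.reindex_bij_betw[OF left_mult_bij[OF A], of \<psi>] by simp
  also have "\<dots> = (\<Prod>B\<in>G. \<psi> A * \<psi> B)"
    using assms by (intro prod.cong) auto
  also have "\<dots> = \<psi> A ^ card G * (\<Prod>B\<in>G. \<psi> B)"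
    by (simp add: prod.distrib)
  finally show ?thesis using assms(2) fin by simp
qed

lemma card_pos: "card G > 0"
  using one_in fin card_gt_0_iff by blast

lemma character_norm:
  fixes \<psi> :: "complex^'d^'d \<Rightarrow> complex"
  assumes "\<And>A B. A \<in> G \<Longrightarrow> B \<in> G \<Longrightarrow> \<psi> (A ** B) = \<psi> A * \<psi> B" "\<And>A. A \<in> G \<Longrightarrow> \<psi> A \<noteq> 0"
    and A: "A \<in> G"
  shows "cmod (\<psi> A) = 1"
proof -
  have "cmod (\<psi> A) ^ card G = 1 ^ card G"
    using character_power_card[OF assms] by (metis norm_one norm_power power_one)
  then show ?thesis by (rule power_eq_imp_eq_base) (simp_all add: card_pos)
qed

lemma det_nz: "A \<in> G \<Longrightarrow> det A \<noteq> 0"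
  using invertible by (simp add: invertible_det_nz)

lemma det_norm: "A \<in> G \<Longrightarrow> cmod (det A) = 1"
  by (rule character_norm) (auto simp: det_mul det_nz)

lemma matrix_power_eq_one:
  assumes A: "A \<in> G" shows "\<exists>n::nat. n > 0 \<and> A [^]\<^bsub>GL\<^esub> n = mat 1"
proof -
  interpret group "GL :: (complex^'d^'d) monoid" by (rule group_GL)
  have A': "A \<in> carrier GL" using invertible[OF A] by simp
  have pG: "A [^]\<^bsub>GL\<^esub> n \<in> G" for n :: nat
    by (induction n) (auto simp: one_in mult_in A)
  have "\<not> inj_on (\<lambda>n::nat. A [^]\<^bsub>GL\<^esub> n) UNIV"
    using pG finite_subset[OF _ fin] finite_imageD by (metis image_subsetI infinite_UNIV_nat)
  then obtain i j :: nat where "i < j" "A [^]\<^bsub>GL\<^esub> i = A [^]\<^bsub>GL\<^esub> j"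
    unfolding inj_on_def by (metis nat_neq_iff)
  then have "A [^]\<^bsub>GL\<^esub> (j - i) = \<one>\<^bsub>GL\<^esub>"
    by (intro pow_eq_div2[OF A']) simp
  then show ?thesis using \<open>i < j\<close> by (intro exI[of _ "j - i"]) simp
qed

end

subsection \<open>Matrices fixing a hyperplane pointwise\<close>

lemma fixes_hyperplane_eq:
  assumes l: "linear_form l" "l v = 1" and fix0: "\<And>z. l z = 0 \<Longrightarrow> A *v z = z"
  shows "A *v z = z + l z *s (A *v v - v)"
proof -
  have "A *v (z - l z *s v) = z - l z *s v"
    by (rule fix0) (simp add: l linear_form_diff linear_form_scale)
  then show ?thesis
    by (simp add: matrix_vector_mult_diff_distrib vec.scale vector_ssub_ldistrib algebra_simps)
qed

text \<open>In coordinates in which \<open>l\<close> is the \<open>k\<close>-th one, the matrix differs from the identity in the \<open>k\<close>-th column only.\<close>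

lemma det_fixes_hyperplane:
  fixes A :: "complex^'d^'d"
  assumes l: "linear_form l" "l v = 1" and fix0: "\<And>z. l z = 0 \<Longrightarrow> A *v z = z"
  shows "l (A *v z) = det A * l z"
proof -
  define u where "u = A *v v - v"
  have A: "A *v z = z + l z *s u" for z
    unfolding u_def by (rule fixes_hyperplane_eq[OF l fix0])
  have lsum: "l x = (\<Sum>i\<in>UNIV. x $ i * l (axis i 1))" for x
  proof -
    have "l (\<Sum>i\<in>I. x $ i *s axis i 1) = (\<Sum>i\<in>I. x $ i * l (axis i 1))" if "finite I" for I
      using that by (induction I) (auto simp: linear_form_zero l linear_form_add linear_form_scale)
    from this[of UNIV] show ?thesis by (simp add: basis_expansion)
  qed
  obtain k where k: "l (axis k 1) \<noteq> 0"
    using l(2) lsum[of v] by (metis (no_types, lifting) mult_zero_right sum.neutral zero_neq_one)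
  define P :: "complex^'d^'d" where "P = matrix (\<lambda>x. \<chi> i. if i = k then l x else x $ i)"
  have P: "P *v x = (\<chi> i. if i = k then l x else x $ i)" for x
    unfolding P_def
    by (rule matrix_linear_mult) (auto simp: vec_eq_iff linear_form_add linear_form_scale l)
  define w where "w = (\<chi> i. if i = k then l u else u $ i)"
  let ?M = "matrix_shear k w"
  have "P ** A = ?M ** P"
    by (rule matrix_eqI)
      (simp add: mult_vec_assoc P A vec_eq_iff linear_form_add linear_form_scale l w_def)
  then have "det P * det A = det ?M * det P" by (metis det_mul)
  moreover have "det P \<noteq> 0"
  proof -
    have "x = 0" if "P *v x = 0" for x
    proof -
      have i: "x $ i = 0" if "i \<noteq> k" for i
        using \<open>P *v x = 0\<close> that by (auto simp: P vec_eq_iff dest: spec[of _ i])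
      have "l x = 0"
        using \<open>P *v x = 0\<close> by (auto simp: P vec_eq_iff dest: spec[of _ k])
      moreover have "l x = x $ k * l (axis k 1)"
      proof -
        have "l x = (\<Sum>i\<in>{k}. x $ i * l (axis i 1))"
          unfolding lsum[of x] using i by (intro sum.mono_neutral_right) auto
        then show ?thesis by simp
      qed
      ultimately show ?thesis using i k by (metis mult_eq_0_iff vec_eq_iff zero_index)
    qed
    then have "invertible P"
      using invertible_left_inverse matrix_left_invertible_ker by blast
    then show ?thesis by (simp add: invertible_det_nz)
  qed
  ultimately have "det A = det ?M" by simp
  also have "\<dots> = 1 + w $ k"
  proof -
    have "?M = (\<chi> i j. if j = k then (mat 1 *v (axis k 1 + w)) $ i else mat 1 $ i $ j)"
      unfolding matrix_vector_mul_lid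
      by (simp add: matrix_shear_def matrix_def vec_eq_iff mat_def axis_def)
    then show ?thesis
      using cramer_lemma[of k "mat 1" "axis k 1 + w"] by (simp add: axis_def)
  qed
  also have "\<dots> = l (A *v v)"
    using l by (simp add: A w_def linear_form_add)
  finally have "det A = l (A *v v)" .
  moreover have "l (A *v z) = l z * l (A *v v)"
    using l by (simp add: A linear_form_add linear_form_scale algebra_simps)
  ultimately show ?thesis by simp
qed

lemma rank_zero: "rank (0 :: complex^'d^'d) = 0"
proof -
  have "rows (0 :: complex^'d^'d) = {0}" by (auto simp: rows_def row_def vec_eq_iff)
  moreover have "vec.dim (vec.span {} :: (complex^'d) set) = 0"
    by (simp only: vec.dim_span vec.dim_empty)
  ultimately show ?thesis by (simp add: row_rank_def_gen)
qed

lemma rank_one: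
  fixes B :: "complex^'d^'d"
  assumes B: "\<And>i j. B $ i $ j = w $ i * m $ j" and nz: "w $ i0 \<noteq> 0" "m $ j0 \<noteq> 0"
  shows "rank B = 1"
  unfolding row_rank_def_gen
proof (rule vec.dim_unique[of "{row i0 B}"])
  have row: "row i B = w $ i *s m" for i
    by (simp add: row_def vec_eq_iff B)
  show "{row i0 B} \<subseteq> rows B" by (auto simp: rows_def)
  show "rows B \<subseteq> vec.span {row i0 B}"
  proof
    fix x assume "x \<in> rows B"
    then obtain i where "x = row i B" by (auto simp: rows_def)
    then have "x = (w $ i / w $ i0) *s row i0 B" using nz by (simp add: row vec_eq_iff)
    then show "x \<in> vec.span {row i0 B}" by (simp add: vec.span_base vec.span_scale)
  qed
  have "row i0 B \<noteq> 0" using nz by (auto simp: row vec_eq_iff)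
  then show "vec.independent {row i0 B}" by simp
qed simp

section \<open>The semi-invariant polynomial of a one-dimensional representation\<close>

locale reflection_group = finite_matrix_group G for G :: "(complex^'d^'d) set" +
  fixes \<rho> :: "complex^'d^'d \<Rightarrow> complex" and a :: "(complex^'d) set \<Rightarrow> complex^'d^'d"
    and l :: "(complex^'d) set \<Rightarrow> complex^'d \<Rightarrow> complex"
  assumes gen: "G = generate GL {A \<in> G. complex_reflection A}"
    and rep: "one_dim_rep G \<rho>"
    and a: "\<And>H. H \<in> reflecting_hyperplanes G \<Longrightarrow> a H \<in> G \<and> pointwise_stabilizer G H = generate GL {a H}"
    and l: "\<And>H. H \<in> reflecting_hyperplanes G \<Longrightarrow> linear_form (l H) \<and> {z. l H z = 0} = H"
begin

abbreviation "hyps \<equiv> reflecting_hyperplanes G"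
abbreviation "L \<equiv> rep_poly G a l \<rho>"
abbreviation "expo H \<equiv> (LEAST c::nat. \<rho> (a H) = det (a H) ^ c)"

lemma \<rho>_mult: "A \<in> G \<Longrightarrow> B \<in> G \<Longrightarrow> \<rho> (A ** B) = \<rho> A * \<rho> B" and \<rho>_nz: "A \<in> G \<Longrightarrow> \<rho> A \<noteq> 0"
  using rep by (auto simp: one_dim_rep_def hom_def mult_complex_def GL_def)

lemma \<rho>_one: "\<rho> (mat 1) = 1"
  using \<rho>_mult[OF one_in one_in] \<rho>_nz[OF one_in] by simp

lemma \<rho>_iv: assumes "A \<in> G" shows "\<rho> (iv A) * \<rho> A = 1" "\<rho> A * \<rho> (iv A) = 1"
  using \<rho>_mult[OF assms iv_in[OF assms]] \<rho>_one iv_mult[OF assms] by (auto simp: mult.commute)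

lemma \<rho>_norm: "A \<in> G \<Longrightarrow> cmod (\<rho> A) = 1"
  by (rule character_norm) (auto simp: \<rho>_mult \<rho>_nz)

lemma \<rho>_cnj: assumes "A \<in> G" shows "cnj (\<rho> (iv A)) = \<rho> A"
proof -
  have "\<rho> (iv A) * cnj (\<rho> (iv A)) = \<rho> (iv A) * \<rho> A"
    using \<rho>_norm[OF iv_in[OF assms]] \<rho>_iv[OF assms] by (simp flip: complex_norm_square)
  then show ?thesis using \<rho>_nz[OF iv_in[OF assms]] by simp
qed

lemma det_iv: assumes "A \<in> G" shows "det (iv A) * det A = 1"
  using iv_mult[OF assms] det_mul[of "iv A" A] by simp

lemma hyps_finite: "finite hyps"
  unfolding reflecting_hyperplanes_def using fin by simp

lemma hyp_iff: "H \<in> hyps \<Longrightarrow> z \<in> H \<longleftrightarrow> l H z = 0"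
  using l by blast

lemma linear_form_l: "H \<in> hyps \<Longrightarrow> linear_form (l H)"
  using l by blast

lemma l_unit: assumes H: "H \<in> hyps" shows "\<exists>v. l H v = 1"
proof -
  obtain \<sigma> where \<sigma>: "complex_reflection \<sigma>" "H = {z. (mat 1 - \<sigma>) *v z = 0}"
    using H unfolding reflecting_hyperplanes_def by blast
  have "mat 1 - \<sigma> \<noteq> 0"
    using \<sigma>(1) rank_zero unfolding complex_reflection_def by (metis zero_neq_one)
  then obtain z where "(mat 1 - \<sigma>) *v z \<noteq> 0"
    using matrix_eq[of "mat 1 - \<sigma>" 0] by auto
  then have "l H z \<noteq> 0" using hyp_iff[OF H] \<sigma>(2) by blast
  then show ?thesis using linear_form_unit_vector[OF linear_form_l[OF H]] by metis
qed

lemma reflection_hyperplane: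
  assumes "\<sigma> \<in> G" "complex_reflection \<sigma>"
  shows "{z. \<sigma> *v z = z} \<in> hyps"
proof -
  have "{z. (mat 1 - \<sigma>) *v z = 0} = {z. \<sigma> *v z = z}"
    by (auto simp: matrix_vector_mult_diff_rdistrib)
  then show ?thesis using assms unfolding reflecting_hyperplanes_def by force
qed

lemma stabilizer_iff: "A \<in> pointwise_stabilizer G H \<longleftrightarrow> A \<in> G \<and> (\<forall>z\<in>H. A *v z = z)"
proof (cases "A \<in> G")
  case True
  have "act A z = z \<longleftrightarrow> A *v z = z" for z
    unfolding act_def using iv_mult_vec[OF True] by metis
  then show ?thesis unfolding pointwise_stabilizer_def by auto
qed (auto simp: pointwise_stabilizer_def)

lemma stabilizer_fixes:
  "H \<in> hyps \<Longrightarrow> A \<in> pointwise_stabilizer G H \<Longrightarrow> l H z = 0 \<Longrightarrow> A *v z = z"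
  using stabilizer_iff[of A H] hyp_iff[of H z] by simp

lemma stabilizer_l:
  assumes H: "H \<in> hyps" and A: "A \<in> pointwise_stabilizer G H"
  shows "l H (A *v z) = det A * l H z"
proof -
  obtain v where v: "l H v = 1" using l_unit[OF H] by blast
  show ?thesis
    by (rule det_fixes_hyperplane[OF linear_form_l[OF H] v stabilizer_fixes[OF H A]])
qed

lemma a_stabilizer:
  assumes "H \<in> hyps" shows "a H \<in> pointwise_stabilizer G H"
proof -
  have "a H \<in> generate GL {a H}" by (rule generate.incl) simp
  then show ?thesis using a[OF assms] by simp
qed

text \<open>An element of determinant \<open>1\<close> is a transvection \<open>z \<mapsto> z + l(z) u\<close> with \<open>l(u) = 0\<close>; its \<open>n\<close>-th power is
  \<open>z \<mapsto> z + n l(z) u\<close>, so it has finite order only if \<open>u = 0\<close>.\<close>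

lemma stabilizer_det_one:
  assumes H: "H \<in> hyps" and A: "A \<in> pointwise_stabilizer G H" "det A = 1"
  shows "A = mat 1"
proof -
  obtain v where v: "l H v = 1" using l_unit[OF H] by blast
  have AG: "A \<in> G" using A stabilizer_iff by simp
  have fix0: "A *v z = z" if "l H z = 0" for z by (rule stabilizer_fixes[OF H A(1) that])
  define u where "u = A *v v - v"
  have A1: "A *v z = z + l H z *s u" for z
    unfolding u_def by (rule fixes_hyperplane_eq[OF linear_form_l[OF H] v fix0])
  have Av: "A *v v = v + u" by (simp add: u_def)
  have "l H u = 0"
    using stabilizer_l[OF H A(1), of v] A(2) linear_form_l[OF H] by (simp add: u_def linear_form_diff)
  then have Au: "A *v u = u" by (rule fix0)
  obtain n :: nat where n: "n > 0" "A [^]\<^bsub>GL\<^esub> n = mat 1" using matrix_power_eq_one[OF AG] by blast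
  have "(A [^]\<^bsub>GL\<^esub> m) *v v = v + of_nat m *s u \<and> (A [^]\<^bsub>GL\<^esub> m) *v u = u" for m :: nat
    by (induction m)
      (auto simp: mult_vec_assoc Av Au matrix_vector_right_distrib vector_sadd_rdistrib)
  from this[of n] have "of_nat n *s u = 0" using n by simp
  then have "u = 0" using n by (simp add: vec_eq_iff)
  then show ?thesis using A1 by (intro matrix_eqI) simp
qed

text \<open>The determinant is injective on the stabilizer, so the roots of unity of the relevant order are all
  powers of \<open>det (a H)\<close>.\<close>

lemma exponent_exists:
  assumes H: "H \<in> hyps" shows "\<exists>c. \<rho> (a H) = det (a H) ^ c"
proof -
  let ?A = "a H" and ?\<mu> = "det (a H)"
  have AG: "?A \<in> G" using a[OF H] by blast
  have pow: "?A [^]\<^bsub>GL\<^esub> n \<in> pointwise_stabilizer G H" "det (?A [^]\<^bsub>GL\<^esub> n) = ?\<mu> ^ n"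
      "\<rho> (?A [^]\<^bsub>GL\<^esub> n) = \<rho> ?A ^ n" for n :: nat
  proof (induction n)
    case 0
    { case 1 then show ?case by (simp add: stabilizer_iff one_in) }
    { case 2 then show ?case by simp }
    { case 3 then show ?case by (simp add: \<rho>_one) }
  next
    case (Suc n)
    have "?A [^]\<^bsub>GL\<^esub> n \<in> G" using Suc.IH(1) stabilizer_iff by blast
    { case 1 then show ?case using Suc.IH(1) a_stabilizer[OF H] by (auto simp: stabilizer_iff mult_in mult_vec_assoc) }
    { case 2 then show ?case using Suc.IH(2) by (simp add: det_mul mult.commute) }
    { case 3 then show ?case using Suc.IH(3) \<rho>_mult[OF \<open>?A [^]\<^bsub>GL\<^esub> n \<in> G\<close> AG] by (simp add: mult.commute) }
  qed
  define m where "m = (LEAST m. m > 0 \<and> ?\<mu> ^ m = 1)"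
  have ex: "card G > 0 \<and> ?\<mu> ^ card G = 1"
    using card_pos character_power_card[of det, OF _ det_nz AG] by (simp add: det_mul)
  have m: "m > 0" "?\<mu> ^ m = 1"
    using LeastI[of "\<lambda>m. m > 0 \<and> ?\<mu> ^ m = 1", OF ex] unfolding m_def by auto
  have inj: "inj_on (\<lambda>j. ?\<mu> ^ j) {..<m}"
  proof (rule linorder_inj_onI')
    fix i j assume ij: "i \<in> {..<m}" "j \<in> {..<m}" "i < j"
    show "?\<mu> ^ i \<noteq> ?\<mu> ^ j"
    proof
      assume "?\<mu> ^ i = ?\<mu> ^ j"
      then have "?\<mu> ^ i * 1 = ?\<mu> ^ i * ?\<mu> ^ (j - i)"
        using ij by (metis lessThan_iff less_imp_le mult_1_right power_add ordered_cancel_comm_monoid_diff_class.add_diff_inverse)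
      then have "?\<mu> ^ (j - i) = 1" using det_nz[OF AG] by (simp only: mult_cancel_left) simp
      then have "m \<le> j - i" unfolding m_def using ij by (intro Least_le) simp
      then show False using ij by auto
    qed
  qed
  have "\<rho> ?A ^ m = 1"
    using pow[of m] stabilizer_det_one[OF H, of "?A [^]\<^bsub>GL\<^esub> m"] m \<rho>_one by simp
  moreover have "(\<lambda>j. ?\<mu> ^ j) ` {..<m} = {z. z ^ m = 1}"
  proof (rule card_seteq)
    show "finite {z::complex. z ^ m = 1}" using m by (simp add: finite_roots_unity)
    show "(\<lambda>j. ?\<mu> ^ j) ` {..<m} \<subseteq> {z. z ^ m = 1}"
    proof
      fix z assume "z \<in> (\<lambda>j. ?\<mu> ^ j) ` {..<m}"
      then obtain j where "z = ?\<mu> ^ j" by blast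
      then have "z ^ m = (?\<mu> ^ m) ^ j" by (metis mult.commute power_mult)
      then show "z \<in> {z. z ^ m = 1}" using m(2) by simp
    qed
    show "card {z::complex. z ^ m = 1} \<le> card ((\<lambda>j. ?\<mu> ^ j) ` {..<m})"
      using card_roots_unity_eq[OF m(1)] by (simp add: card_image[OF inj])
  qed
  ultimately show ?thesis by blast
qed

lemma exponent:
  assumes "H \<in> hyps" shows "\<rho> (a H) = det (a H) ^ expo H" "j < expo H \<Longrightarrow> \<rho> (a H) \<noteq> det (a H) ^ j"
  using LeastI_ex[OF exponent_exists[OF assms]] not_less_Least by auto

lemma exponent_stabilizer:
  assumes H: "H \<in> hyps" and e: "\<rho> (a H) = det (a H) ^ c" and A: "A \<in> pointwise_stabilizer G H"
  shows "\<rho> A = det A ^ c"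
proof -
  have aG: "a H \<in> G" using a[OF H] by blast
  have "A \<in> generate GL {a H}" using A a[OF H] by simp
  then have "A \<in> G \<and> \<rho> A = det A ^ c"
  proof (induction rule: generate.induct)
    case one
    then show ?case by (simp add: one_in \<rho>_one)
  next
    case (incl h)
    then show ?case using e aG by simp
  next
    case (inv h)
    then have "\<rho> (iv h) * \<rho> h = (det (iv h) * det h) ^ c"
      using \<rho>_iv(1) det_iv aG by simp
    then show ?case using inv e aG iv_in det_nz[OF aG] by (simp add: power_mult_distrib)
  next
    case (eng h1 h2)
    then show ?case by (simp add: mult_in \<rho>_mult det_mul power_mult_distrib)
  qed
  then show ?thesis by blast
qed

text \<open>A group element maps reflecting hyperplanes to reflecting hyperplanes, by conjugating the reflections.\<close>

lemma image_hyperplane: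
  assumes A: "A \<in> G" and H: "H \<in> hyps"
  shows "(*v) A ` H \<in> hyps"
proof -
  obtain \<sigma> where \<sigma>: "\<sigma> \<in> G" "complex_reflection \<sigma>" "H = {z. (mat 1 - \<sigma>) *v z = 0}"
    using H unfolding reflecting_hyperplanes_def by blast
  let ?\<tau> = "A ** \<sigma> ** iv A" and ?B = "mat 1 - A ** \<sigma> ** iv A"
  have \<tau>: "?\<tau> \<in> G" using A \<sigma> by (simp add: mult_in iv_in)
  have B: "?B *v z = A *v ((mat 1 - \<sigma>) *v (iv A *v z))" for z
    by (simp add: matrix_vector_mult_diff_rdistrib matrix_vector_mult_diff_distrib mult_vec_assoc iv_mult_vec[OF A])
  obtain v where v: "l H v = 1" using l_unit[OF H] by blast
  define u where "u = (mat 1 - \<sigma>) *v v"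
  have fix0: "\<sigma> *v z = z" if "l H z = 0" for z
    using that hyp_iff[OF H, of z] \<sigma>(3) by (auto simp: matrix_vector_mult_diff_rdistrib)
  have S: "(mat 1 - \<sigma>) *v x = l H x *s u" for x
    using fixes_hyperplane_eq[OF linear_form_l[OF H] v fix0, of x]
    by (simp add: u_def matrix_vector_mult_diff_rdistrib vec_eq_iff algebra_simps)
  have u: "A *v u \<noteq> 0"
  proof
    assume "A *v u = 0"
    then have "u = 0" using iv_mult_vec(1)[OF A, of u] by simp
    then have "v \<in> H" using \<sigma>(3) by (simp add: u_def)
    then show False using hyp_iff[OF H] v by simp
  qed
  define m where "m = (\<chi> j. l H (iv A *v axis j 1))"
  have entry: "?B $ i $ j = (A *v u) $ i * m $ j" for i j
  proof -
    have "?B $ i $ j = (?B *v axis j 1) $ i" by (rule mult_axis[symmetric])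
    also have "\<dots> = (A *v u) $ i * m $ j"
      by (simp only: B S) (simp add: m_def vec.scale mult.commute)
    finally show ?thesis .
  qed
  have "m \<noteq> 0"
  proof
    assume m: "m = 0"
    have "?B $ i $ j = 0" for i j using entry[of i j] m by simp
    then have "?B = 0" by (simp add: vec_eq_iff)
    then have "?B *v (A *v v) = 0" by simp
    then show False using u by (simp only: B iv_mult_vec[OF A]) (simp flip: u_def)
  qed
  then obtain j0 where j0: "m $ j0 \<noteq> 0" by (auto simp: vec_eq_iff)
  obtain i0 where i0: "(A *v u) $ i0 \<noteq> 0" using u by (auto simp: vec_eq_iff)
  have "rank ?B = 1" by (rule rank_one[OF entry i0 j0])
  moreover obtain n :: nat where "n > 0" "?\<tau> [^]\<^bsub>GL\<^esub> n = mat 1"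
    using matrix_power_eq_one[OF \<tau>] by blast
  ultimately have "complex_reflection ?\<tau>"
    unfolding complex_reflection_def using invertible[OF \<tau>] by auto
  moreover have "{z. ?B *v z = 0} = (*v) A ` H"
  proof -
    have "?B *v z = 0 \<longleftrightarrow> iv A *v z \<in> H" for z
    proof -
      have "?B *v z = 0 \<longleftrightarrow> (mat 1 - \<sigma>) *v (iv A *v z) = 0"
        unfolding B using iv_mult_vec(1)[OF A] by (metis matrix_vector_mult_0_right)
      then show ?thesis using \<sigma>(3) by simp
    qed
    moreover have "iv A *v z \<in> H \<longleftrightarrow> z \<in> (*v) A ` H" for z
      using iv_mult_vec[OF A] by (metis imageE imageI)
    ultimately show ?thesis by blast
  qed
  ultimately show ?thesis
    unfolding reflecting_hyperplanes_def using \<tau> by blast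
qed

lemma image_iv: assumes "A \<in> G" shows "(*v) (iv A) ` (*v) A ` H = H" "(*v) A ` (*v) (iv A) ` H = H"
  using iv_mult_vec[OF assms] by (simp_all add: image_image)

text \<open>Conjugation by \<open>A\<close> carries the stabilizer of \<open>H\<close> to that of its image and changes neither \<open>\<rho>\<close> nor the determinant.\<close>

lemma exponent_image: assumes A: "A \<in> G" and H: "H \<in> hyps" shows "expo ((*v) A ` H) = expo H"
proof -
  have dir: "\<rho> (a H) = det (a H) ^ c"
    if A: "A \<in> G" and H: "H \<in> hyps" and e: "\<rho> (a ((*v) A ` H)) = det (a ((*v) A ` H)) ^ c" for A H c
  proof -
    let ?B = "A ** a H ** iv A"
    have aG: "a H \<in> G" and fix0: "\<And>z. z \<in> H \<Longrightarrow> a H *v z = z"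
      using a_stabilizer[OF H] stabilizer_iff by blast+
    have "?B \<in> pointwise_stabilizer G ((*v) A ` H)"
      unfolding stabilizer_iff using A aG fix0
      by (auto simp: mult_in iv_in mult_vec_assoc iv_mult_vec)
    then have "\<rho> ?B = det ?B ^ c"
      by (rule exponent_stabilizer[OF image_hyperplane[OF A H] e])
    moreover have "\<rho> ?B = \<rho> (a H)"
      using \<rho>_iv(1)[OF A] by (simp add: \<rho>_mult mult_in iv_in A aG mult_ac)
    moreover have "det ?B = det (a H)"
      using det_iv[OF A] by (simp add: det_mul mult_ac)
    ultimately show ?thesis by simp
  qed
  have "\<rho> (a ((*v) A ` H)) = det (a ((*v) A ` H)) ^ c \<longleftrightarrow> \<rho> (a H) = det (a H) ^ c" for c
    using dir[OF A H, of c] dir[OF iv_in[OF A] image_hyperplane[OF A H], of c]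
    by (auto simp: image_iv[OF A])
  then show ?thesis by simp
qed

lemma hyps_distinct:
  assumes H: "H \<in> hyps" "H' \<in> hyps" "H \<noteq> H'" shows "\<exists>w. l H w = 0 \<and> l H' w \<noteq> 0"
proof (rule ccontr)
  assume contr: "\<not> ?thesis"
  obtain v where v: "l H v = 1" using l_unit[OF H(1)] by blast
  have e: "l H' z = l H' v * l H z" for z
    by (rule linear_form_proportional[OF linear_form_l[OF H(1)] linear_form_l[OF H(2)] v])
      (use contr in blast)
  obtain v' where "l H' v' = 1" using l_unit[OF H(2)] by blast
  then have "l H' v \<noteq> 0" using e[of v'] by auto
  then have "l H' z = 0 \<longleftrightarrow> l H z = 0" for z using e[of z] by simp
  then show False using H hyp_iff by blast
qed

text \<open>A reflection permutes the other reflecting hyperplanes, so it multiplies the product over these by a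
  constant; at a generic point of its own hyperplane that constant is seen to be \<open>1\<close>.\<close>

lemma L_reflection:
  assumes \<sigma>: "\<sigma> \<in> G" "complex_reflection \<sigma>"
  shows "L (\<sigma> *v z) = \<rho> \<sigma> * L z"
proof -
  define H0 where "H0 = {z. \<sigma> *v z = z}"
  have H0: "H0 \<in> hyps" using reflection_hyperplane[OF \<sigma>] by (simp add: H0_def)
  have stab: "\<sigma> \<in> pointwise_stabilizer G H0"
    using \<sigma> by (auto simp: stabilizer_iff H0_def)
  define Q where "Q z = (\<Prod>H\<in>hyps - {H0}. l H z ^ expo H)" for z
  have LQ: "L z = l H0 z ^ expo H0 * Q z" for z
    unfolding rep_poly_def Q_def by (rule prod.remove[OF hyps_finite H0])
  have "\<exists>k. \<forall>z. l ((*v) \<sigma> ` H) (\<sigma> *v z) = k * l H z" if H: "H \<in> hyps" for H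
  proof -
    obtain v where v: "l H v = 1" using l_unit[OF H] by blast
    have H': "(*v) \<sigma> ` H \<in> hyps" by (rule image_hyperplane[OF \<sigma>(1) H])
    have "linear_form (\<lambda>z. l ((*v) \<sigma> ` H) (\<sigma> *v z))"
      using linear_form_l[OF H'] by (simp add: linear_form_iff matrix_vector_right_distrib vec.scale)
    from linear_form_proportional[OF linear_form_l[OF H] this v]
    show ?thesis using hyp_iff[OF H] hyp_iff[OF H'] by blast
  qed
  then obtain \<kappa> where \<kappa>: "\<And>H z. H \<in> hyps \<Longrightarrow> l ((*v) \<sigma> ` H) (\<sigma> *v z) = \<kappa> H * l H z" by metis
  have im0: "(*v) \<sigma> ` H0 = H0" by (force simp: H0_def)
  then have im0': "(*v) (iv \<sigma>) ` H0 = H0" using image_iv(1)[OF \<sigma>(1), of H0] by simp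
  have bij: "bij_betw (\<lambda>H. (*v) \<sigma> ` H) (hyps - {H0}) (hyps - {H0})"
  proof (rule bij_betwI[where g = "\<lambda>H. (*v) (iv \<sigma>) ` H"])
    show "(\<lambda>H. (*v) \<sigma> ` H) \<in> hyps - {H0} \<rightarrow> hyps - {H0}"
    proof (intro funcsetI DiffI)
      fix H assume H: "H \<in> hyps - {H0}"
      then show "(*v) \<sigma> ` H \<in> hyps" using image_hyperplane[OF \<sigma>(1)] by simp
      show "(*v) \<sigma> ` H \<notin> {H0}"
      proof
        assume "(*v) \<sigma> ` H \<in> {H0}"
        then show False using image_iv(1)[OF \<sigma>(1), of H] im0' H by simp
      qed
    qed
    show "(\<lambda>H. (*v) (iv \<sigma>) ` H) \<in> hyps - {H0} \<rightarrow> hyps - {H0}"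
    proof (intro funcsetI DiffI)
      fix H assume H: "H \<in> hyps - {H0}"
      then show "(*v) (iv \<sigma>) ` H \<in> hyps" using image_hyperplane[OF iv_in[OF \<sigma>(1)]] by simp
      show "(*v) (iv \<sigma>) ` H \<notin> {H0}"
      proof
        assume "(*v) (iv \<sigma>) ` H \<in> {H0}"
        then show False using image_iv(2)[OF \<sigma>(1), of H] im0 H by simp
      qed
    qed
  qed (simp_all add: image_iv[OF \<sigma>(1)])
  define K where "K = (\<Prod>H\<in>hyps - {H0}. \<kappa> H ^ expo H)"
  have QK: "Q (\<sigma> *v z) = K * Q z" for z
  proof -
    have "Q (\<sigma> *v z) = (\<Prod>H\<in>hyps - {H0}. l ((*v) \<sigma> ` H) (\<sigma> *v z) ^ expo ((*v) \<sigma> ` H))"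
      unfolding Q_def using prod.reindex_bij_betw[OF bij, of "\<lambda>H. l H (\<sigma> *v z) ^ expo H"] by simp
    also have "\<dots> = (\<Prod>H\<in>hyps - {H0}. \<kappa> H ^ expo H * l H z ^ expo H)"
      using \<kappa> exponent_image[OF \<sigma>(1)] by (intro prod.cong) (auto simp: power_mult_distrib)
    finally show ?thesis by (simp add: Q_def K_def prod.distrib)
  qed
  have "\<exists>w\<in>H0. \<forall>H\<in>hyps - {H0}. l H w \<noteq> 0"
  proof (rule linear_forms_avoid_zero)
    fix H assume "H \<in> hyps - {H0}"
    then show "linear_form (l H)" "\<exists>w\<in>H0. l H w \<noteq> 0"
      using linear_form_l hyps_distinct[OF H0, of H] hyp_iff[OF H0] by auto
  qed (auto simp: hyps_finite H0_def matrix_vector_right_distrib vec.scale)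
  then obtain w where w: "w \<in> H0" "\<And>H. H \<in> hyps - {H0} \<Longrightarrow> l H w \<noteq> 0" by blast
  have "Q w \<noteq> 0" unfolding Q_def using w(2) hyps_finite by simp
  moreover have "Q w = K * Q w" using QK[of w] w(1) by (simp add: H0_def)
  ultimately have "K = 1" by simp
  then show ?thesis
    using QK stabilizer_l[OF H0 stab] exponent_stabilizer[OF H0 exponent(1)[OF H0] stab]
    by (simp add: LQ power_mult_distrib)
qed

theorem L_semi_invariant:
  assumes A: "A \<in> G" shows "L (A *v z) = \<rho> A * L z"
proof -
  have "A \<in> generate GL {A \<in> G. complex_reflection A}" using A gen by simp
  then have "A \<in> G \<and> (\<forall>z. L (A *v z) = \<rho> A * L z)"
  proof (induction rule: generate.induct)
    case one
    then show ?case by (simp add: one_in \<rho>_one)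
  next
    case (incl h)
    then show ?case using L_reflection by blast
  next
    case (inv h)
    then have h: "h \<in> G" "\<And>z. L (h *v z) = \<rho> h * L z" using L_reflection by blast+
    have "L (iv h *v z) = \<rho> (iv h) * L z" for z
    proof -
      have "L z = \<rho> h * L (iv h *v z)"
        using h(2)[of "iv h *v z"] by (simp add: iv_mult_vec[OF h(1)])
      then show ?thesis using \<rho>_iv(1)[OF h(1)] by (metis mult.assoc mult_1)
    qed
    then show ?case using iv_in[OF h(1)] by blast
  next
    case (eng h1 h2)
    then show ?case by (simp add: mult_in \<rho>_mult mult_vec_assoc)
  qed
  then show ?thesis by blast
qed

lemma L_holomorphic: "holomorphic_several L D"
  unfolding rep_poly_def[abs_def]
  by (intro holomorphic_several_prod holomorphic_several_power holomorphic_several_linear_form linear_form_l)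

lemma L_generic_direction: "\<exists>v. \<forall>p. \<forall>\<^sub>F t in at 0. L (p + t *s v) \<noteq> 0"
proof -
  have "\<exists>v\<in>UNIV. \<forall>H\<in>hyps. l H v \<noteq> 0"
  proof (rule linear_forms_avoid_zero[OF hyps_finite linear_form_l])
    fix H assume "H \<in> hyps"
    then show "\<exists>w\<in>UNIV. l H w \<noteq> 0" using l_unit[of H] by (metis UNIV_I zero_neq_one)
  qed auto
  then obtain v where v: "\<And>H. H \<in> hyps \<Longrightarrow> l H v \<noteq> 0" by blast
  have "\<forall>\<^sub>F t in at 0. L (p + t *s v) \<noteq> 0" for p
    unfolding rep_poly_def by (rule prod_power_eventually_nonzero[OF hyps_finite linear_form_l v])
  then show ?thesis by blast
qed

text \<open>The eigenvalues of the stabilizers force \<open>f\<close> to vanish along each reflecting hyperplane to the order of \<open>L\<close>. The quotient is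
  invariant since \<open>f\<close> and \<open>L\<close> transform by the same character.\<close>

theorem relative_invariant_divisible:
  assumes D: "open D" and GD: "\<And>A z. A \<in> G \<Longrightarrow> z \<in> D \<Longrightarrow> A *v z \<in> D"
    and f: "holomorphic_several f D" "\<And>A z. A \<in> G \<Longrightarrow> z \<in> D \<Longrightarrow> f (A *v z) = \<rho> A * f z"
  obtains g where "holomorphic_several g D" "\<And>z. z \<in> D \<Longrightarrow> f z = L z * g z"
    "\<And>A z. A \<in> G \<Longrightarrow> z \<in> D \<Longrightarrow> g (A *v z) = g z"
proof -
  have "\<exists>g. holomorphic_several g D \<and> (\<forall>z\<in>D. f z = (\<Prod>H\<in>hyps. l H z ^ expo H) * g z)"
  proof (rule divisible_by_product_of_linear_forms[OF D hyps_finite linear_form_l hyps_distinct l_unit f(1)])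
    fix H assume H: "H \<in> hyps"
    obtain v where v: "l H v = 1" using l_unit[OF H] by blast
    have aG: "a H \<in> G" using a[OF H] by blast
    have e: "\<rho> (a H) = det (a H) ^ expo H" by (rule exponent(1)[OF H])
    show "\<exists>g. holomorphic_several g D \<and> (\<forall>z\<in>D. f z = l H z ^ expo H * g z)"
    proof (rule divisible_by_power_of_linear_form[OF D _ linear_form_l[OF H] v _ _ det_nz[OF aG] f(1)])
      show "a H *v z \<in> D" if "z \<in> D" for z using GD[OF aG that] .
      show "a H *v z = z" if "l H z = 0" for z
        by (rule stabilizer_fixes[OF H a_stabilizer[OF H] that])
      show "l H (a H *v z) = det (a H) * l H z" for z
        by (rule stabilizer_l[OF H a_stabilizer[OF H]])
      show "f (a H *v z) = det (a H) ^ expo H * f z" if "z \<in> D" for z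
        using f(2)[OF aG that] e by simp
      show "det (a H) ^ expo H \<noteq> det (a H) ^ j" if "j < expo H" for j
        using exponent(2)[OF H that] e by simp
    qed
  qed
  then obtain g where g: "holomorphic_several g D" "\<And>z. z \<in> D \<Longrightarrow> f z = L z * g z"
    unfolding rep_poly_def by blast
  have contg: "continuous_on D g" by (rule holomorphic_several_continuous_on[OF g(1)])
  obtain v where v: "\<And>p. \<forall>\<^sub>F t in at 0. L (p + t *s v) \<noteq> 0" using L_generic_direction by blast
  have "g (A *v z) = g z" if A: "A \<in> G" and z: "z \<in> D" for A z
  proof (rule continuous_eq_on_line[where v = v, OF D z])
    show "continuous_on D (\<lambda>z. g (A *v z))"
      by (rule continuous_on_compose2[OF contg]) (use GD[OF A] in \<open>auto intro!: continuous_intros\<close>)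
    show "\<forall>\<^sub>F t in at 0. z + t *s v \<in> D \<longrightarrow> g (A *v (z + t *s v)) = g (z + t *s v)"
      using v[of z]
    proof eventually_elim
      case (elim t)
      let ?x = "z + t *s v"
      show ?case
      proof
        assume x: "?x \<in> D"
        have "(\<rho> A * L ?x) * g (A *v ?x) = (\<rho> A * L ?x) * g ?x"
          using f(2)[OF A x] g(2)[OF x] g(2)[OF GD[OF A x]] L_semi_invariant[OF A, of ?x]
          by (simp only: mult.assoc)
        then show "g (A *v ?x) = g ?x" using elim \<rho>_nz[OF A] by (simp only: mult_cancel_left) simp
      qed
    qed
  qed (rule contg)
  then show ?thesis using g that by blast
qed

end

section \<open>Weighted Bergman spaces\<close>

subsection \<open>The mean value inequality over balls\<close>

lemma det_mat: "det (mat c :: complex^'d^'d) = c ^ CARD('d)"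
  by (subst det_diagonal) (auto simp: mat_def)

lemma set_integral_matrix:
  fixes F :: "complex^'d \<Rightarrow> complex"
  assumes S: "S \<in> sets lebesgue" and A: "invertible A" "cmod (det A) = 1"
  shows "set_integrable lebesgue ((*v) A ` S) F \<longleftrightarrow> set_integrable lebesgue S (\<lambda>x. F (A *v x))"
    and "(LINT u:(*v) A ` S|lebesgue. F u) = (LINT x:S|lebesgue. F (A *v x))"
proof -
  have "bounded_linear ((*v) A)"
    by (rule matrix_vector_mul_bounded_linear)
  then have d: "((*v) A has_derivative (*v) A) (at x)" for x
    by (rule bounded_linear_imp_has_derivative)
  have inj: "inj_on ((*v) A) S"
    using A(1) by (metis inj_on_inverseI invertible_def matrix_vector_mul_assoc matrix_vector_mul_lid)
  from change_of_variables_complex[where A = "\<lambda>_. A", OF S d A(1) inj]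
  show "set_integrable lebesgue ((*v) A ` S) F \<longleftrightarrow> set_integrable lebesgue S (\<lambda>x. F (A *v x))"
    and "(LINT u:(*v) A ` S|lebesgue. F u) = (LINT x:S|lebesgue. F (A *v x))"
    by (simp_all add: A(2))
qed

lemma set_integral_translate:
  fixes F :: "complex^'d \<Rightarrow> complex"
  shows "(LINT u:ball z e|lebesgue. F u) = (LINT y:ball 0 e|lebesgue. F (z + y))"
proof -
  have d: "((\<lambda>y. z + y) has_derivative (*v) (mat 1)) (at x)" for x :: "complex^'d"
    by (simp add: matrix_vector_mul_lid[abs_def]) (auto intro!: derivative_eq_intros)
  have "invertible (mat 1 :: complex^'d^'d)"
    unfolding invertible_def by (rule exI[of _ "mat 1"]) simp
  from change_of_variables_complex(2)[where A = "\<lambda>_. mat 1" and g = "\<lambda>y. z + y" and S = "ball 0 e", OF _ d this]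
  show ?thesis by simp
qed

lemma set_integral_finite_sum:
  fixes f :: "'i \<Rightarrow> 'a \<Rightarrow> 'b::{banach, second_countable_topology}"
  assumes "\<And>i. i \<in> I \<Longrightarrow> set_integrable M A (f i)"
  shows "set_integrable M A (\<lambda>x. \<Sum>i\<in>I. f i x)"
    and "(LINT x:A|M. (\<Sum>i\<in>I. f i x)) = (\<Sum>i\<in>I. LINT x:A|M. f i x)"
  using assms unfolding set_integrable_def set_lebesgue_integral_def scaleR_sum_right
  by (auto intro!: Bochner_Integration.integrable_sum Bochner_Integration.integral_sum)

lemma set_integrable_lebesgue_continuous:
  fixes f :: "complex^'d \<Rightarrow> 'b::{banach, second_countable_topology}"
  assumes "compact K" "continuous_on K f" "A \<in> sets lebesgue" "A \<subseteq> K"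
  shows "set_integrable lebesgue A f"
proof (rule set_integrable_subset[OF _ assms(3,4)])
  have "integrable lborel (\<lambda>x. indicator K x *\<^sub>R f x)"
    by (rule borel_integrable_compact[OF assms(1,2)])
  then show "set_integrable lebesgue K f"
    unfolding set_integrable_def
    by (subst integrable_completion) (auto dest: borel_measurable_integrable)
qed

lemma set_integral_const_ball:
  fixes c :: "'b::{banach, second_countable_topology}" and z :: "complex^'d"
  shows "(LINT x:ball z e|lebesgue. c) = measure lebesgue (ball z e) *\<^sub>R c"
proof (rule set_integral_const)
  show "emeasure lebesgue (ball z e) \<noteq> \<infinity>"
    using fmeasurableD2[OF lmeasurable_ball[of z e]] unfolding infinity_ennreal_def .
qed simp

lemma cball_zero_smult: "y \<in> ball 0 e \<Longrightarrow> cmod \<zeta> \<le> 2 \<Longrightarrow> z + \<zeta> *s y \<in> cball (z :: complex^'d) (2 * e)"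
proof -
  assume "y \<in> ball 0 e" "cmod \<zeta> \<le> 2"
  then have "cmod \<zeta> * norm y \<le> 2 * e"
    by (intro mult_mono) auto
  then show ?thesis by (simp add: dist_norm)
qed

text \<open>Averaging over the rotations by roots of unity leaves the integral unchanged and turns the integrand
  into an arbitrarily good approximation of the constant \<open>F z\<close>.\<close>

lemma mean_value_ball:
  fixes F :: "complex^'d \<Rightarrow> complex"
  assumes F: "holomorphic_several F D" and e: "e > 0" "cball z (2 * e) \<subseteq> D"
  shows "(LINT y:ball 0 e|lebesgue. F (z + y)) = measure lebesgue (ball (0::complex^'d) e) *\<^sub>R F z"
proof -
  let ?B = "ball (0::complex^'d) e" and ?w = "\<lambda>N k. cis (2 * pi * real k / real N)"
  let ?vol = "measure lebesgue ?B"
  have contF: "continuous_on (cball z (2 * e)) F"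
    using holomorphic_several_continuous_on[OF F] e(2) by (rule continuous_on_subset)
  have "bounded (F ` cball z (2 * e))"
    by (intro compact_imp_bounded compact_continuous_image contF compact_cball)
  then obtain b where b: "\<And>x. x \<in> cball z (2 * e) \<Longrightarrow> cmod (F x) \<le> b"
    unfolding bounded_iff by blast
  have contc: "continuous_on (cball 0 e) (\<lambda>y. F (z + c *s y))" if "cmod c = 1" for c
  proof (rule continuous_on_compose2[OF contF])
    show "(\<lambda>y. z + c *s y) ` cball 0 e \<subseteq> cball z (2 * e)"
      using that e by (auto simp: dist_norm)
  qed (intro continuous_intros)
  have int: "set_integrable lebesgue ?B (\<lambda>y. F (z + c *s y))" if "cmod c = 1" for c
    by (rule set_integrable_lebesgue_continuous[OF compact_cball contc[OF that]]) auto
  have rot: "(LINT y:?B|lebesgue. F (z + c *s y)) = (LINT y:?B|lebesgue. F (z + y))" if c: "cmod c = 1" for c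
  proof -
    have inv: "mat c ** mat (1 / c) = (mat 1 :: complex^'d^'d)" "mat (1 / c) ** mat c = (mat 1 :: complex^'d^'d)"
      using c by (auto intro!: matrix_eqI[of "_ ** _"] simp: mult_vec_assoc vector_smult_assoc)
    have "(*v) (mat c) ` ?B = ?B"
    proof
      show "(*v) (mat c) ` ?B \<subseteq> ?B" using c by auto
      show "?B \<subseteq> (*v) (mat c) ` ?B"
      proof
        fix y assume "y \<in> ?B"
        then have "(1 / c) *s y \<in> ?B" "y = mat c *v ((1 / c) *s y)"
          using c by (auto simp: vector_smult_assoc norm_divide)
        then show "y \<in> (*v) (mat c) ` ?B" by blast
      qed
    qed
    moreover have "invertible (mat c :: complex^'d^'d)"
      using inv unfolding invertible_def by blast
    moreover have "cmod (det (mat c :: complex^'d^'d)) = 1"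
      using c by (simp add: det_mat norm_power)
    ultimately show ?thesis
      using set_integral_matrix(2)[of ?B "mat c" "\<lambda>y. F (z + y)"] by simp
  qed
  let ?I = "LINT y:?B|lebesgue. F (z + y)"
  have bound: "cmod (?I - ?vol *\<^sub>R F z) \<le> 2 * b * ?vol * (1 / 2) ^ Suc n" for n
  proof -
    let ?N = "Suc n"
    let ?A = "\<lambda>y. (\<Sum>k<?N. F (z + ?w ?N k *s y)) / of_nat ?N"
    have iA: "set_integrable lebesgue ?B ?A"
      by (intro set_integrable_divide set_integral_finite_sum int) auto
    have "(LINT y:?B|lebesgue. ?A y) = (\<Sum>k<?N. LINT y:?B|lebesgue. F (z + ?w ?N k *s y)) / of_nat ?N"
      by (simp only: set_integral_divide_zero) (subst set_integral_finite_sum(2); simp add: int)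
    also have "\<dots> = ?I" by (simp add: rot del: sum.lessThan_Suc of_nat_Suc)
    finally have IA: "(LINT y:?B|lebesgue. ?A y) = ?I" .
    have iC: "set_integrable lebesgue ?B (\<lambda>y. F z)"
      by (rule set_integrable_lebesgue_continuous[OF compact_cball[of 0 e]]) auto
    have "(LINT y:?B|lebesgue. F z) = ?vol *\<^sub>R F z"
      by (simp add: set_integral_const_ball)
    then have "?I - ?vol *\<^sub>R F z = (LINT y:?B|lebesgue. ?A y - F z)"
      using IA by (simp only: set_integral_diff(2)[OF iA iC])
    also have "cmod \<dots> \<le> (LINT y:?B|lebesgue. cmod (?A y - F z))"
      by (rule set_integral_norm_bound[OF set_integral_diff(1)[OF iA iC]])
    also have "\<dots> \<le> (LINT y:?B|lebesgue. 2 * b * (1 / 2) ^ ?N)"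
    proof (rule set_integral_mono)
      show "set_integrable lebesgue ?B (\<lambda>y. cmod (?A y - F z))"
        by (intro set_integrable_norm set_integral_diff iA iC)
      show "set_integrable lebesgue ?B (\<lambda>y. 2 * b * (1 / 2) ^ ?N)"
        by (rule set_integrable_lebesgue_continuous[OF compact_cball[of 0 e]]) auto
      fix y assume y: "y \<in> ?B"
      have hol: "(\<lambda>\<zeta>. F (z + \<zeta> *s y)) holomorphic_on cball 0 2"
        by (rule holomorphic_several_line[OF F]) (use cball_zero_smult[OF y] e(2) in auto)
      have "cmod ((\<Sum>k<?N. F (z + (?w ?N k * 1) *s y)) / of_nat ?N - F (z + 0 *s y))
          \<le> b * (1 / 2) ^ ?N / (1 - 1 / 2)"
      proof (rule mean_roots_of_unity[where g = "\<lambda>\<zeta>. F (z + \<zeta> *s y)" and R = 2 and r = 1])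
        show "(\<lambda>\<zeta>. F (z + \<zeta> *s y)) holomorphic_on ball 0 2"
          using hol by (rule holomorphic_on_subset) auto
        show "continuous_on (cball 0 2) (\<lambda>\<zeta>. F (z + \<zeta> *s y))"
          using hol by (rule holomorphic_on_imp_continuous_on)
        show "cmod (F (z + \<zeta> *s y)) \<le> b" if "cmod \<zeta> = 2" for \<zeta>
          using b[OF cball_zero_smult[OF y]] that by simp
      qed auto
      then show "cmod (?A y - F z) \<le> 2 * b * (1 / 2) ^ ?N"
        by (simp only: mult_1_right vector_smult_lzero add_0_right) simp
    qed
    also have "\<dots> = 2 * b * ?vol * (1 / 2) ^ ?N"
      by (simp add: set_integral_const_ball)
    finally show ?thesis .
  qed
  have "(\<lambda>n. 2 * b * ?vol * (1 / 2) ^ Suc n) \<longlonglongrightarrow> 2 * b * ?vol * 0"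
    by (intro tendsto_mult_left LIMSEQ_Suc LIMSEQ_realpow_zero) auto
  then have "cmod (?I - ?vol *\<^sub>R F z) \<le> 0"
    using bound by (intro tendsto_lowerbound[of _ _ sequentially]) auto
  then show ?thesis by simp
qed

text \<open>The mean value property applied to \<open>f\<^sup>2\<close>.\<close>

lemma sub_mean_value_ball:
  fixes f :: "complex^'d \<Rightarrow> complex"
  assumes f: "holomorphic_several f D" and e: "e > 0" "cball z (2 * e) \<subseteq> D"
  shows "(cmod (f z))\<^sup>2 * measure lebesgue (ball (0::complex^'d) e)
      \<le> (LINT x:ball z e|lebesgue. (cmod (f x))\<^sup>2)"
proof -
  have cont: "continuous_on (cball z (2 * e)) f"
    using holomorphic_several_continuous_on[OF f] e(2) by (rule continuous_on_subset)
  have int: "set_integrable lebesgue (ball z e) (\<lambda>x. f x ^ 2)"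
    by (rule set_integrable_lebesgue_continuous[OF compact_cball[of z "2 * e"]])
      (use e cont in \<open>auto intro!: continuous_intros\<close>)
  have "(cmod (f z))\<^sup>2 * measure lebesgue (ball (0::complex^'d) e) =
      cmod (LINT y:ball 0 e|lebesgue. f (z + y) ^ 2)"
    using mean_value_ball[OF holomorphic_several_power[OF f, of 2] e] by (simp add: norm_power)
  also have "\<dots> = cmod (LINT x:ball z e|lebesgue. f x ^ 2)"
    unfolding set_integral_translate[where z = z and F = "\<lambda>x. f x ^ 2"] ..
  also have "\<dots> \<le> (LINT x:ball z e|lebesgue. cmod (f x ^ 2))"
    by (rule set_integral_norm_bound[OF int])
  finally show ?thesis by (simp add: norm_power)
qed

subsection \<open>Hilbert space structure\<close>

lemma set_integral_dV:
  fixes f :: "complex^'d \<Rightarrow> 'b::{banach, second_countable_topology}"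
  assumes V: "0 < measure lebesgue V"
  shows "set_integrable (dV V) D f \<longleftrightarrow> set_integrable lebesgue D f"
    and "(LINT x:D|dV V. f x) = (1 / measure lebesgue V) *\<^sub>R (LINT x:D|lebesgue. f x)"
proof -
  define F where "F x = indicator D x *\<^sub>R f x" for x
  let ?c = "1 / measure lebesgue V"
  have c: "?c > 0" using V by simp
  have iff: "integrable lebesgue (\<lambda>x. ?c *\<^sub>R F x) \<longleftrightarrow> integrable lebesgue F"
  proof
    assume "integrable lebesgue (\<lambda>x. ?c *\<^sub>R F x)"
    then have "integrable lebesgue (\<lambda>x. measure lebesgue V *\<^sub>R (?c *\<^sub>R F x))"
      by - (rule integrable_scaleR_right)
    moreover have "(\<lambda>x. measure lebesgue V *\<^sub>R (?c *\<^sub>R F x)) = F" using V by (simp add: fun_eq_iff)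
    ultimately show "integrable lebesgue F" by (simp only:)
  qed (intro integrable_scaleR_right)
  have "(integrable (dV V) F \<longleftrightarrow> integrable lebesgue F) \<and>
      integral\<^sup>L (dV V) F = ?c *\<^sub>R integral\<^sup>L lebesgue F"
  proof (cases "F \<in> borel_measurable lebesgue")
    case True
    then show ?thesis
      unfolding dV_def using V integrable_density[OF True, of "\<lambda>_. ?c"] integral_density[OF True, of "\<lambda>_. ?c"] iff
      by simp
  next
    case False
    have "sets (dV V) = sets lebesgue" unfolding dV_def by simp
    then have "F \<notin> borel_measurable (dV V)"
      using False by (simp cong: measurable_cong_sets)
    then have "\<not> integrable (dV V) F" "\<not> integrable lebesgue F"
      using False borel_measurable_integrable by metis+
    then show ?thesis by (simp add: not_integrable_integral_eq)
  qed
  then show "set_integrable (dV V) D f \<longleftrightarrow> set_integrable lebesgue D f"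
    "(LINT x:D|dV V. f x) = (1 / measure lebesgue V) *\<^sub>R (LINT x:D|lebesgue. f x)"
    unfolding set_integrable_def set_lebesgue_integral_def F_def by simp_all
qed

lemma set_borel_measurable_continuous_lebesgue:
  fixes f :: "complex^'d \<Rightarrow> 'b::{banach, second_countable_topology}"
  assumes "open D" "continuous_on D f"
  shows "(\<lambda>x. indicator D x *\<^sub>R f x) \<in> borel_measurable lebesgue"
proof -
  have "(\<lambda>x. indicator D x *\<^sub>R f x) \<in> borel_measurable borel"
    using assms by (intro borel_measurable_continuous_on_indicator) auto
  then have "(\<lambda>x. indicator D x *\<^sub>R f x) \<in> borel_measurable lborel" by simp
  then show ?thesis by (rule measurable_completion)
qed

locale weighted_domain =
  fixes V D :: "(complex^'d) set" and \<nu> :: "complex^'d \<Rightarrow> real"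
  assumes V: "0 < measure lebesgue V" and D: "open D"
    and cont: "continuous_on D \<nu>" and pos: "\<And>z. z \<in> D \<Longrightarrow> \<nu> z > 0"
begin

abbreviation "A2 \<equiv> bergman_space (dV V) D \<nu>"
abbreviation "ip \<equiv> bergman_inner (dV V) D \<nu>"

definition sqnorm :: "(complex^'d \<Rightarrow> complex) \<Rightarrow> real" where
  "sqnorm f = (LINT z:D|dV V. (cmod (f z))\<^sup>2 * \<nu> z)"

lemma space_iff: "f \<in> A2 \<longleftrightarrow> holomorphic_several f D \<and> (\<forall>z. z \<notin> D \<longrightarrow> f z = 0) \<and>
    set_integrable lebesgue D (\<lambda>z. (cmod (f z))\<^sup>2 * \<nu> z)"
  unfolding bergman_space_def set_integral_dV(1)[OF V] by simp

lemma space_holomorphic: "f \<in> A2 \<Longrightarrow> holomorphic_several f D"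
  and space_integrable: "f \<in> A2 \<Longrightarrow> set_integrable lebesgue D (\<lambda>z. (cmod (f z))\<^sup>2 * \<nu> z)"
  and space_zero: "f \<in> A2 \<Longrightarrow> z \<notin> D \<Longrightarrow> f z = 0"
  by (auto simp: space_iff)

lemma space_continuous: "f \<in> A2 \<Longrightarrow> continuous_on D f"
  using space_holomorphic holomorphic_several_continuous_on by blast

lemma sqnorm_lebesgue: "sqnorm f = (LINT z:D|lebesgue. (cmod (f z))\<^sup>2 * \<nu> z) / measure lebesgue V"
  unfolding sqnorm_def set_integral_dV(2)[OF V] by simp

lemma set_integrable_dominated:
  fixes g :: "complex^'d \<Rightarrow> 'b::{banach, second_countable_topology}"
  assumes "set_integrable lebesgue D h" "continuous_on D g" "\<And>z. z \<in> D \<Longrightarrow> norm (g z) \<le> (h z :: real)"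
  shows "set_integrable lebesgue D g"
  unfolding set_integrable_def
proof (rule Bochner_Integration.integrable_bound)
  show "integrable lebesgue (\<lambda>x. indicator D x *\<^sub>R h x)"
    using assms(1) by (simp add: set_integrable_def)
  show "AE x in lebesgue. norm (indicator D x *\<^sub>R g x) \<le> norm (indicator D x *\<^sub>R h x)"
    using assms(3) by (intro AE_I2) (auto simp: indicator_def intro: order_trans[OF _ abs_ge_self])
qed (rule set_borel_measurable_continuous_lebesgue[OF D assms(2)])

lemma inner_integrable:
  assumes "f \<in> A2" "g \<in> A2"
  shows "set_integrable lebesgue D (\<lambda>z. f z * cnj (g z) * complex_of_real (\<nu> z))"
proof (rule set_integrable_dominated[OF set_integral_add(1)[OF space_integrable[OF assms(1)] space_integrable[OF assms(2)]]])
  show "continuous_on D (\<lambda>z. f z * cnj (g z) * complex_of_real (\<nu> z))"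
    by (intro continuous_intros space_continuous assms cont)
  fix z assume z: "z \<in> D"
  have "cmod (f z) * cmod (g z) \<le> (cmod (f z))\<^sup>2 + (cmod (g z))\<^sup>2"
    using sum_squares_bound[of "cmod (f z)" "cmod (g z)"] by (simp add: mult_nonneg_nonneg order_trans[rotated])
  then have "cmod (f z) * cmod (g z) * \<nu> z \<le> ((cmod (f z))\<^sup>2 + (cmod (g z))\<^sup>2) * \<nu> z"
    using pos[OF z] by (intro mult_right_mono) auto
  then show "cmod (f z * cnj (g z) * complex_of_real (\<nu> z)) \<le> (cmod (f z))\<^sup>2 * \<nu> z + (cmod (g z))\<^sup>2 * \<nu> z"
    using pos[OF z] by (simp add: norm_mult distrib_right)
qed

lemma space_add: assumes f: "f \<in> A2" and g: "g \<in> A2" shows "(\<lambda>z. f z + g z) \<in> A2"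
  unfolding space_iff
proof (intro conjI)
  show "holomorphic_several (\<lambda>z. f z + g z) D"
    by (intro holomorphic_several_add space_holomorphic f g)
  show "\<forall>z. z \<notin> D \<longrightarrow> f z + g z = 0" using space_zero[OF f] space_zero[OF g] by simp
  have i: "set_integrable lebesgue D (\<lambda>z. 2 * ((cmod (f z))\<^sup>2 * \<nu> z) + 2 * ((cmod (g z))\<^sup>2 * \<nu> z))"
    by (intro set_integral_add set_integrable_mult_right space_integrable f g)
  show "set_integrable lebesgue D (\<lambda>z. (cmod (f z + g z))\<^sup>2 * \<nu> z)"
  proof (rule set_integrable_dominated[OF i])
    show "continuous_on D (\<lambda>z. (cmod (f z + g z))\<^sup>2 * \<nu> z)"
      by (intro continuous_intros space_continuous f g cont)
    fix z assume z: "z \<in> D"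
    have "(cmod (f z + g z))\<^sup>2 \<le> (cmod (f z) + cmod (g z))\<^sup>2"
      by (intro power_mono norm_triangle_ineq) auto
    also have "\<dots> \<le> 2 * (cmod (f z))\<^sup>2 + 2 * (cmod (g z))\<^sup>2"
      using sum_squares_bound[of "cmod (f z)" "cmod (g z)"] by (simp add: power2_sum)
    finally have "(cmod (f z + g z))\<^sup>2 * \<nu> z \<le> (2 * (cmod (f z))\<^sup>2 + 2 * (cmod (g z))\<^sup>2) * \<nu> z"
      using pos[OF z] by (intro mult_right_mono) auto
    then show "norm ((cmod (f z + g z))\<^sup>2 * \<nu> z) \<le> 2 * ((cmod (f z))\<^sup>2 * \<nu> z) + 2 * ((cmod (g z))\<^sup>2 * \<nu> z)"
      using pos[OF z] by (simp add: distrib_right)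
  qed
qed

lemma space_scale: assumes f: "f \<in> A2" shows "(\<lambda>z. c * f z) \<in> A2"
proof -
  have "set_integrable lebesgue D (\<lambda>z. (cmod c)\<^sup>2 * ((cmod (f z))\<^sup>2 * \<nu> z))"
    by (intro set_integrable_mult_right space_integrable f)
  then show ?thesis
    using f by (auto simp: space_iff norm_mult power_mult_distrib mult.assoc intro: holomorphic_several_cmult)
qed

lemma space_diff: "f \<in> A2 \<Longrightarrow> g \<in> A2 \<Longrightarrow> (\<lambda>z. f z - g z) \<in> A2"
  using space_add[of f "\<lambda>z. - 1 * g z"] space_scale[of g "-1"] by simp

lemma space_null: "(\<lambda>z. 0) \<in> A2"
  by (simp add: space_iff set_integrable_def)

lemma ip_add: assumes "f \<in> A2" "g \<in> A2" "h \<in> A2"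
  shows "ip (\<lambda>z. f z + g z) h = ip f h + ip g h"
  unfolding bergman_inner_def set_integral_dV(2)[OF V] distrib_right
  using inner_integrable assms by (subst set_integral_add(2)) (auto simp: scaleR_add_right)

lemma ip_scale: "ip (\<lambda>z. c * f z) h = c * ip f h"
  unfolding bergman_inner_def mult.assoc by simp

lemma ip_cnj: "ip g f = cnj (ip f g)"
proof -
  have "ip g f = (LINT z:D|dV V. cnj (f z * cnj (g z) * complex_of_real (\<nu> z)))"
    unfolding bergman_inner_def by (simp add: mult_ac)
  also have "\<dots> = cnj (ip f g)"
  proof -
    have "indicator D z *\<^sub>R cnj (f z * cnj (g z) * complex_of_real (\<nu> z)) =
        cnj (indicator D z *\<^sub>R (f z * cnj (g z) * complex_of_real (\<nu> z)))" for z
      by (simp only: complex_cnj_scaleR)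
    then show ?thesis
      unfolding bergman_inner_def set_lebesgue_integral_def by (simp only: Bochner_Integration.integral_cnj)
  qed
  finally show ?thesis .
qed

lemma ip_diff: assumes "f \<in> A2" "g \<in> A2" "h \<in> A2"
  shows "ip (\<lambda>z. f z - g z) h = ip f h - ip g h"
  using ip_add[of f "\<lambda>z. - 1 * g z" h] ip_scale[of "-1" g h] space_scale[of g "-1"] assms by simp

lemma ip_add_right: assumes "f \<in> A2" "g \<in> A2" "h \<in> A2"
  shows "ip h (\<lambda>z. f z + g z) = ip h f + ip h g"
  using ip_cnj ip_add[OF assms] by (metis complex_cnj_add)

lemma ip_scale_right: "ip h (\<lambda>z. c * f z) = cnj c * ip h f"
  using ip_cnj[of h "\<lambda>z. c * f z"] ip_cnj[of h f] ip_scale[of c f h] by simp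

lemma ip_self: "ip f f = complex_of_real (sqnorm f)"
proof -
  have "ip f f = (LINT z:D|dV V. complex_of_real ((cmod (f z))\<^sup>2 * \<nu> z))"
    unfolding bergman_inner_def by (simp only: of_real_mult complex_norm_square)
  also have "\<dots> = complex_of_real (sqnorm f)"
    unfolding sqnorm_def by (rule set_integral_complex_of_real)
  finally show ?thesis .
qed

lemma sqnorm_nonneg: "sqnorm f \<ge> 0"
  unfolding sqnorm_def set_lebesgue_integral_def
  using pos by (intro Bochner_Integration.integral_nonneg) (auto simp: indicator_def less_imp_le)

lemma sqnorm_add:
  assumes f: "f \<in> A2" and g: "g \<in> A2"
  shows "sqnorm (\<lambda>z. f z + g z) = sqnorm f + sqnorm g + 2 * Re (ip g f)"
proof -
  have fg: "(\<lambda>z. f z + g z) \<in> A2" by (rule space_add[OF f g])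
  have "ip (\<lambda>z. f z + g z) (\<lambda>z. f z + g z) = ip f f + ip g g + (ip g f + cnj (ip g f))"
    by (simp add: ip_add[OF f g fg] ip_add_right[OF f g f] ip_add_right[OF f g g] flip: ip_cnj)
  then have "complex_of_real (sqnorm (\<lambda>z. f z + g z)) =
      complex_of_real (sqnorm f + sqnorm g + 2 * Re (ip g f))"
    by (simp only: ip_self complex_add_cnj) simp
  then show ?thesis using of_real_eq_iff by blast
qed

lemma sqnorm_scale: "sqnorm (\<lambda>z. c * f z) = (cmod c)\<^sup>2 * sqnorm f"
proof -
  have "(\<lambda>z. (cmod (c * f z))\<^sup>2 * \<nu> z) = (\<lambda>z. (cmod c)\<^sup>2 * ((cmod (f z))\<^sup>2 * \<nu> z))"
    by (simp add: fun_eq_iff norm_mult power_mult_distrib mult.assoc)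
  then show ?thesis unfolding sqnorm_def by simp
qed

lemma parallelogram:
  assumes f: "f \<in> A2" and g: "g \<in> A2"
  shows "sqnorm (\<lambda>z. f z - g z) = 2 * sqnorm f + 2 * sqnorm g - 4 * sqnorm (\<lambda>z. (1 / 2) * (f z + g z))"
proof -
  have "sqnorm (\<lambda>z. f z + (-1) * g z) = sqnorm f + sqnorm (\<lambda>z. (-1) * g z) + 2 * Re (ip (\<lambda>z. (-1) * g z) f)"
    by (rule sqnorm_add[OF f space_scale[OF g]])
  then have "sqnorm (\<lambda>z. f z - g z) = sqnorm f + sqnorm g - 2 * Re (ip g f)"
    unfolding ip_scale sqnorm_scale by simp
  moreover have "sqnorm (\<lambda>z. (1 / 2) * (f z + g z)) = (1 / 4) * sqnorm (\<lambda>z. f z + g z)"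
    unfolding sqnorm_scale by (simp add: power2_eq_square norm_divide)
  ultimately show ?thesis using sqnorm_add[OF f g] by simp
qed

text \<open>The weight is bounded below on a small closed ball, so that the integral in the sub-mean-value inequality is controlled by the
  weighted norm.\<close>

lemma local_bound:
  assumes p: "p \<in> D"
  shows "\<exists>C e. e > 0 \<and> C \<ge> 0 \<and> ball p e \<subseteq> D \<and> (\<forall>f\<in>A2. \<forall>z\<in>ball p e. (cmod (f z))\<^sup>2 \<le> C * sqnorm f)"
proof -
  obtain e0 where e0: "e0 > 0" "cball p e0 \<subseteq> D"
    using D p open_contains_cball by blast
  define e where "e = e0 / 3"
  have e: "e > 0" "cball p (3 * e) \<subseteq> D" using e0 by (auto simp: e_def)
  obtain x0 where x0: "x0 \<in> cball p (3 * e)" "\<And>x. x \<in> cball p (3 * e) \<Longrightarrow> \<nu> x0 \<le> \<nu> x"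
    using continuous_attains_inf[OF compact_cball[of p "3 * e"] _ continuous_on_subset[OF cont e(2)]] e(1)
    by auto
  have m: "\<nu> x0 > 0" using pos x0(1) e(2) by blast
  let ?vol = "measure lebesgue (ball (0::complex^'d) e)"
  have vol: "?vol > 0"
    using e(1) by (simp add: measure_completion content_ball_pos)
  define C where "C = measure lebesgue V / (\<nu> x0 * ?vol)"
  have C: "C \<ge> 0" unfolding C_def using V m vol by simp
  have "ball p e \<subseteq> cball p (3 * e)" using e(1) by auto
  with e(2) have sub: "ball p e \<subseteq> D" by blast
  have "(cmod (f z))\<^sup>2 \<le> C * sqnorm f" if f: "f \<in> A2" and z: "z \<in> ball p e" for f z
  proof -
    have zs: "cball z (2 * e) \<subseteq> cball p (3 * e)"
    proof
      fix x assume "x \<in> cball z (2 * e)"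
      then show "x \<in> cball p (3 * e)" using z dist_triangle[of p x z] by auto
    qed
    have bz: "ball z e \<subseteq> cball p (3 * e)" using zs e(1) by (auto simp: subset_eq)
    have contf: "continuous_on (cball p (3 * e)) f"
      by (rule continuous_on_subset[OF space_continuous[OF f] e(2)])
    have contn: "continuous_on (cball p (3 * e)) \<nu>"
      by (rule continuous_on_subset[OF cont e(2)])
    have "\<nu> x0 * ((cmod (f z))\<^sup>2 * ?vol) \<le> \<nu> x0 * (LINT x:ball z e|lebesgue. (cmod (f x))\<^sup>2)"
      using sub_mean_value_ball[OF space_holomorphic[OF f] e(1), of z] zs e(2) m
      by (intro mult_left_mono) auto
    also have "\<dots> = (LINT x:ball z e|lebesgue. \<nu> x0 * (cmod (f x))\<^sup>2)" by simp
    also have "\<dots> \<le> (LINT x:ball z e|lebesgue. (cmod (f x))\<^sup>2 * \<nu> x)"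
    proof (rule set_integral_mono)
      show "set_integrable lebesgue (ball z e) (\<lambda>x. \<nu> x0 * (cmod (f x))\<^sup>2)"
        by (rule set_integrable_lebesgue_continuous[OF compact_cball _ _ bz])
          (auto intro!: continuous_intros contf)
      show "set_integrable lebesgue (ball z e) (\<lambda>x. (cmod (f x))\<^sup>2 * \<nu> x)"
        by (rule set_integrable_lebesgue_continuous[OF compact_cball _ _ bz])
          (auto intro!: continuous_intros contf contn)
      fix x assume "x \<in> ball z e"
      then have "\<nu> x0 \<le> \<nu> x" using x0(2) bz by blast
      then show "\<nu> x0 * (cmod (f x))\<^sup>2 \<le> (cmod (f x))\<^sup>2 * \<nu> x"
        using mult_left_mono[of "\<nu> x0" "\<nu> x" "(cmod (f x))\<^sup>2"] by (simp add: mult.commute)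
    qed
    also have "\<dots> \<le> (LINT x:D|lebesgue. (cmod (f x))\<^sup>2 * \<nu> x)"
      unfolding set_lebesgue_integral_def
    proof (rule integral_mono)
      show "integrable lebesgue (\<lambda>x. indicator D x *\<^sub>R ((cmod (f x))\<^sup>2 * \<nu> x))"
        using space_integrable[OF f] by (simp add: set_integrable_def)
      have "set_integrable lebesgue (ball z e) (\<lambda>x. (cmod (f x))\<^sup>2 * \<nu> x)"
        by (rule set_integrable_lebesgue_continuous[OF compact_cball _ _ bz])
          (auto intro!: continuous_intros contf contn)
      then show "integrable lebesgue (\<lambda>x. indicator (ball z e) x *\<^sub>R ((cmod (f x))\<^sup>2 * \<nu> x))"
        by (simp add: set_integrable_def)
      fix x
      show "indicator (ball z e) x *\<^sub>R ((cmod (f x))\<^sup>2 * \<nu> x) \<le> indicator D x *\<^sub>R ((cmod (f x))\<^sup>2 * \<nu> x)"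
        using pos[of x] bz e(2) by (auto simp: indicator_def less_imp_le)
    qed
    also have "\<dots> = measure lebesgue V * sqnorm f" using V by (simp add: sqnorm_lebesgue)
    finally show ?thesis
      using m vol by (simp add: C_def field_simps)
  qed
  then show ?thesis using e(1) C sub by (intro exI[of _ C] exI[of _ e]) simp
qed

lemma compact_bound:
  assumes K: "compact K" "K \<subseteq> D"
  shows "\<exists>C. \<forall>f\<in>A2. \<forall>z\<in>K. (cmod (f z))\<^sup>2 \<le> C * sqnorm f"
proof -
  have "\<forall>p\<in>D. \<exists>C e. e > 0 \<and> C \<ge> 0 \<and> ball p e \<subseteq> D \<and> (\<forall>f\<in>A2. \<forall>z\<in>ball p e. (cmod (f z))\<^sup>2 \<le> C * sqnorm f)"
    using local_bound by blast
  from bchoice[OF this] obtain C where "\<forall>p\<in>D. \<exists>e. e > 0 \<and> C p \<ge> 0 \<and> ball p e \<subseteq> D \<and>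
      (\<forall>f\<in>A2. \<forall>z\<in>ball p e. (cmod (f z))\<^sup>2 \<le> C p * sqnorm f)" by blast
  from bchoice[OF this] obtain e where Ce: "\<And>p. p \<in> D \<Longrightarrow> e p > 0" "\<And>p. p \<in> D \<Longrightarrow> C p \<ge> 0"
    "\<And>p f z. p \<in> D \<Longrightarrow> f \<in> A2 \<Longrightarrow> z \<in> ball p (e p) \<Longrightarrow> (cmod (f z))\<^sup>2 \<le> C p * sqnorm f"
    by blast
  have cover: "K \<subseteq> (\<Union>p\<in>K. ball p (e p))" using Ce(1) K(2) by fastforce
  obtain P where P: "P \<subseteq> K" "finite P" "K \<subseteq> (\<Union>p\<in>P. ball p (e p))"
    using compactE_image[OF K(1) _ cover] by auto
  have "(cmod (f z))\<^sup>2 \<le> (\<Sum>p\<in>P. C p) * sqnorm f" if f: "f \<in> A2" and z: "z \<in> K" for f z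
  proof -
    obtain p where p: "p \<in> P" "z \<in> ball p (e p)" using P(3) z by blast
    then have "(cmod (f z))\<^sup>2 \<le> C p * sqnorm f" using Ce(3)[of p] P(1) K(2) f by blast
    also have "\<dots> \<le> (\<Sum>p\<in>P. C p) * sqnorm f"
      using p P K(2) Ce(2) by (intro mult_right_mono member_le_sum sqnorm_nonneg) auto
    finally show ?thesis .
  qed
  then show ?thesis by blast
qed

lemma sqnorm_zero: assumes f: "f \<in> A2" "sqnorm f = 0" shows "f = (\<lambda>z. 0)"
proof
  fix z
  show "f z = 0"
  proof (cases "z \<in> D")
    case True
    then obtain C e where "e > 0" "\<And>f x. f \<in> A2 \<Longrightarrow> x \<in> ball z e \<Longrightarrow> (cmod (f x))\<^sup>2 \<le> C * sqnorm f"
      using local_bound by meson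
    then have "(cmod (f z))\<^sup>2 \<le> 0" using f by fastforce
    then show ?thesis by simp
  qed (simp add: space_zero[OF f(1)])
qed

lemma fatou:
  assumes f: "\<And>n. f n \<in> A2" and g: "holomorphic_several g D" "\<And>z. z \<notin> D \<Longrightarrow> g z = 0"
    and lim: "\<And>z. z \<in> D \<Longrightarrow> (\<lambda>n. f n z) \<longlonglongrightarrow> g z"
    and b: "\<forall>\<^sub>F n in sequentially. sqnorm (f n) \<le> b"
  shows "g \<in> A2" "sqnorm g \<le> b"
proof -
  let ?i = "\<lambda>f x. indicator D x *\<^sub>R ((cmod (f x))\<^sup>2 * \<nu> x)"
  have b0: "b \<ge> 0"
    using b sqnorm_nonneg by (meson eventually_sequentially order_refl order_trans)
  have nn: "?i f x \<ge> 0" for f x using pos[of x] by (auto simp: indicator_def less_imp_le)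
  have contg: "continuous_on D g" by (rule holomorphic_several_continuous_on[OF g(1)])
  have sets: "sets (dV V) = sets lebesgue" by (simp add: dV_def)
  have mg: "?i g \<in> borel_measurable (dV V)"
    unfolding measurable_cong_sets[OF sets refl]
    by (rule set_borel_measurable_continuous_lebesgue[OF D]) (intro continuous_intros contg cont)
  have if': "integrable (dV V) (?i (f n))" for n
  proof -
    have "set_integrable (dV V) D (\<lambda>x. (cmod (f n x))\<^sup>2 * \<nu> x)"
      using space_integrable[OF f[of n]] by (simp only: set_integral_dV(1)[OF V])
    then show ?thesis by (simp only: set_integrable_def)
  qed
  have "(\<lambda>n. ?i (f n) x) \<longlonglongrightarrow> ?i g x" for x
  proof (cases "x \<in> D")
    case True
    then show ?thesis by (intro tendsto_intros lim)
  qed simp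
  then have L: "liminf (\<lambda>n. ennreal (?i (f n) x)) = ennreal (?i g x)" for x
    by (intro lim_imp_Liminf tendsto_ennrealI) auto
  have "(\<integral>\<^sup>+x. ennreal (?i g x) \<partial>dV V) \<le> liminf (\<lambda>n. \<integral>\<^sup>+x. ennreal (?i (f n) x) \<partial>dV V)"
    unfolding L[symmetric] using if' by (intro nn_integral_liminf) (auto dest: borel_measurable_integrable)
  also have "\<dots> = liminf (\<lambda>n. ennreal (sqnorm (f n)))"
    using if' nn by (subst nn_integral_eq_integral) (auto simp: sqnorm_def set_lebesgue_integral_def)
  also have "\<dots> \<le> limsup (\<lambda>n. ennreal (sqnorm (f n)))"
    by (rule Liminf_le_Limsup) simp
  also have "\<dots> \<le> ennreal b"
    by (rule Limsup_bounded) (use b in \<open>auto elim!: eventually_mono simp: ennreal_leI\<close>)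
  finally have le: "(\<integral>\<^sup>+x. ennreal (?i g x) \<partial>dV V) \<le> ennreal b" .
  have ig: "integrable (dV V) (?i g)"
    using le_less_trans[OF le] nn by (intro integrableI_nonneg mg) auto
  then have "set_integrable (dV V) D (\<lambda>x. (cmod (g x))\<^sup>2 * \<nu> x)" by (simp only: set_integrable_def)
  then show "g \<in> A2"
    using g unfolding space_iff set_integral_dV(1)[OF V] by blast
  show "sqnorm g \<le> b"
  proof -
    have "AE x in dV V. 0 \<le> ?i g x" by (rule AE_I2) (rule nn)
    from le[unfolded nn_integral_eq_integral[OF ig this]] show ?thesis
      using b0 by (simp add: sqnorm_def set_lebesgue_integral_def)
  qed
qed

text \<open>A Cauchy sequence in the norm is locally uniformly Cauchy, so it has a holomorphic limit; Fatou's lemma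
  shows that it is also the limit in the norm.\<close>

lemma complete:
  assumes f: "\<And>n. f n \<in> A2"
    and cauchy: "\<And>\<epsilon>. \<epsilon> > 0 \<Longrightarrow> \<exists>N. \<forall>m\<ge>N. \<forall>n\<ge>N. sqnorm (\<lambda>z. f m z - f n z) \<le> \<epsilon>"
  obtains g where "g \<in> A2" "\<And>z. z \<in> D \<Longrightarrow> (\<lambda>n. f n z) \<longlonglongrightarrow> g z"
    "(\<lambda>n. sqnorm (\<lambda>z. f n z - g z)) \<longlonglongrightarrow> 0"
proof -
  define g where "g z = (if z \<in> D then lim (\<lambda>n. f n z) else 0)" for z
  have loc: "\<exists>U. p \<in> U \<and> holomorphic_several g U \<and> (\<lambda>n. f n p) \<longlonglongrightarrow> g p" if p: "p \<in> D" for p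
  proof -
    obtain C e where Ce: "e > 0" "C \<ge> 0" "ball p e \<subseteq> D"
      "\<And>f z. f \<in> A2 \<Longrightarrow> z \<in> ball p e \<Longrightarrow> (cmod (f z))\<^sup>2 \<le> C * sqnorm f"
      using local_bound[OF p] by blast
    have "uniformly_Cauchy_on (ball p e) f"
      unfolding uniformly_Cauchy_on_def
    proof (intro allI impI)
      fix \<delta> :: real assume \<delta>: "\<delta> > 0"
      have "\<delta>\<^sup>2 / (C + 1) > 0" using \<delta> Ce(2) by simp
      then obtain N where N: "\<And>m n. m \<ge> N \<Longrightarrow> n \<ge> N \<Longrightarrow> sqnorm (\<lambda>z. f m z - f n z) \<le> \<delta>\<^sup>2 / (C + 1)"
        using cauchy by meson
      have "dist (f m z) (f n z) < \<delta>" if "z \<in> ball p e" "m \<ge> N" "n \<ge> N" for z m n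
      proof -
        have "(cmod (f m z - f n z))\<^sup>2 \<le> C * sqnorm (\<lambda>z. f m z - f n z)"
          by (rule Ce(4)[OF space_diff[OF f f] that(1)])
        also have "\<dots> \<le> C * (\<delta>\<^sup>2 / (C + 1))"
          using N[OF that(2,3)] Ce(2) by (intro mult_left_mono) auto
        also have "\<dots> < \<delta>\<^sup>2"
        proof -
          have "C * \<delta>\<^sup>2 < \<delta>\<^sup>2 * (C + 1)" using \<delta> by (simp add: algebra_simps)
          then show ?thesis using Ce(2) by (simp add: divide_less_eq)
        qed
        finally show ?thesis using \<delta> by (simp add: dist_norm power2_less_imp_less)
      qed
      then show "\<exists>M. \<forall>x\<in>ball p e. \<forall>m\<ge>M. \<forall>n\<ge>M. dist (f m x) (f n x) < \<delta>" by blast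
    qed
    then obtain h where h: "uniform_limit (ball p e) f h sequentially"
      using Cauchy_uniformly_convergent uniformly_convergent_on_def by blast
    have hg: "h z = g z" if "z \<in> ball p e" for z
      using tendsto_uniform_limitI[OF h that] Ce(3) that by (auto simp: g_def dest: limI)
    have "holomorphic_several h (ball p e)"
      by (rule holomorphic_several_uniform_limit[OF _ open_ball h])
        (rule holomorphic_several_subset[OF space_holomorphic[OF f] Ce(3)])
    then have "holomorphic_several g (ball p e)"
      by (rule holomorphic_several_transform) (simp_all add: hg)
    moreover have "(\<lambda>n. f n p) \<longlonglongrightarrow> g p"
      using tendsto_uniform_limitI[OF h, of p] hg[of p] Ce(1) by simp
    ultimately show ?thesis using Ce(1) by (intro exI[of _ "ball p e"]) simp
  qed
  have hol: "holomorphic_several g D"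
    by (rule holomorphic_several_localI) (use loc in blast)
  have lim: "(\<lambda>n. f n z) \<longlonglongrightarrow> g z" if "z \<in> D" for z using loc[OF that] by blast
  have near: "(\<lambda>z. f n z - g z) \<in> A2 \<and> sqnorm (\<lambda>z. f n z - g z) \<le> \<epsilon>"
    if N: "\<And>m n. m \<ge> N \<Longrightarrow> n \<ge> N \<Longrightarrow> sqnorm (\<lambda>z. f m z - f n z) \<le> \<epsilon>" and n: "n \<ge> N" for N n \<epsilon>
  proof -
    have "holomorphic_several (\<lambda>z. f n z - g z) D"
      by (intro holomorphic_several_diff space_holomorphic f hol)
    moreover have "\<And>z. z \<notin> D \<Longrightarrow> f n z - g z = 0"
      using space_zero[OF f[of n]] by (simp add: g_def)
    moreover have "\<And>z. z \<in> D \<Longrightarrow> (\<lambda>m. f n z - f m z) \<longlonglongrightarrow> f n z - g z"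
      by (intro tendsto_intros lim)
    moreover have "\<forall>\<^sub>F m in sequentially. sqnorm (\<lambda>z. f n z - f m z) \<le> \<epsilon>"
      using N[OF n] unfolding eventually_sequentially by blast
    ultimately show ?thesis
      using fatou[of "\<lambda>m z. f n z - f m z" "\<lambda>z. f n z - g z" \<epsilon>] space_diff[OF f f] by blast
  qed
  obtain N where N: "\<And>m n. m \<ge> N \<Longrightarrow> n \<ge> N \<Longrightarrow> sqnorm (\<lambda>z. f m z - f n z) \<le> 1"
    using cauchy[of 1] by auto
  have "(\<lambda>z. f N z - g z) \<in> A2"
    using near[where N = N and n = N and \<epsilon> = 1, OF N order_refl] by simp
  then have "(\<lambda>z. f N z - (f N z - g z)) \<in> A2" by (rule space_diff[OF f])
  then have gs: "g \<in> A2" by simp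
  have "(\<lambda>n. sqnorm (\<lambda>z. f n z - g z)) \<longlonglongrightarrow> 0"
  proof (rule LIMSEQ_I)
    fix r :: real assume r: "r > 0"
    then obtain N where N: "\<And>m n. m \<ge> N \<Longrightarrow> n \<ge> N \<Longrightarrow> sqnorm (\<lambda>z. f m z - f n z) \<le> r / 2"
      using cauchy[of "r / 2"] by auto
    have "norm (sqnorm (\<lambda>z. f n z - g z) - 0) < r" if "n \<ge> N" for n
      using near[OF N that] r sqnorm_nonneg by simp
    then show "\<exists>no. \<forall>n\<ge>no. norm (sqnorm (\<lambda>z. f n z - g z) - 0) < r" by blast
  qed
  with gs lim show ?thesis by (rule that)
qed

subsection \<open>Representation of bounded functionals\<close>

text \<open>Divide by \<open>s\<close> and let \<open>s\<close> tend to \<open>0\<close>.\<close>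

lemma scaled_less_imp_zero:
  fixes x y :: real
  assumes "x \<ge> 0" "y \<ge> 0" "\<And>s. s > 0 \<Longrightarrow> 2 * s * x \<le> s\<^sup>2 * x * y"
  shows "x = 0"
proof (rule ccontr)
  assume "x \<noteq> 0"
  then have x: "x > 0" using assms(1) by simp
  define s where "s = 1 / (y + 1)"
  have s: "s > 0" "s * y < 1" using assms(2) by (auto simp: s_def divide_less_eq)
  have "2 * s * x \<le> (s * x) * (s * y)"
    using assms(3)[OF s(1)] by (simp add: power2_eq_square mult_ac)
  also have "\<dots> < (s * x) * 1" using s x by (intro mult_strict_left_mono) auto
  finally show False using s x by simp
qed

text \<open>Among the functions on which the functional takes the value \<open>1\<close> there is one of minimal norm, by the
  parallelogram law; it is orthogonal to the kernel of the functional.\<close>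

theorem riesz:
  assumes W: "W \<subseteq> A2" "(\<lambda>z. 0) \<in> W" "\<And>f g. f \<in> W \<Longrightarrow> g \<in> W \<Longrightarrow> (\<lambda>z. f z + g z) \<in> W"
      "\<And>c f. f \<in> W \<Longrightarrow> (\<lambda>z. c * f z) \<in> W"
    and closed: "\<And>f g. (\<And>n::nat. f n \<in> W) \<Longrightarrow> g \<in> A2 \<Longrightarrow> (\<And>z. z \<in> D \<Longrightarrow> (\<lambda>n. f n z) \<longlonglongrightarrow> g z) \<Longrightarrow> g \<in> W"
    and L: "\<And>f g. f \<in> W \<Longrightarrow> g \<in> W \<Longrightarrow> \<Lambda> (\<lambda>z. f z + g z) = \<Lambda> f + \<Lambda> g"
      "\<And>c f. f \<in> W \<Longrightarrow> \<Lambda> (\<lambda>z. c * f z) = c * \<Lambda> f"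
    and bound: "\<And>f. f \<in> W \<Longrightarrow> (cmod (\<Lambda> f))\<^sup>2 \<le> C * sqnorm f"
  shows "\<exists>k\<in>W. \<forall>f\<in>W. \<Lambda> f = ip f k"
proof (cases "\<forall>f\<in>W. \<Lambda> f = 0")
  case True
  have "ip f (\<lambda>z. 0) = 0" for f unfolding bergman_inner_def by simp
  then show ?thesis using True W(2) by (intro bexI[of _ "\<lambda>z. 0"]) auto
next
  case False
  then obtain f0 where f0: "f0 \<in> W" "\<Lambda> f0 \<noteq> 0" by blast
  have Wd: "(\<lambda>z. f z - g z) \<in> W" "\<Lambda> (\<lambda>z. f z - g z) = \<Lambda> f - \<Lambda> g" if "f \<in> W" "g \<in> W" for f g
    using W(3)[OF that(1) W(4)[OF that(2), of "-1"]] L(1)[OF that(1) W(4)[OF that(2), of "-1"]]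
      L(2)[OF that(2), of "-1"] by simp_all
  define S where "S = {f \<in> W. \<Lambda> f = 1}"
  have "(\<lambda>z. (1 / \<Lambda> f0) * f0 z) \<in> S"
    unfolding S_def using W(4)[OF f0(1), of "1 / \<Lambda> f0"] L(2)[OF f0(1), of "1 / \<Lambda> f0"] f0(2) by simp
  then have S0: "sqnorm ` S \<noteq> {}" by blast
  have bdd: "bdd_below (sqnorm ` S)" by (rule bdd_belowI2[of _ 0]) (rule sqnorm_nonneg)
  define m where "m = Inf (sqnorm ` S)"
  have m: "m \<le> sqnorm f" if "f \<in> S" for f
    unfolding m_def using that bdd by (intro cInf_lower) auto
  have "\<exists>f\<in>S. sqnorm f < m + 1 / real (Suc n)" for n
  proof -
    have "Inf (sqnorm ` S) < m + 1 / real (Suc n)" by (simp add: m_def)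
    then show ?thesis using cInf_less_iff[OF S0 bdd] by auto
  qed
  then obtain f where f: "\<And>n. f n \<in> S" "\<And>n. sqnorm (f n) < m + 1 / real (Suc n)" by metis
  have fW: "f n \<in> W" and fA: "f n \<in> A2" and f1: "\<Lambda> (f n) = 1" for n
    using f(1)[of n] W(1) by (auto simp: S_def)
  have mid: "(\<lambda>z. (1 / 2) * (g z + h z)) \<in> S" if "g \<in> S" "h \<in> S" for g h
  proof -
    have gh: "g \<in> W" "h \<in> W" "\<Lambda> g = 1" "\<Lambda> h = 1" using that by (auto simp: S_def)
    have "\<Lambda> (\<lambda>z. (1 / 2) * (g z + h z)) = (1 / 2) * (\<Lambda> g + \<Lambda> h)"
      by (simp only: L(2)[OF W(3)[OF gh(1,2)]] L(1)[OF gh(1,2)])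
    then show ?thesis unfolding S_def using W(4)[OF W(3)[OF gh(1,2)], of "1 / 2"] gh by simp
  qed
  have "\<exists>N. \<forall>i\<ge>N. \<forall>j\<ge>N. sqnorm (\<lambda>z. f i z - f j z) \<le> \<epsilon>" if \<epsilon>: "\<epsilon> > 0" for \<epsilon>
  proof -
    obtain N where N: "1 / real (Suc N) < \<epsilon> / 4"
      using nat_approx_posE[of "\<epsilon> / 4"] \<epsilon> by auto
    have "sqnorm (\<lambda>z. f i z - f j z) \<le> \<epsilon>" if ij: "i \<ge> N" "j \<ge> N" for i j
    proof -
      have "sqnorm (\<lambda>z. f i z - f j z) =
          2 * sqnorm (f i) + 2 * sqnorm (f j) - 4 * sqnorm (\<lambda>z. (1 / 2) * (f i z + f j z))"
        by (rule parallelogram[OF fA fA])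
      also have "\<dots> \<le> 2 / real (Suc i) + 2 / real (Suc j)"
        using f(2)[of i] f(2)[of j] m[OF mid[OF f(1)[of i] f(1)[of j]]] by simp
      also have "\<dots> \<le> 2 / real (Suc N) + 2 / real (Suc N)"
        using ij by (intro add_mono divide_left_mono) auto
      finally show ?thesis using N by simp
    qed
    then show ?thesis by blast
  qed
  from complete[OF fA this] obtain g where g: "g \<in> A2" "\<And>z. z \<in> D \<Longrightarrow> (\<lambda>n. f n z) \<longlonglongrightarrow> g z"
    "(\<lambda>n. sqnorm (\<lambda>z. f n z - g z)) \<longlonglongrightarrow> 0" by blast
  have gW: "g \<in> W" by (rule closed[OF fW g(1,2)])
  have g1: "\<Lambda> g = 1"
  proof -
    have "(cmod (1 - \<Lambda> g))\<^sup>2 \<le> C * sqnorm (\<lambda>z. f n z - g z)" for n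
      using bound[OF Wd(1)[OF fW gW], of n] Wd(2)[OF fW gW, of n] f1 by simp
    moreover have "(\<lambda>n. C * sqnorm (\<lambda>z. f n z - g z)) \<longlonglongrightarrow> C * 0"
      by (intro tendsto_mult_left g(3))
    ultimately have "(cmod (1 - \<Lambda> g))\<^sup>2 \<le> C * 0"
      by (intro tendsto_lowerbound[of _ _ sequentially]) auto
    then show ?thesis by simp
  qed
  have gm: "sqnorm g \<le> m"
  proof (rule field_le_epsilon)
    fix e :: real assume e: "e > 0"
    obtain N where N: "1 / real (Suc N) < e" using nat_approx_posE[OF e] by auto
    have ev: "\<forall>\<^sub>F n in sequentially. sqnorm (f n) \<le> m + e"
      unfolding eventually_sequentially
    proof (intro exI allI impI)
      fix n assume "N \<le> n"
      then have "1 / real (Suc n) \<le> 1 / real (Suc N)" by (intro divide_left_mono) auto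
      then show "sqnorm (f n) \<le> m + e" using f(2)[of n] N by simp
    qed
    show "sqnorm g \<le> m + e"
      by (rule fatou(2)[of f g, OF fA space_holomorphic[OF g(1)] _ g(2) ev]) (rule space_zero[OF g(1)])
  qed
  have orth: "ip h g = 0" if h: "h \<in> W" "\<Lambda> h = 0" for h
  proof -
    have hA: "h \<in> A2" using h W(1) by blast
    define x where "x = (cmod (ip h g))\<^sup>2"
    have "2 * s * x \<le> s\<^sup>2 * x * sqnorm h" if s: "s > 0" for s :: real
    proof -
      \<comment> \<open>Moving \<open>g\<close> by \<open>t h\<close> lowers its norm to first order in \<open>s\<close> unless \<open>h\<close> is orthogonal to \<open>g\<close>.\<close>
      define t where "t = - complex_of_real s * cnj (ip h g)"
      have th: "(\<lambda>z. t * h z) \<in> W" "\<Lambda> (\<lambda>z. t * h z) = 0" using W(4)[OF h(1)] L(2)[OF h(1)] h(2) by simp_all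
      have "(\<lambda>z. g z + t * h z) \<in> S"
        unfolding S_def using W(3)[OF gW th(1)] L(1)[OF gW th(1)] th(2) g1 by simp
      from m[OF this] gm have "sqnorm g \<le> sqnorm (\<lambda>z. g z + t * h z)" by linarith
      also have "\<dots> = sqnorm g + (cmod t)\<^sup>2 * sqnorm h + 2 * Re (t * ip h g)"
        using sqnorm_add[OF g(1) space_scale[OF hA, of t]] by (simp only: sqnorm_scale ip_scale)
      also have "t * ip h g = complex_of_real (- s * x)"
      proof -
        have "t * ip h g = - complex_of_real s * (ip h g * cnj (ip h g))" by (simp add: t_def mult_ac)
        also have "ip h g * cnj (ip h g) = complex_of_real x" by (simp only: x_def complex_norm_square)
        finally show ?thesis by simp
      qed
      also have "(cmod t)\<^sup>2 = s\<^sup>2 * x"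
        by (simp add: t_def x_def norm_mult power_mult_distrib)
      finally show ?thesis by simp
    qed
    then have "x = 0"
      by (intro scaled_less_imp_zero[of x "sqnorm h"]) (auto simp: x_def sqnorm_nonneg)
    then show ?thesis by (simp add: x_def)
  qed
  have gpos: "sqnorm g > 0"
    using bound[OF gW] g1 sqnorm_nonneg[of g] by (cases "sqnorm g = 0") auto
  let ?k = "\<lambda>z. complex_of_real (1 / sqnorm g) * g z"
  have "\<Lambda> h = ip h ?k" if h: "h \<in> W" for h
  proof -
    have W1: "(\<lambda>z. \<Lambda> h * g z) \<in> W" "\<Lambda> (\<lambda>z. \<Lambda> h * g z) = \<Lambda> h"
      using W(4)[OF gW] L(2)[OF gW] g1 by simp_all
    have "ip (\<lambda>z. h z - \<Lambda> h * g z) g = 0"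
      using Wd[OF h W1(1)] W1(2) by (intro orth) simp_all
    moreover have "ip (\<lambda>z. h z - \<Lambda> h * g z) g = ip h g - \<Lambda> h * ip g g"
      using ip_diff[of h "\<lambda>z. \<Lambda> h * g z" g] h W1 W(1) g(1) by (simp add: ip_scale subset_iff)
    ultimately have "ip h g = \<Lambda> h * complex_of_real (sqnorm g)"
      by (simp add: ip_self)
    then show ?thesis unfolding ip_scale_right using gpos by simp
  qed
  then show ?thesis using W(4)[OF gW] by blast
qed

lemma evaluation_bound: assumes "p \<in> D"
  shows "\<exists>C. \<forall>f\<in>A2. (cmod (f p))\<^sup>2 \<le> C * sqnorm f"
  using compact_bound[of "{p}"] assms by auto

text \<open>The difference of two representers of the same functional is orthogonal to itself.\<close>

lemma representer_unique:
  assumes k: "k \<in> A2" "k' \<in> A2" and same: "ip (\<lambda>z. k z - k' z) k = ip (\<lambda>z. k z - k' z) k'"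
  shows "k = k'"
proof -
  let ?d = "\<lambda>z. k z - k' z"
  have d: "?d \<in> A2" by (rule space_diff[OF k])
  have "ip k ?d - ip k' ?d = cnj (ip ?d k - ip ?d k')"
    using ip_cnj[of k ?d] ip_cnj[of k' ?d] by simp
  then have "ip ?d ?d = 0"
    using same ip_diff[OF k d] by simp
  then have "sqnorm ?d = 0" by (simp add: ip_self)
  from sqnorm_zero[OF d this] show ?thesis by (auto simp: fun_eq_iff)
qed

text \<open>Point evaluations are bounded, so the definite description in the definition of the kernel denotes the representer of
  the evaluation at \<open>w\<close>.\<close>

theorem bergman_kernel_reproducing:
  assumes w: "w \<in> D"
  shows "(\<lambda>z. bergman_kernel (dV V) D \<nu> z w) \<in> A2"
    and "f \<in> A2 \<Longrightarrow> f w = ip f (\<lambda>z. bergman_kernel (dV V) D \<nu> z w)"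
proof -
  obtain C where C: "\<And>f. f \<in> A2 \<Longrightarrow> (cmod (f w))\<^sup>2 \<le> C * sqnorm f"
    using evaluation_bound[OF w] by blast
  have "\<exists>k\<in>A2. \<forall>f\<in>A2. f w = ip f k"
    by (rule riesz[where C = C and \<Lambda> = "\<lambda>f. f w"]) (auto simp: space_null space_add space_scale C)
  then obtain k where k: "k \<in> A2" "\<And>f. f \<in> A2 \<Longrightarrow> f w = ip f k" by blast
  have "(THE k. k \<in> A2 \<and> (\<forall>f\<in>A2. f w = ip f k)) = k"
  proof (rule the_equality)
    fix k' assume k': "k' \<in> A2 \<and> (\<forall>f\<in>A2. f w = ip f k')"
    have "ip f k' = ip f k" if "f \<in> A2" for f
      using k' k(2)[OF that] that by metis
    then show "k' = k" using k' k(1) space_diff by (intro representer_unique) blast+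
  qed (use k in blast)
  then have "(\<lambda>z. bergman_kernel (dV V) D \<nu> z w) = k"
    unfolding bergman_kernel_def by simp
  then show "(\<lambda>z. bergman_kernel (dV V) D \<nu> z w) \<in> A2"
    "f \<in> A2 \<Longrightarrow> f w = ip f (\<lambda>z. bergman_kernel (dV V) D \<nu> z w)"
    using k by simp_all
qed

end

section \<open>Polynomial functions\<close>

abbreviation monomial_fun :: "('d \<Rightarrow>\<^sub>0 nat) \<Rightarrow> complex^'d \<Rightarrow> complex" where
  "monomial_fun m z \<equiv> (\<Prod>i\<in>UNIV. (z $ i) ^ Poly_Mapping.lookup m i)"

definition poly_function :: "(complex^'d \<Rightarrow> complex) \<Rightarrow> bool" where
  "poly_function f \<longleftrightarrow> (\<exists>p. \<forall>z. f z = eval_poly p z)"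

lemma eval_poly_superset:
  assumes "finite S" "Poly_Mapping.keys p \<subseteq> S"
  shows "eval_poly p z = (\<Sum>m\<in>S. Poly_Mapping.lookup p m * monomial_fun m z)"
  unfolding eval_poly_def using assms
  by (intro sum.mono_neutral_left) (auto simp: in_keys_iff)

lemma eval_poly_add: "eval_poly (p + q) z = eval_poly p z + eval_poly q z"
proof -
  let ?S = "Poly_Mapping.keys p \<union> Poly_Mapping.keys q"
  have "Poly_Mapping.keys (p + q) \<subseteq> ?S" by (rule Poly_Mapping.keys_add)
  then show ?thesis
    by (subst (1 2 3) eval_poly_superset[of ?S])
      (auto simp: lookup_add distrib_right sum.distrib)
qed

lemma polynomial_add:
  "poly_function f \<Longrightarrow> poly_function g \<Longrightarrow> poly_function (\<lambda>z. f z + g z)"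
  unfolding poly_function_def by (metis eval_poly_add)

lemma polynomial_monomial: "poly_function (\<lambda>z. c * monomial_fun m z)"
  unfolding poly_function_def
  by (rule exI[of _ "Poly_Mapping.single m c"]) (simp add: eval_poly_def lookup_single)

lemma polynomial_const: "poly_function (\<lambda>z. c)"
  using polynomial_monomial[of c 0] by simp

lemma polynomial_sum:
  "(\<And>i. i \<in> I \<Longrightarrow> poly_function (f i)) \<Longrightarrow> poly_function (\<lambda>z. \<Sum>i\<in>I. f i z)"
  by (induction I rule: infinite_finite_induct) (auto intro: polynomial_add polynomial_const)

lemma polynomial_mult:
  assumes "poly_function f" "poly_function g"
  shows "poly_function (\<lambda>z. f z * g z)"
proof -
  obtain p q where p: "\<And>z. f z = eval_poly p z" and q: "\<And>z. g z = eval_poly q z"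
    using assms unfolding poly_function_def by blast
  have "f z * g z = (\<Sum>m\<in>Poly_Mapping.keys p. \<Sum>n\<in>Poly_Mapping.keys q.
      (Poly_Mapping.lookup p m * Poly_Mapping.lookup q n) * monomial_fun (m + n) z)" for z
    unfolding p q eval_poly_def
    by (simp add: sum_product lookup_add power_add prod.distrib mult_ac)
  then show ?thesis
    by (simp only:) (intro polynomial_sum polynomial_monomial)
qed

lemma polynomial_prod:
  "(\<And>i. i \<in> I \<Longrightarrow> poly_function (f i)) \<Longrightarrow> poly_function (\<lambda>z. \<Prod>i\<in>I. f i z)"
  by (induction I rule: infinite_finite_induct) (auto intro: polynomial_mult polynomial_const)

lemma polynomial_power: "poly_function f \<Longrightarrow> poly_function (\<lambda>z. f z ^ n)"
  by (induction n) (auto intro: polynomial_mult polynomial_const)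

lemma polynomial_coordinate: "poly_function (\<lambda>z :: complex^'d. z $ i)"
proof -
  have "monomial_fun (Poly_Mapping.single i 1) z = (\<Prod>j\<in>UNIV. if j = i then z $ i else 1)" for z :: "complex^'d"
    by (intro prod.cong) (auto simp: lookup_single when_def)
  then show ?thesis
    using polynomial_monomial[of 1 "Poly_Mapping.single i 1"] by simp
qed

lemma polynomial_diff:
  "poly_function f \<Longrightarrow> poly_function g \<Longrightarrow> poly_function (\<lambda>z. f z - g z)"
  using polynomial_add[of f "\<lambda>z. - 1 * g z"] polynomial_mult[OF polynomial_const, of g "-1"] by simp

lemma polynomial_matrix: "poly_function (\<lambda>z. (A *v z) $ i)"
  unfolding matrix_vector_mult_def
  by (auto intro!: polynomial_sum polynomial_mult polynomial_const polynomial_coordinate)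

lemma polynomial_compose_matrix:
  assumes "poly_function f" shows "poly_function (\<lambda>z. f (A *v z))"
proof -
  obtain p where p: "\<And>z. f z = eval_poly p z"
    using assms unfolding poly_function_def by blast
  show ?thesis
    unfolding p eval_poly_def
    by (intro polynomial_sum polynomial_mult polynomial_prod polynomial_power polynomial_const polynomial_matrix)
qed

lemma holomorphic_several_coordinate: "holomorphic_several (\<lambda>z. z $ i) D"
  by (rule holomorphic_several_linear_form) (simp add: linear_form_iff)

lemma polynomial_holomorphic: assumes "poly_function f" shows "holomorphic_several f D"
proof -
  obtain p where p: "f = (\<lambda>z. eval_poly p z)"
    using assms unfolding poly_function_def by blast
  show ?thesis
    unfolding p eval_poly_def
    by (intro holomorphic_several_sum holomorphic_several_cmult holomorphic_several_prod
        holomorphic_several_power holomorphic_several_coordinate)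
qed

lemma polynomial_interpolation:
  assumes "finite S" "z \<notin> S"
  shows "\<exists>f. poly_function f \<and> f z \<noteq> 0 \<and> (\<forall>s\<in>S. f s = 0)"
proof -
  have "\<forall>s\<in>S. \<exists>i. z $ i \<noteq> s $ i" using assms(2) by (metis vec_eq_iff)
  then obtain i where i: "\<And>s. s \<in> S \<Longrightarrow> z $ i s \<noteq> s $ i s" by metis
  let ?f = "\<lambda>x. \<Prod>s\<in>S. x $ i s - s $ i s"
  have "poly_function ?f"
    by (intro polynomial_prod polynomial_diff polynomial_coordinate polynomial_const)
  moreover have "?f z \<noteq> 0" using i assms(1) by simp
  moreover have "\<forall>s\<in>S. ?f s = 0" using assms(1) by auto
  ultimately show ?thesis by blast
qed

text \<open>On the complex line through \<open>p\<close> and \<open>q\<close> the function is entire and does not vanish identically.\<close>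

lemma holomorphic_line_eventually_nonzero:
  assumes f: "holomorphic_several f UNIV" and q: "f q \<noteq> 0"
  shows "\<forall>\<^sub>F \<zeta> in at 0. f (p + \<zeta> *s (q - p)) \<noteq> 0"
    and "countable {\<zeta>. f (p + \<zeta> *s (q - p)) = 0}"
proof -
  let ?\<phi> = "\<lambda>\<zeta>. f (p + \<zeta> *s (q - p))"
  have hol: "?\<phi> holomorphic_on UNIV" by (rule holomorphic_several_line[OF f]) simp
  have one: "?\<phi> 1 \<noteq> 0" using q by simp
  have fin: "finite {\<zeta>\<in>K. ?\<phi> \<zeta> = 0}" if "compact K" for K
  proof (cases "?\<phi> constant_on UNIV")
    case True
    then obtain c where "\<And>x. ?\<phi> x = c" unfolding constant_on_def by blast
    moreover from this[of 1] one have "c \<noteq> 0" by simp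
    ultimately show ?thesis by simp
  next
    case False
    show ?thesis
      by (rule holomorphic_compact_finite_zeros[OF hol open_UNIV connected_UNIV that _ False]) simp
  qed
  have "\<forall>\<^sub>F \<zeta> in at 0. \<forall>x\<in>{\<zeta>\<in>cball 0 1. ?\<phi> \<zeta> = 0}. \<zeta> \<noteq> x"
    by (intro eventually_ball_finite fin ballI eventually_neq_at_within) simp
  moreover have "\<forall>\<^sub>F \<zeta> in at 0. \<zeta> \<in> ball (0::complex) 1"
    by (intro eventually_at_in_open') auto
  ultimately show "\<forall>\<^sub>F \<zeta> in at 0. ?\<phi> \<zeta> \<noteq> 0"
  proof eventually_elim
    case (elim \<zeta>)
    then have "\<zeta> \<notin> {\<zeta>\<in>cball 0 1. ?\<phi> \<zeta> = 0}" by blast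
    then show ?case using elim(2) by auto
  qed
  have "{\<zeta>. ?\<phi> \<zeta> = 0} = (\<Union>n::nat. {\<zeta>\<in>cball 0 (real n). ?\<phi> \<zeta> = 0})"
    by (auto simp: real_arch_simple)
  then show "countable {\<zeta>. ?\<phi> \<zeta> = 0}"
    using fin[of "cball 0 (real n)" for n] by (simp add: countable_finite)
qed

section \<open>Basic polynomial maps\<close>

locale basic_map = finite_matrix_group G for G :: "(complex^'d^'d) set" +
  fixes \<theta> :: "complex^'d \<Rightarrow> complex^'d"
  assumes basic: "basic_polynomial_map G \<theta>"
begin

definition regular :: "complex^'d \<Rightarrow> bool" where
  "regular z \<longleftrightarrow> (\<forall>A\<in>G. A *v z = z \<longrightarrow> A = mat 1)"

definition jac :: "complex^'d \<Rightarrow> complex^'d^'d" where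
  "jac z = matrix (frechet_derivative \<theta> (at z))"

lemma jacobian_det_eq: "jacobian_det \<theta> z = det (jac z)"
  by (simp add: jacobian_det_def jac_def)

lemma \<theta>_polynomial: "poly_function (\<lambda>z. \<theta> z $ i)"
  using basic unfolding basic_polynomial_map_def poly_function_def by blast

lemma \<theta>_holomorphic: "holomorphic_several (\<lambda>z. \<theta> z $ i) D"
  by (rule polynomial_holomorphic[OF \<theta>_polynomial])

lemma \<theta>_deriv: "(\<theta> has_derivative (*v) (jac z)) (at z)"
proof -
  obtain \<theta>' where \<theta>': "(\<theta> has_derivative \<theta>') (at z)" "\<And>c x. \<theta>' (c *s x) = c *s \<theta>' x"
    using holomorphic_map_derivative[of \<theta> UNIV z] \<theta>_holomorphic by auto
  have "frechet_derivative \<theta> (at z) = \<theta>'"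
    by (rule frechet_derivative_at[OF \<theta>'(1), symmetric])
  then have "jac z = matrix \<theta>'" by (simp only: jac_def)
  moreover have "matrix \<theta>' *v x = \<theta>' x" for x
    by (rule matrix_linear_mult)
      (simp_all add: \<theta>'(2) linear_add[OF has_derivative_linear[OF \<theta>'(1)]])
  ultimately have "(*v) (jac z) = \<theta>'" by (simp add: fun_eq_iff)
  with \<theta>'(1) show ?thesis by simp
qed

lemma \<theta>_continuous: "continuous_on D \<theta>"
  using \<theta>_deriv has_derivative_continuous continuous_at_imp_continuous_on by blast

lemma invariant_polynomial:
  assumes "poly_function f" "\<And>A z. A \<in> G \<Longrightarrow> f (A *v z) = f z"
  shows "\<exists>q. \<forall>z. f z = eval_poly q (\<theta> z)"
proof -
  obtain p where p: "f = eval_poly p" using assms(1) unfolding poly_function_def by auto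
  have "f \<in> invariant_poly_functions G"
    unfolding invariant_poly_functions_def using p assms(2) by (auto simp: fun_eq_iff act_fun_eq)
  then show ?thesis using basic unfolding basic_polynomial_map_def by auto
qed

lemma \<theta>_invariant: assumes A: "A \<in> G" shows "\<theta> (A *v z) = \<theta> z"
proof -
  have "\<theta> (A *v z) $ i = \<theta> z $ i" for i
  proof -
    obtain q where q: "\<And>u :: complex^'d. u $ i = eval_poly q u"
      using polynomial_coordinate[of i] unfolding poly_function_def by blast
    have "(\<lambda>z. eval_poly q (\<theta> z)) \<in> invariant_poly_functions G"
      using basic unfolding basic_polynomial_map_def by auto
    then have "act_fun A (\<lambda>z. \<theta> z $ i) = (\<lambda>z. \<theta> z $ i)"
      using A unfolding invariant_poly_functions_def by (simp flip: q)
    from fun_cong[OF this, of z] show ?thesis by (simp add: act_fun_eq[OF A])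
  qed
  then show ?thesis by (simp add: vec_eq_iff)
qed

lemma sum_over_group_invariant:
  assumes "A \<in> G" shows "(\<Sum>B\<in>G. f (B *v (A *v z))) = (\<Sum>B\<in>G. f (B *v z))"
  using sum.reindex_bij_betw[OF right_mult_bij[OF assms], of "\<lambda>B. f (B *v z)"]
  by (simp add: mult_vec_assoc)

text \<open>Averaging a polynomial that vanishes at all but one point of the two orbits gives an invariant polynomial
  which tells the orbits apart, and every invariant polynomial factors through the basic map.\<close>

theorem \<theta>_separates_orbits:
  assumes eq: "\<theta> z = \<theta> w" obtains A where "A \<in> G" "w = A *v z"
proof -
  have "\<exists>A\<in>G. w = A *v z"
  proof (rule ccontr)
    assume contr: "\<not> ?thesis"
    let ?S = "(\<lambda>A. A *v z) ` G \<union> ((\<lambda>A. A *v w) ` G - {w})"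
    have S: "finite ?S" "w \<notin> ?S" using fin contr by auto
    obtain f where f: "poly_function f" "f w \<noteq> 0" "\<And>s. s \<in> ?S \<Longrightarrow> f s = 0"
      using polynomial_interpolation[OF S] by blast
    let ?F = "\<lambda>x. \<Sum>A\<in>G. f (A *v x)"
    have "poly_function ?F"
      by (intro polynomial_sum polynomial_compose_matrix f)
    then obtain q where q: "\<And>x. ?F x = eval_poly q (\<theta> x)"
      using invariant_polynomial[of ?F] sum_over_group_invariant by blast
    have "?F z = 0" using f(3) by (intro sum.neutral) auto
    moreover have "?F w = (\<Sum>A\<in>{A\<in>G. A *v w = w}. f (A *v w))"
      using fin f(3) by (intro sum.mono_neutral_right) auto
    moreover have "\<dots> = of_nat (card {A\<in>G. A *v w = w}) * f w" by simp
    moreover have "card {A\<in>G. A *v w = w} > 0"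
      using fin one_in by (subst card_gt_0_iff) auto
    ultimately show False using q[of z] q[of w] eq f(2) by simp
  qed
  then show ?thesis using that by blast
qed

text \<open>If the stabilizer of \<open>z\<close> is trivial, the derivative of an invariant polynomial at \<open>z\<close> can be prescribed: average a
  polynomial that vanishes to second order at the other points of the orbit.\<close>

theorem jac_invertible:
  assumes reg: "regular z" shows "invertible (jac z)"
proof -
  have "v = 0" if ker: "jac z *v v = 0" for v
  proof (rule ccontr)
    assume "v \<noteq> 0"
    then obtain k where k: "v $ k \<noteq> 0" by (auto simp: vec_eq_iff)
    let ?S = "(\<lambda>A. A *v z) ` (G - {mat 1})"
    have zS: "z \<notin> ?S"
    proof
      assume "z \<in> ?S"
      then obtain A where "A \<in> G" "A \<noteq> mat 1" "A *v z = z" by force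
      then show False using reg unfolding regular_def by blast
    qed
    have fS: "finite ?S" using fin by simp
    obtain p where p: "poly_function p" "p z \<noteq> 0" "\<And>s. s \<in> ?S \<Longrightarrow> p s = 0"
      using polynomial_interpolation[OF fS zS] by blast
    \<comment> \<open>The double zeros of \<open>p\<^sup>2\<close> keep the other points of the orbit from contributing to the derivative.\<close>
    define f where "f x = (x $ k - z $ k) * p x ^ 2" for x
    have fp: "poly_function f"
      unfolding f_def by (intro polynomial_mult polynomial_diff polynomial_power polynomial_coordinate polynomial_const p)
    let ?F = "\<lambda>x. \<Sum>A\<in>G. f (A *v x)"
    have "poly_function ?F"
      by (intro polynomial_sum polynomial_compose_matrix fp)
    then obtain q where q: "\<And>x. ?F x = eval_poly q (\<theta> x)"
      using invariant_polynomial[of ?F] sum_over_group_invariant by blast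
    have fd: "((\<lambda>t. f (y + t *s w)) has_field_derivative (w $ k * p y ^ 2)) (at 0)"
      if "y $ k = z $ k \<or> p y = 0" for y w
    proof -
      have "holomorphic_several p UNIV" by (rule polynomial_holomorphic[OF p(1)])
      then obtain p' where p': "linear_form p'" "(p has_derivative p') (at (y + 0 *s w))"
        unfolding holomorphic_several_def by auto
      have "((\<lambda>t. p (y + t *s w)) has_field_derivative p' w) (at 0)"
        by (rule holomorphic_several_line_deriv[OF p'(2,1)])
      then have "((\<lambda>t. (y $ k + t * w $ k - z $ k) * p (y + t *s w) ^ 2) has_field_derivative
          ((y $ k - z $ k) * (2 * p y * p' w) + w $ k * p y ^ 2)) (at 0)"
        by (auto intro!: derivative_eq_intros)
      then have "((\<lambda>t. f (y + t *s w)) has_field_derivative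
          ((y $ k - z $ k) * (2 * p y * p' w) + w $ k * p y ^ 2)) (at 0)"
        unfolding f_def by simp
      moreover have "(y $ k - z $ k) * (2 * p y * p' w) = 0" using that by auto
      ultimately show ?thesis by simp
    qed
    have "((\<lambda>t. f (A *v (z + t *s v))) has_field_derivative (if A = mat 1 then v $ k * p z ^ 2 else 0)) (at 0)"
      if A: "A \<in> G" for A
    proof -
      have e: "A *v (z + t *s v) = A *v z + t *s (A *v v)" for t
        by (simp add: matrix_vector_right_distrib vec.scale)
      show ?thesis
      proof (cases "A = mat 1")
        case True
        then show ?thesis using fd[of z v] by simp
      next
        case False
        then have "p (A *v z) = 0" using p(3) A by blast
        then show ?thesis using fd[of "A *v z" "A *v v"] False unfolding e by simp
      qed
    qed
    then have "((\<lambda>t. ?F (z + t *s v)) has_field_derivative (\<Sum>A\<in>G. if A = mat 1 then v $ k * p z ^ 2 else 0)) (at 0)"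
      by (intro DERIV_sum)
    moreover have "(\<Sum>A\<in>G. if A = mat 1 then v $ k * p z ^ 2 else 0) = v $ k * p z ^ 2"
      using fin one_in by simp
    ultimately have d1: "((\<lambda>t. ?F (z + t *s v)) has_field_derivative (v $ k * p z ^ 2)) (at 0)" by simp
    have "holomorphic_several (\<lambda>u. eval_poly q u) UNIV"
      by (rule polynomial_holomorphic) (auto simp: poly_function_def)
    then obtain q' where q': "linear_form q'" "((\<lambda>u. eval_poly q u) has_derivative q') (at (\<theta> z))"
      unfolding holomorphic_several_def by blast
    have "((\<lambda>x. eval_poly q (\<theta> x)) has_derivative (\<lambda>x. q' (jac z *v x))) (at (z + 0 *s v))"
      using has_derivative_compose[OF \<theta>_deriv q'(2)] by simp
    moreover have "linear_form (\<lambda>x. q' (jac z *v x))"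
      using q'(1) by (simp add: linear_form_iff matrix_vector_right_distrib vec.scale)
    ultimately have "((\<lambda>t. eval_poly q (\<theta> (z + t *s v))) has_field_derivative q' (jac z *v v)) (at 0)"
      by (rule holomorphic_several_line_deriv)
    then have "((\<lambda>t. ?F (z + t *s v)) has_field_derivative 0) (at 0)"
      unfolding q ker linear_form_zero[OF q'(1)] .
    from DERIV_unique[OF d1 this] show False using k p(2) by simp
  qed
  then show ?thesis
    using invertible_left_inverse matrix_left_invertible_ker by blast
qed

lemma jac_equivariant: assumes A: "A \<in> G" shows "jac (A *v z) ** A = jac z"
proof -
  have "(\<theta> \<circ> (*v) A has_derivative (*v) (jac (A *v z)) \<circ> (*v) A) (at z)"
    by (rule diff_chain_at[OF bounded_linear_imp_has_derivative[OF matrix_vector_mul_bounded_linear] \<theta>_deriv])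
  moreover have "\<theta> \<circ> (*v) A = \<theta>" using \<theta>_invariant[OF A] by (simp add: fun_eq_iff)
  ultimately have "(*v) (jac (A *v z)) \<circ> (*v) A = (*v) (jac z)"
    using has_derivative_unique[OF _ \<theta>_deriv[of z]] by simp
  then show ?thesis
    by (intro matrix_eqI) (simp add: mult_vec_assoc fun_eq_iff)
qed

lemma jacobian_det_norm: assumes "A \<in> G" shows "cmod (jacobian_det \<theta> (A *v z)) = cmod (jacobian_det \<theta> z)"
proof -
  have "det (jac (A *v z)) * det A = det (jac z)"
    using jac_equivariant[OF assms] det_mul by metis
  then have "cmod (det (jac (A *v z))) * cmod (det A) = cmod (det (jac z))" by (metis norm_mult)
  then show ?thesis by (simp add: jacobian_det_eq det_norm[OF assms])
qed

subsection \<open>The discriminant\<close>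

text \<open>The zero set of \<open>\<Delta>\<close> contains the images of all points with a nontrivial stabilizer; its preimage is a union of
  hyperplanes, so it is negligible and does not disconnect the space. The linear forms are indexed by pairs of matrices.\<close>

definition is_discriminant :: "(complex^'d \<Rightarrow> complex) \<Rightarrow> bool" where
  "is_discriminant \<Delta> \<longleftrightarrow> (\<exists>(I :: ((complex^'d^'d) \<times> (complex^'d^'d)) set) m. poly_function \<Delta> \<and> finite I \<and>
    (\<forall>i\<in>I. linear_form (m i) \<and> (\<exists>z. m i z \<noteq> 0)) \<and> (\<forall>z. \<Delta> (\<theta> z) = (\<Prod>i\<in>I. m i z)) \<and>
    (\<forall>z. \<Delta> (\<theta> z) \<noteq> 0 \<longrightarrow> regular z))"

text \<open>For each nontrivial \<open>A\<close> in the group take a linear form that vanishes on the fixed points of \<open>A\<close>. The product of all these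
  forms and their translates is an invariant polynomial, hence a polynomial in the basic invariants.\<close>

lemma discriminant_exists: "\<exists>\<Delta>. is_discriminant \<Delta>"
proof -
  have "\<exists>i z. (A *v z - z) $ i \<noteq> 0" if "A \<noteq> mat 1" for A :: "complex^'d^'d"
  proof -
    have "\<exists>z. A *v z \<noteq> mat 1 *v z" using that matrix_eqI[of A "mat 1"] by blast
    then obtain z where "A *v z - z \<noteq> 0" by auto
    then show ?thesis by (auto simp: vec_eq_iff)
  qed
  then obtain i where i: "\<And>A :: complex^'d^'d. A \<noteq> mat 1 \<Longrightarrow> \<exists>z. (A *v z - z) $ i A \<noteq> 0" by metis
  define m where "m = (\<lambda>(B :: complex^'d^'d, A :: complex^'d^'d) z. (A *v (B *v z) - B *v z) $ i A)"
  let ?I = "G \<times> (G - {mat 1})"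
  have lin: "linear_form (m x)" for x
    unfolding m_def linear_form_iff
    by (auto simp: matrix_vector_right_distrib vec.scale split: prod.split) (simp_all add: algebra_simps)
  have nz: "\<exists>z. m x z \<noteq> 0" if x: "x \<in> ?I" for x
  proof -
    obtain B A where BA: "x = (B, A)" "B \<in> G" "A \<noteq> mat 1" using x by auto
    obtain z where "(A *v z - z) $ i A \<noteq> 0" using i[OF BA(3)] by blast
    then have "m x (iv B *v z) \<noteq> 0" by (simp add: m_def BA iv_mult_vec[OF BA(2)])
    then show ?thesis by blast
  qed
  let ?F = "\<lambda>z. \<Prod>x\<in>?I. m x z"
  have F: "?F z = (\<Prod>B\<in>G. \<Prod>A\<in>G - {mat 1}. m (mat 1, A) (B *v z))" for z
    by (simp add: m_def prod.cartesian_product split_def)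
  have "poly_function ?F"
    unfolding m_def split_def matrix_vector_mul_assoc vector_minus_component
    by (intro polynomial_prod polynomial_diff polynomial_matrix)
  moreover have "?F (C *v z) = ?F z" if "C \<in> G" for C z
    unfolding F
    using prod.reindex_bij_betw[OF right_mult_bij[OF that], of "\<lambda>B. \<Prod>A\<in>G - {mat 1}. m (mat 1, A) (B *v z)"]
    by (simp add: mult_vec_assoc)
  ultimately obtain q where q: "\<And>z. ?F z = eval_poly q (\<theta> z)"
    using invariant_polynomial[of ?F] by blast
  have reg: "regular z" if "?F z \<noteq> 0" for z
    unfolding regular_def
  proof (intro ballI impI, rule ccontr)
    fix A assume A: "A \<in> G" "A *v z = z" "A \<noteq> mat 1"
    then have "m (mat 1, A) z = 0" by (simp add: m_def)
    moreover have "(mat 1, A) \<in> ?I" using A one_in by simp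
    ultimately have "?F z = 0" using fin by (intro prod_zero) auto
    then show False using that by simp
  qed
  have "poly_function (\<lambda>u. eval_poly q u)" by (auto simp: poly_function_def)
  moreover have "finite ?I" using fin by simp
  ultimately show ?thesis
    unfolding is_discriminant_def using lin nz q reg
    by (intro exI[of _ "\<lambda>u. eval_poly q u"] exI[of _ ?I] exI[of _ m]) auto
qed

definition \<Delta> :: "complex^'d \<Rightarrow> complex" where
  "\<Delta> = (SOME \<Delta>. is_discriminant \<Delta>)"

lemma \<Delta>: "is_discriminant \<Delta>"
  unfolding \<Delta>_def by (rule someI_ex[OF discriminant_exists])

lemma \<Delta>_factors:
  obtains I :: "((complex^'d^'d) \<times> (complex^'d^'d)) set" and m where "finite I"
    "\<And>i. i \<in> I \<Longrightarrow> linear_form (m i)" "\<And>i. i \<in> I \<Longrightarrow> \<exists>z. m i z \<noteq> 0" "\<And>z. \<Delta> (\<theta> z) = (\<Prod>i\<in>I. m i z)"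
proof -
  from \<Delta>[unfolded is_discriminant_def] obtain I :: "((complex^'d^'d) \<times> (complex^'d^'d)) set" and m where
    "poly_function \<Delta> \<and> finite I \<and> (\<forall>i\<in>I. linear_form (m i) \<and> (\<exists>z. m i z \<noteq> 0)) \<and>
      (\<forall>z. \<Delta> (\<theta> z) = (\<Prod>i\<in>I. m i z)) \<and> (\<forall>z. \<Delta> (\<theta> z) \<noteq> 0 \<longrightarrow> regular z)"
    by (elim exE) (rule that)
  then show ?thesis by (intro that[of I m]) simp_all
qed

lemma \<Delta>_holomorphic: "holomorphic_several \<Delta> D" and \<Delta>_regular: "\<Delta> (\<theta> z) \<noteq> 0 \<Longrightarrow> regular z"
  using \<Delta> unfolding is_discriminant_def by (auto intro: polynomial_holomorphic)

lemma \<Delta>_nonzero: "\<exists>z. \<Delta> (\<theta> z) \<noteq> 0"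
proof -
  obtain I :: "((complex^'d^'d) \<times> (complex^'d^'d)) set" and m where I: "finite I"
    "\<And>i. i \<in> I \<Longrightarrow> linear_form (m i)" "\<And>i. i \<in> I \<Longrightarrow> \<exists>z. m i z \<noteq> 0" "\<And>z. \<Delta> (\<theta> z) = (\<Prod>i\<in>I. m i z)"
    by (rule \<Delta>_factors[OF that])
  have "\<exists>v\<in>UNIV. \<forall>i\<in>I. m i v \<noteq> 0"
    by (rule linear_forms_avoid_zero[OF I(1,2)]) (use I(3) in auto)
  then obtain v where v: "\<And>i. i \<in> I \<Longrightarrow> m i v \<noteq> 0" by blast
  have "\<Delta> (\<theta> v) \<noteq> 0" unfolding I(4) using v I(1) by simp
  then show ?thesis by blast
qed

lemma \<Delta>_direction: "\<exists>v. \<forall>\<^sub>F \<zeta> in at 0. \<Delta> (p + \<zeta> *s v) \<noteq> 0"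
  using \<Delta>_nonzero holomorphic_line_eventually_nonzero(1)[OF \<Delta>_holomorphic] by blast

subsection \<open>The basic map is an open surjection\<close>

lemma \<theta>_homogeneous: "\<exists>n. \<forall>c z. \<theta> (c *s z) $ i = c ^ n * \<theta> z $ i"
proof -
  obtain p where p: "homogeneous p" "\<And>z. \<theta> z $ i = eval_poly p z"
    using basic unfolding basic_polynomial_map_def by blast
  obtain n where n: "\<And>m. m \<in> Poly_Mapping.keys p \<Longrightarrow> (\<Sum>i\<in>UNIV. Poly_Mapping.lookup m i) = n"
    using p(1) unfolding homogeneous_def by blast
  have "monomial_fun m (c *s z) = c ^ n * monomial_fun m z" if "m \<in> Poly_Mapping.keys p" for m c z
    by (simp add: power_mult_distrib prod.distrib n[OF that] flip: power_sum)
  then have "eval_poly p (c *s z) = c ^ n * eval_poly p z" for c z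
    unfolding eval_poly_def sum_distrib_left by (intro sum.cong) (simp_all add: mult_ac)
  then show ?thesis using p(2) by auto
qed

text \<open>If \<open>\<theta>\<close> stayed bounded along a sequence tending to infinity, then, by homogeneity, the directions would accumulate at
  a point of the unit sphere with the same image as \<open>0\<close>.\<close>

lemma \<theta>_bounded_preimage: "bounded {z. norm (\<theta> z) \<le> R}"
proof (rule ccontr)
  assume unb: "\<not> ?thesis"
  have "\<exists>z. norm (\<theta> z) \<le> R \<and> norm z > real (Suc n)" for n
  proof (rule ccontr)
    assume contr: "\<not> ?thesis"
    have "bounded {z. norm (\<theta> z) \<le> R}"
      by (rule boundedI[of _ "real (Suc n)"]) (use contr in \<open>simp add: not_less\<close>)
    then show False using unb by contradiction
  qed
  then have "\<forall>n. \<exists>z. norm (\<theta> z) \<le> R \<and> norm z > real (Suc n)" by (rule allI)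
  from choice[OF this] obtain z where z: "\<And>n::nat. norm (\<theta> (z n)) \<le> R" "\<And>n. norm (z n) > real (Suc n)"
    by blast
  define y where "y n = complex_of_real (1 / norm (z n)) *s z n" for n
  have zpos: "norm (z n) > 0" for n using z(2)[of n] by linarith
  have "norm (y n) = 1" for n
    unfolding y_def using zpos[of n] by (simp add: norm_divide)
  then have "\<forall>n. y n \<in> sphere 0 1" by simp
  then obtain l r where l: "l \<in> sphere (0 :: complex^'d) 1" "strict_mono r" "(y \<circ> r) \<longlonglongrightarrow> l"
    using compact_sphere[of "0 :: complex^'d" 1] unfolding compact_def by blast
  have "\<theta> l $ i = \<theta> 0 $ i" for i
  proof -
    obtain n where n: "\<And>c z. \<theta> (c *s z) $ i = c ^ n * \<theta> z $ i" using \<theta>_homogeneous by blast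
    have "isCont \<theta> l" using \<theta>_continuous[of UNIV] by (simp add: continuous_on_eq_continuous_at)
    from isCont_tendsto_compose[OF this l(3)] have "(\<lambda>k. \<theta> (y (r k))) \<longlonglongrightarrow> \<theta> l"
      by (simp only: o_def)
    then have lim: "(\<lambda>k. \<theta> (y (r k)) $ i) \<longlonglongrightarrow> \<theta> l $ i" by (rule tendsto_vec_nth)
    have z0: "\<theta> 0 $ i = 0 ^ n * \<theta> x $ i" for x using n[of 0 x] by simp
    show ?thesis
    proof (cases "n = 0")
      case True
      then have "\<theta> x $ i = \<theta> 0 $ i" for x using z0[of x] by simp
      then show ?thesis .
    next
      case False
      have le: "cmod (\<theta> (y (r k)) $ i) \<le> R * (1 / real (Suc k))" for k
      proof -
        have "1 / norm (z (r k)) \<le> 1 / real (Suc k)"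
          using z(2)[of "r k"] seq_suble[OF l(2), of k] by (intro divide_left_mono mult_pos_pos) auto
        moreover have "1 / real (Suc k) \<le> 1" by simp
        ultimately have q: "1 / norm (z (r k)) \<le> 1" "0 \<le> 1 / norm (z (r k))" using zpos by (linarith, simp)
        have "(1 / norm (z (r k))) ^ n \<le> (1 / norm (z (r k))) ^ 1"
          using q False by (intro power_decreasing) auto
        with \<open>1 / norm (z (r k)) \<le> 1 / real (Suc k)\<close>
        have "(1 / norm (z (r k))) ^ n \<le> 1 / real (Suc k)" by simp
        moreover have "cmod (\<theta> (z (r k)) $ i) \<le> R"
          using Finite_Cartesian_Product.norm_nth_le[of "\<theta> (z (r k))" i] z(1)[of "r k"] by linarith
        ultimately have "(1 / norm (z (r k))) ^ n * cmod (\<theta> (z (r k)) $ i) \<le> 1 / real (Suc k) * R"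
          by (intro mult_mono) auto
        then show ?thesis
          by (simp add: y_def n norm_mult norm_power norm_divide power_one_over mult.commute)
      qed
      have "(\<lambda>k. R * (1 / real (Suc k))) \<longlonglongrightarrow> R * 0"
        by (intro tendsto_mult_left LIMSEQ_Suc lim_1_over_n)
      then have null: "(\<lambda>k. R * (1 / real (Suc k))) \<longlonglongrightarrow> 0" by (simp only: mult_zero_right)
      have "(\<lambda>k. \<theta> (y (r k)) $ i) \<longlonglongrightarrow> 0"
        by (rule Lim_null_comparison[OF always_eventually null]) (rule allI, rule le)
      with lim have "\<theta> l $ i = 0" by (rule LIMSEQ_unique)
      then show ?thesis using z0[of 0] False by (simp add: power_0_left)
    qed
  qed
  then have 0: "\<theta> 0 = \<theta> l" by (simp add: vec_eq_iff)
  obtain A where "A \<in> G" "l = A *v 0" by (rule \<theta>_separates_orbits[OF 0 that])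
  then show False using l(1) by simp
qed

text \<open>The basic map is proper, as bounded sets have bounded preimages.\<close>

lemma \<theta>_closed_image: assumes C: "closed C" shows "closed (\<theta> ` C)"
  unfolding closed_sequential_limits
proof (intro allI impI, elim conjE)
  fix u x assume u: "\<forall>n. u n \<in> \<theta> ` C" "u \<longlonglongrightarrow> x"
  then have "\<forall>n. \<exists>z. z \<in> C \<and> u n = \<theta> z" by blast
  from choice[OF this] obtain z where z: "\<And>n. z n \<in> C" "\<And>n. u n = \<theta> (z n)" by blast
  have "bounded (range u)" using u(2) convergent_imp_bounded by blast
  then obtain R where R: "\<And>n. norm (u n) \<le> R" unfolding bounded_iff by blast
  have "bounded {z. norm (\<theta> z) \<le> R}" by (rule \<theta>_bounded_preimage)
  then have "bounded (range z)" by (rule bounded_subset) (use R z in auto)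
  then obtain l r where l: "strict_mono r" "(z \<circ> r) \<longlonglongrightarrow> l"
    using bounded_imp_convergent_subsequence by blast
  have "l \<in> C" using closed_sequentially[OF C _ l(2)] z(1) by simp
  have "isCont \<theta> l" using \<theta>_continuous[of UNIV] by (simp add: continuous_on_eq_continuous_at)
  from isCont_tendsto_compose[OF this l(2)] have lim1: "(\<lambda>k. \<theta> (z (r k))) \<longlonglongrightarrow> \<theta> l"
    by (simp only: o_def)
  have lim2: "(\<lambda>k. \<theta> (z (r k))) \<longlonglongrightarrow> x"
    using LIMSEQ_subseq_LIMSEQ[OF u(2) l(1)] by (simp only: o_def z(2))
  have "x = \<theta> l" by (rule LIMSEQ_unique[OF lim2 lim1])
  with \<open>l \<in> C\<close> show "x \<in> \<theta> ` C" by blast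
qed

lemma \<theta>_open_at_regular:
  assumes reg: "regular z" and U: "open U" "z \<in> U" shows "\<theta> z \<in> interior (\<theta> ` U)"
proof -
  obtain B where B: "jac z ** B = mat 1" using jac_invertible[OF reg] unfolding invertible_def by blast
  show ?thesis
  proof (rule sussmann_open_mapping[OF open_UNIV \<theta>_continuous _ \<theta>_deriv matrix_vector_mul_bounded_linear])
    show "(*v) (jac z) \<circ> (*v) B = id" using B by (simp add: fun_eq_iff flip: mult_vec_assoc)
  qed (use U in \<open>auto simp: interior_open\<close>)
qed

text \<open>A complex line through two points off the zero set meets it in a countable set, whose complement in the line is connected.\<close>

lemma connected_\<Delta>_nonzero: "connected {u. \<Delta> u \<noteq> 0}"
proof -
  have "connected_component {u. \<Delta> u \<noteq> 0} a b" if ab: "\<Delta> a \<noteq> 0" "\<Delta> b \<noteq> 0" for a b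
    unfolding connected_component_def
  proof (intro exI conjI)
    let ?Z = "{\<zeta>. \<Delta> (a + \<zeta> *s (b - a)) = 0}"
    have "countable ?Z" by (rule holomorphic_line_eventually_nonzero(2)[OF \<Delta>_holomorphic ab(2)])
    then have "connected (- ?Z)"
      by (intro path_connected_imp_connected path_connected_complement_countable) auto
    then show "connected ((\<lambda>\<zeta>. a + \<zeta> *s (b - a)) ` (- ?Z))"
      by (rule connected_continuous_image[rotated]) (intro continuous_intros)
    show "a \<in> (\<lambda>\<zeta>. a + \<zeta> *s (b - a)) ` (- ?Z)" using ab by (intro image_eqI[of _ _ 0]) auto
    show "b \<in> (\<lambda>\<zeta>. a + \<zeta> *s (b - a)) ` (- ?Z)" using ab by (intro image_eqI[of _ _ 1]) auto
  qed auto
  then show ?thesis by (auto simp: connected_iff_connected_component)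
qed

text \<open>The image is closed, and relatively open over the connected dense set \<open>\<Delta> \<noteq> 0\<close>.\<close>

theorem \<theta>_surjective: "\<theta> ` UNIV = UNIV"
proof -
  let ?R = "{u. \<Delta> u \<noteq> 0}"
  have closed: "closed (\<theta> ` UNIV)" by (rule \<theta>_closed_image) simp
  have "?R \<inter> \<theta> ` UNIV \<subseteq> interior (\<theta> ` UNIV)"
    using \<theta>_open_at_regular[OF \<Delta>_regular open_UNIV] by auto
  then have eq: "?R \<inter> \<theta> ` UNIV = ?R \<inter> interior (\<theta> ` UNIV)"
    using interior_subset by blast
  have "openin (top_of_set ?R) (?R \<inter> \<theta> ` UNIV)"
    unfolding eq by (rule openin_open_Int) simp
  moreover have "closedin (top_of_set ?R) (?R \<inter> \<theta> ` UNIV)"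
    by (rule closedin_closed_Int[OF closed])
  moreover have "?R \<inter> \<theta> ` UNIV \<noteq> {}" using \<Delta>_nonzero by blast
  ultimately have "?R \<inter> \<theta> ` UNIV = ?R"
    using connected_\<Delta>_nonzero unfolding connected_clopen by blast
  then have R: "u \<in> \<theta> ` UNIV" if "\<Delta> u \<noteq> 0" for u using that by blast
  have "p \<in> \<theta> ` UNIV" for p
  proof -
    obtain v where v: "\<forall>\<^sub>F \<zeta> in at 0. \<Delta> (p + \<zeta> *s v) \<noteq> 0" using \<Delta>_direction by blast
    then have "\<forall>\<^sub>F \<zeta> in at 0. p + \<zeta> *s v \<in> \<theta> ` UNIV"
      by eventually_elim (rule R)
    from Lim_in_closed_set[OF closed this _ line_tendsto] show ?thesis by simp
  qed
  then show ?thesis by blast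
qed

text \<open>The union of the translates of \<open>U\<close> is a full preimage, so its image is the complement of the closed image of its
  complement.\<close>

theorem \<theta>_open_map: assumes U: "open U" shows "open (\<theta> ` U)"
proof -
  let ?GU = "\<Union>A\<in>G. (\<lambda>z. A *v z) -` U"
  have "open ((\<lambda>z. A *v z) -` U)" for A
    by (rule open_vimage[OF U]) (intro continuous_intros)
  then have GU: "closed (- ?GU)" by auto
  have img: "\<theta> ` U = \<theta> ` ?GU"
  proof
    show "\<theta> ` U \<subseteq> \<theta> ` ?GU" using one_in by (intro image_mono) force
    show "\<theta> ` ?GU \<subseteq> \<theta> ` U"
    proof
      fix u assume "u \<in> \<theta> ` ?GU"
      then obtain A z where "A \<in> G" "A *v z \<in> U" "u = \<theta> z" by blast
      then show "u \<in> \<theta> ` U" using \<theta>_invariant[of A z] by (metis imageI)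
    qed
  qed
  have "- \<theta> ` ?GU = \<theta> ` (- ?GU)"
  proof
    show "- \<theta> ` ?GU \<subseteq> \<theta> ` (- ?GU)"
    proof
      fix u assume u: "u \<in> - \<theta> ` ?GU"
      obtain z where "u = \<theta> z" using \<theta>_surjective by blast
      then show "u \<in> \<theta> ` (- ?GU)" using u by blast
    qed
    show "\<theta> ` (- ?GU) \<subseteq> - \<theta> ` ?GU"
    proof
      fix u assume "u \<in> \<theta> ` (- ?GU)"
      then obtain z where z: "u = \<theta> z" "z \<notin> ?GU" by blast
      have "u \<noteq> \<theta> w" if w: "w \<in> ?GU" for w
      proof
        assume "u = \<theta> w"
        then have zw: "\<theta> z = \<theta> w" using z(1) by simp
        obtain A where A: "A \<in> G" "w = A *v z" by (rule \<theta>_separates_orbits[OF zw that])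
        obtain B where B: "B \<in> G" "B *v w \<in> U" using w by blast
        then have "(B ** A) *v z \<in> U" by (simp add: A mult_vec_assoc)
        then show False using z(2) mult_in[OF B(1) A(1)] by blast
      qed
      then show "u \<in> - \<theta> ` ?GU" by blast
    qed
  qed
  moreover have "closed (\<theta> ` (- ?GU))" by (rule \<theta>_closed_image[OF GU])
  ultimately have "closed (- \<theta> ` ?GU)" by simp
  then show ?thesis unfolding img by (simp add: closed_def)
qed

subsection \<open>Descent of invariant holomorphic functions\<close>

lemma regular_neighbourhood:
  assumes reg: "regular z" and U: "open U" "z \<in> U"
  obtains N where "open N" "z \<in> N" "N \<subseteq> U" "inj_on \<theta> N"
proof -
  have "\<exists>N. open N \<and> z \<in> N \<and> (\<forall>x\<in>N. \<forall>y\<in>N. A *v x \<noteq> y)" if A: "A \<in> G - {mat 1}" for A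
  proof -
    have ne: "A *v z \<noteq> z" using A reg unfolding regular_def by blast
    obtain V W where VW: "open V" "open W" "A *v z \<in> V" "z \<in> W" "V \<inter> W = {}"
      using hausdorff[OF ne] by blast
    have "open ((\<lambda>x. A *v x) -` V)" by (rule open_vimage[OF VW(1)]) (intro continuous_intros)
    then show ?thesis using VW by (intro exI[of _ "((\<lambda>x. A *v x) -` V) \<inter> W"]) auto
  qed
  then have "\<forall>A\<in>G - {mat 1}. \<exists>N. open N \<and> z \<in> N \<and> (\<forall>x\<in>N. \<forall>y\<in>N. A *v x \<noteq> y)" by (rule ballI)
  from bchoice[OF this] obtain N where "\<forall>A\<in>G - {mat 1}. open (N A) \<and> z \<in> N A \<and> (\<forall>x\<in>N A. \<forall>y\<in>N A. A *v x \<noteq> y)"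
    by (elim exE) (rule that)
  then have N: "\<And>A. A \<in> G - {mat 1} \<Longrightarrow> open (N A)" "\<And>A. A \<in> G - {mat 1} \<Longrightarrow> z \<in> N A"
    "\<And>A x y. A \<in> G - {mat 1} \<Longrightarrow> x \<in> N A \<Longrightarrow> y \<in> N A \<Longrightarrow> A *v x \<noteq> y" by blast+
  let ?N = "U \<inter> (\<Inter>A\<in>G - {mat 1}. N A)"
  show ?thesis
  proof (rule that[of ?N])
    show "open ?N" using U(1) N(1) fin by (intro open_Int open_INT) auto
    show "inj_on \<theta> ?N"
    proof (rule inj_onI)
      fix x y assume xy: "x \<in> ?N" "y \<in> ?N" "\<theta> x = \<theta> y"
      obtain A where A: "A \<in> G" "y = A *v x" by (rule \<theta>_separates_orbits[OF xy(3) that])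
      have "A = mat 1"
      proof (rule ccontr)
        assume "A \<noteq> mat 1"
        then have "A \<in> G - {mat 1}" using A(1) by simp
        then show False using N(3)[of A x y] xy A(2) by blast
      qed
      then show "x = y" using A(2) by simp
    qed
  qed (use U N(2) in auto)
qed

text \<open>Off the discriminant the basic map has local holomorphic inverses; the function is continuous since the map is open,
  so the singularities along the discriminant are removable.\<close>

theorem invariant_holomorphic_descends:
  assumes D: "open D" and F: "holomorphic_several F D" and h: "\<And>z. z \<in> D \<Longrightarrow> h (\<theta> z) = F z"
  shows "holomorphic_several h (\<theta> ` D)"
proof (rule holomorphic_several_removable[OF \<theta>_open_map[OF D] _ \<Delta>_holomorphic _ \<Delta>_direction])
  have contF: "continuous_on D F" by (rule holomorphic_several_continuous_on[OF F])
  show "continuous_on (\<theta> ` D) h"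
    unfolding continuous_on_open_vimage[OF \<theta>_open_map[OF D]]
  proof (intro allI impI)
    fix V :: "complex set" assume V: "open V"
    have "h -` V \<inter> \<theta> ` D = \<theta> ` (F -` V \<inter> D)" using h by auto
    moreover have "open (F -` V \<inter> D)" using contF V unfolding continuous_on_open_vimage[OF D] by blast
    ultimately show "open (h -` V \<inter> \<theta> ` D)" using \<theta>_open_map by simp
  qed
  show "holomorphic_several h {u \<in> \<theta> ` D. \<Delta> u \<noteq> 0}"
    unfolding holomorphic_several_def
  proof
    fix u assume "u \<in> {u \<in> \<theta> ` D. \<Delta> u \<noteq> 0}"
    then obtain z where z: "z \<in> D" "u = \<theta> z" "regular z" using \<Delta>_regular by blast
    obtain N where N: "open N" "z \<in> N" "N \<subseteq> D" "inj_on \<theta> N"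
      by (rule regular_neighbourhood[OF z(3) D z(1) that])
    obtain B where B: "jac z ** B = mat 1" using jac_invertible[OF z(3)] unfolding invertible_def by blast
    let ?g = "inv_into N \<theta>"
    have dg: "(?g has_derivative (*v) B) (at (\<theta> z))"
    proof (rule has_derivative_inverse_strong[OF N(1,2) \<theta>_continuous _ \<theta>_deriv])
      show "?g (\<theta> x) = x" if "x \<in> N" for x by (rule inv_into_f_f[OF N(4) that])
      show "(*v) (jac z) \<circ> (*v) B = id" using B by (simp add: fun_eq_iff flip: mult_vec_assoc)
    qed
    obtain F' where F': "linear_form F'" "(F has_derivative F') (at z)"
      using F z(1) unfolding holomorphic_several_def by blast
    have gz: "?g (\<theta> z) = z" by (rule inv_into_f_f[OF N(4,2)])
    have "((\<lambda>u. F (?g u)) has_derivative (\<lambda>x. F' (B *v x))) (at (\<theta> z))"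
      by (rule has_derivative_compose[OF dg]) (simp only: gz F'(2))
    then have "(h has_derivative (\<lambda>x. F' (B *v x))) (at (\<theta> z))"
    proof (rule has_derivative_transform_within_open[OF _ \<theta>_open_map[OF N(1)]])
      show "\<theta> z \<in> \<theta> ` N" using N(2) by blast
      fix u assume "u \<in> \<theta> ` N"
      then obtain x where "x \<in> N" "u = \<theta> x" by blast
      then show "F (?g u) = h u" using h N(3) inv_into_f_f[OF N(4)] by auto
    qed
    moreover have "linear_form (\<lambda>x. F' (B *v x))"
      using F'(1) by (simp add: linear_form_iff matrix_vector_right_distrib vec.scale)
    ultimately show "\<exists>f'. linear_form f' \<and> (h has_derivative f') (at u)" unfolding z(2) by blast
  qed
qed

end

section \<open>Integration over the quotient\<close>

lemma negligible_proper_subspace: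
  fixes S :: "'a::euclidean_space set"
  assumes "subspace S" "x \<notin> S" shows "negligible S"
proof (rule negligible_lowdim)
  have "dim S \<noteq> DIM('a)"
    using assms by (metis UNIV_I dim_eq_full span_eq_iff)
  then show "dim S < DIM('a)" using dim_subset_UNIV[of S] by simp
qed

lemma set_integral_negligible_diff:
  fixes f :: "complex^'d \<Rightarrow> complex"
  assumes "A \<subseteq> B" "negligible (B - A)"
  shows "set_integrable lebesgue A f \<longleftrightarrow> set_integrable lebesgue B f"
    and "(LINT x:A|lebesgue. f x) = (LINT x:B|lebesgue. f x)"
proof -
  have n: "negligible {x \<in> A - B. f x \<noteq> 0}" "negligible {x \<in> B - A. f x \<noteq> 0}"
    using assms by (auto intro: negligible_subset)
  show iff: "set_integrable lebesgue A f \<longleftrightarrow> set_integrable lebesgue B f"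
    by (rule absolutely_integrable_spike_set_eq[OF n])
  show "(LINT x:A|lebesgue. f x) = (LINT x:B|lebesgue. f x)"
  proof (cases "set_integrable lebesgue A f")
    case True
    then show ?thesis
      using iff integral_spike_set[OF n] by (simp add: set_lebesgue_integral_eq_integral(2))
  next
    case False
    then show ?thesis
      using iff unfolding set_integrable_def set_lebesgue_integral_def
      by (simp add: not_integrable_integral_eq)
  qed
qed

context basic_map
begin

lemma negligible_discriminant: "negligible {z. \<Delta> (\<theta> z) = 0}"
proof -
  obtain I :: "((complex^'d^'d) \<times> (complex^'d^'d)) set" and m where I: "finite I"
    "\<And>i. i \<in> I \<Longrightarrow> linear_form (m i)" "\<And>i. i \<in> I \<Longrightarrow> \<exists>z. m i z \<noteq> 0" "\<And>z. \<Delta> (\<theta> z) = (\<Prod>i\<in>I. m i z)"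
    by (rule \<Delta>_factors[OF that])
  have "negligible {z. m i z = 0}" if i: "i \<in> I" for i
  proof -
    obtain x where x: "m i x \<noteq> 0" using I(3)[OF i] by blast
    have "subspace {z. m i z = 0}"
      unfolding subspace_def using I(2)[OF i]
      by (auto simp: linear_form_zero linear_form_add linear_form_scale scaleR_eq_smult)
    then show ?thesis using x by (intro negligible_proper_subspace[of _ x]) auto
  qed
  then have "negligible (\<Union>i\<in>I. {z. m i z = 0})" using I(1) by (intro negligible_Union) auto
  moreover have "{z. \<Delta> (\<theta> z) = 0} = (\<Union>i\<in>I. {z. m i z = 0})" using I(1,4) by auto
  ultimately show ?thesis by simp
qed

text \<open>A real linear functional whose translates by the group are distinct.\<close>

lemma generic_vector:
  "\<exists>v. \<forall>A\<in>G. \<forall>B\<in>G. A \<noteq> B \<longrightarrow> (\<exists>z. (A *v z) \<bullet> v \<noteq> (B *v z) \<bullet> v)"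
proof -
  have "\<forall>p\<in>{p\<in>G \<times> G. fst p \<noteq> snd p}. \<exists>z. fst p *v z - snd p *v z \<noteq> 0"
    using matrix_eqI by (metis (mono_tags, lifting) mem_Collect_eq right_minus_eq)
  from bchoice[OF this] obtain z where z:
    "\<And>A B. A \<in> G \<Longrightarrow> B \<in> G \<Longrightarrow> A \<noteq> B \<Longrightarrow> A *v z (A, B) - B *v z (A, B) \<noteq> 0" by force
  let ?N = "\<lambda>p. {v. (fst p *v z p - snd p *v z p) \<bullet> v = 0}"
  have "negligible (?N p)" if "p \<in> {p\<in>G \<times> G. fst p \<noteq> snd p}" for p
    using that z[of "fst p" "snd p"] by (intro negligible_hyperplane) auto
  then have "negligible (\<Union>p\<in>{p\<in>G \<times> G. fst p \<noteq> snd p}. ?N p)"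
    using fin by (intro negligible_Union) auto
  then have "(\<Union>p\<in>{p\<in>G \<times> G. fst p \<noteq> snd p}. ?N p) \<noteq> UNIV" using non_negligible_UNIV by metis
  then obtain v where v: "v \<notin> (\<Union>p\<in>{p\<in>G \<times> G. fst p \<noteq> snd p}. ?N p)" by blast
  have "(A *v z (A, B)) \<bullet> v \<noteq> (B *v z (A, B)) \<bullet> v" if "A \<in> G" "B \<in> G" "A \<noteq> B" for A B
    using v that by (force simp: inner_diff_left)
  then show ?thesis by blast
qed

text \<open>The points at which a generic real linear functional is strictly smaller than at the other points of
  the orbit form an open fundamental domain.\<close>

lemma fundamental_domain:
  assumes D: "open D" and GD: "\<And>A z. A \<in> G \<Longrightarrow> z \<in> D \<Longrightarrow> A *v z \<in> D"
  obtains S where "open S" "S \<subseteq> D" "inj_on \<theta> S" "\<And>z. z \<in> S \<Longrightarrow> regular z"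
    "disjoint_family_on (\<lambda>B. (*v) B ` S) G" "negligible (D - (\<Union>B\<in>G. (*v) B ` S))"
proof -
  obtain v where v: "\<And>A B. A \<in> G \<Longrightarrow> B \<in> G \<Longrightarrow> A \<noteq> B \<Longrightarrow> \<exists>z. (A *v z) \<bullet> v \<noteq> (B *v z) \<bullet> v"
    using generic_vector by blast
  define S where "S = {z \<in> D. \<Delta> (\<theta> z) \<noteq> 0 \<and> (\<forall>A\<in>G - {mat 1}. z \<bullet> v < (A *v z) \<bullet> v)}"
  have "S = D \<inter> {z. \<Delta> (\<theta> z) \<noteq> 0} \<inter> (\<Inter>A\<in>G - {mat 1}. {z. z \<bullet> v < (A *v z) \<bullet> v})"
    by (auto simp: S_def)
  moreover have "open {z. \<Delta> (\<theta> z) \<noteq> 0}"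
    by (intro open_Collect_neq continuous_on_const
        continuous_on_compose2[OF holomorphic_several_continuous_on[OF \<Delta>_holomorphic] \<theta>_continuous]) auto
  moreover have "open {z. z \<bullet> v < (A *v z) \<bullet> v}" for A
    by (intro open_Collect_less continuous_intros)
  ultimately have openS: "open S"
    using D fin by (auto intro!: open_Int open_INT)
  have reg: "regular z" if "z \<in> S" for z using that \<Delta>_regular by (simp add: S_def)
  have inj: "inj_on \<theta> S"
  proof (rule inj_onI)
    fix z w assume zw: "z \<in> S" "w \<in> S" "\<theta> z = \<theta> w"
    obtain A where A: "A \<in> G" "w = A *v z" by (rule \<theta>_separates_orbits[OF zw(3) that])
    have "A = mat 1"
    proof (rule ccontr)
      assume ne: "A \<noteq> mat 1"
      then have "iv A \<noteq> mat 1" using iv_mult[OF A(1)] by force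
      then have "w \<bullet> v < (iv A *v w) \<bullet> v" using zw(2) iv_in[OF A(1)] by (simp add: S_def)
      moreover have "z \<bullet> v < (A *v z) \<bullet> v" using zw(1) A(1) ne by (simp add: S_def)
      ultimately show False by (simp add: A(2) iv_mult_vec[OF A(1)])
    qed
    then show "z = w" using A(2) by simp
  qed
  have disj: "disjoint_family_on (\<lambda>B. (*v) B ` S) G"
    unfolding disjoint_family_on_def
  proof (intro ballI impI, rule ccontr)
    fix B C assume BC: "B \<in> G" "C \<in> G" "B \<noteq> C" "(*v) B ` S \<inter> (*v) C ` S \<noteq> {}"
    then obtain s t where st: "s \<in> S" "t \<in> S" "B *v s = C *v t" by blast
    have "\<theta> s = \<theta> t" using st(3) \<theta>_invariant[OF BC(1), of s] \<theta>_invariant[OF BC(2), of t] by simp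
    then have "s = t" using inj_onD[OF inj _ st(1,2)] by simp
    then have "(iv C ** B) *v s = s" using st(3) by (simp add: mult_vec_assoc iv_mult_vec[OF BC(2)])
    then have "iv C ** B = mat 1"
      using reg[OF st(1)] mult_in[OF iv_in[OF BC(2)] BC(1)] unfolding regular_def by blast
    then have "C ** (iv C ** B) = C" by simp
    then have "B = C" using iv_mult[OF BC(2)] by (simp add: matrix_mul_assoc)
    then show False using BC(3) by simp
  qed
  let ?P = "{p\<in>G \<times> G. fst p \<noteq> snd p}"
  let ?N = "\<lambda>p. {z. (fst p *v z) \<bullet> v = (snd p *v z) \<bullet> v}"
  have cover: "D - (\<Union>B\<in>G. (*v) B ` S) \<subseteq> {z. \<Delta> (\<theta> z) = 0} \<union> (\<Union>p\<in>?P. ?N p)"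
  proof (rule subsetI, rule ccontr)
    fix z assume z: "z \<in> D - (\<Union>B\<in>G. (*v) B ` S)" "z \<notin> {z. \<Delta> (\<theta> z) = 0} \<union> (\<Union>p\<in>?P. ?N p)"
    then have dz: "\<Delta> (\<theta> z) \<noteq> 0" by simp
    have ne: "(A *v z) \<bullet> v \<noteq> (B *v z) \<bullet> v" if "A \<in> G" "B \<in> G" "A \<noteq> B" for A B
    proof
      assume "(A *v z) \<bullet> v = (B *v z) \<bullet> v"
      then have "z \<in> ?N (A, B)" "(A, B) \<in> ?P" using that by auto
      then show False using z(2) by blast
    qed
    have "Min ((\<lambda>A. (A *v z) \<bullet> v) ` G) \<in> (\<lambda>A. (A *v z) \<bullet> v) ` G"
      using fin one_in by (intro Min_in) auto
    then obtain B where B: "B \<in> G" "Min ((\<lambda>A. (A *v z) \<bullet> v) ` G) = (B *v z) \<bullet> v" by blast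
    \<comment> \<open>The orbit point at which the functional is minimal is unique, and it lies in \<open>S\<close>.\<close>
    have le: "(B *v z) \<bullet> v \<le> (A *v z) \<bullet> v" if "A \<in> G" for A
      unfolding B(2)[symmetric] using fin that by (intro Min_le) auto
    have "(B *v z) \<bullet> v < (A *v (B *v z)) \<bullet> v" if A: "A \<in> G - {mat 1}" for A
    proof -
      have AB: "A ** B \<in> G" using A B(1) mult_in by blast
      have "A ** B \<noteq> B"
      proof
        assume "A ** B = B"
        then have "A ** B ** iv B = B ** iv B" by simp
        then have "A = mat 1" using iv_mult[OF B(1)] by (simp flip: matrix_mul_assoc)
        then show False using A by simp
      qed
      then show ?thesis using le[OF AB] ne[OF AB B(1)] by (simp add: mult_vec_assoc)
    qed
    moreover have "B *v z \<in> D" using GD[OF B(1)] z(1) by blast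
    ultimately have "B *v z \<in> S" using dz by (simp add: S_def \<theta>_invariant[OF B(1)])
    then have "iv B *v (B *v z) \<in> (*v) (iv B) ` S" by blast
    then have "z \<in> (*v) (iv B) ` S" by (simp add: iv_mult_vec[OF B(1)])
    then show False using z(1) iv_in[OF B(1)] by blast
  qed
  have "negligible (?N p)" if p: "p \<in> ?P" for p
  proof -
    obtain x where "(fst p *v x) \<bullet> v \<noteq> (snd p *v x) \<bullet> v" using v[of "fst p" "snd p"] p by auto
    moreover have "subspace (?N p)"
      unfolding subspace_def by (auto simp: matrix_vector_right_distrib inner_add_left scaleR_eq_smult vec.scale)
        (metis inner_scaleR_left scaleR_eq_smult)
    ultimately show ?thesis by (intro negligible_proper_subspace[of _ x]) auto
  qed
  then have "negligible (\<Union>p\<in>?P. ?N p)" using fin by (intro negligible_Union) auto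
  then have "negligible (D - (\<Union>B\<in>G. (*v) B ` S))"
    using negligible_subset[OF negligible_Un[OF negligible_discriminant] cover] by blast
  moreover have "S \<subseteq> D" by (auto simp: S_def)
  ultimately show ?thesis using openS inj reg disj by (intro that[of S])
qed

text \<open>The basic map is injective on each translate of the fundamental domain, and all translates have the
  same image.\<close>

theorem integral_over_quotient:
  fixes F :: "complex^'d \<Rightarrow> complex"
  assumes D: "open D" and GD: "\<And>A z. A \<in> G \<Longrightarrow> z \<in> D \<Longrightarrow> A *v z \<in> D"
  shows "set_integrable lebesgue (\<theta> ` D) F \<longleftrightarrow>
      set_integrable lebesgue D (\<lambda>z. of_real ((cmod (jacobian_det \<theta> z))\<^sup>2) * F (\<theta> z))" (is "_ \<longleftrightarrow> set_integrable _ _ ?g")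
    and "(LINT z:D|lebesgue. of_real ((cmod (jacobian_det \<theta> z))\<^sup>2) * F (\<theta> z)) =
      of_nat (card G) * (LINT u:\<theta> ` D|lebesgue. F u)"
proof -
  obtain S where S: "open S" "S \<subseteq> D" "inj_on \<theta> S" "\<And>z. z \<in> S \<Longrightarrow> regular z"
    "disjoint_family_on (\<lambda>B. (*v) B ` S) G" "negligible (D - (\<Union>B\<in>G. (*v) B ` S))"
    by (rule fundamental_domain[OF D GD that])
  have imB: "\<theta> ` (*v) B ` S = \<theta> ` S" if "B \<in> G" for B
    using \<theta>_invariant[OF that] by (simp add: image_image)
  have vim: "(*v) B ` S = (\<lambda>z. iv B *v z) -` S" if B: "B \<in> G" for B
  proof
    show "(*v) B ` S \<subseteq> (\<lambda>z. iv B *v z) -` S" by (auto simp: iv_mult_vec[OF B])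
    show "(\<lambda>z. iv B *v z) -` S \<subseteq> (*v) B ` S"
    proof
      fix x assume "x \<in> (\<lambda>z. iv B *v z) -` S"
      then show "x \<in> (*v) B ` S" by (intro image_eqI[of _ _ "iv B *v x"]) (simp_all add: iv_mult_vec[OF B])
    qed
  qed
  have openB: "open ((*v) B ` S)" if B: "B \<in> G" for B
    unfolding vim[OF B] by (rule open_vimage[OF S(1)]) (intro continuous_intros)
  have meas: "(*v) B ` S \<in> sets lebesgue" if B: "B \<in> G" for B
    using openB[OF B] by simp
  have regB: "regular (B *v s)" if B: "B \<in> G" and s: "s \<in> S" for B s
    unfolding regular_def
  proof (intro ballI impI)
    fix A assume A: "A \<in> G" "A *v (B *v s) = B *v s"
    then have "(iv B ** (A ** B)) *v s = s" by (simp add: mult_vec_assoc iv_mult_vec[OF B])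
    then have "iv B ** (A ** B) = mat 1"
      using S(4)[OF s] mult_in[OF iv_in[OF B] mult_in[OF A(1) B]] unfolding regular_def by blast
    then have "B ** (iv B ** (A ** B)) ** iv B = B ** iv B" by simp
    moreover have "B ** (iv B ** (A ** B)) ** iv B = A"
      using iv_mult[OF B] by (metis matrix_mul_assoc matrix_mul_lid matrix_mul_rid)
    ultimately show "A = mat 1" using iv_mult[OF B] by simp
  qed
  have injB: "inj_on \<theta> ((*v) B ` S)" if B: "B \<in> G" for B
  proof (rule inj_onI)
    fix x y assume "x \<in> (*v) B ` S" "y \<in> (*v) B ` S" and eq: "\<theta> x = \<theta> y"
    then obtain s t where st: "x = B *v s" "y = B *v t" "s \<in> S" "t \<in> S" by blast
    then have "\<theta> s = \<theta> t" using eq \<theta>_invariant[OF B] by simp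
    then show "x = y" using inj_onD[OF S(3) _ st(3,4)] st by simp
  qed
  have cov: "set_integrable lebesgue (\<theta> ` S) F \<longleftrightarrow> set_integrable lebesgue ((*v) B ` S) ?g"
      "(LINT u:\<theta> ` S|lebesgue. F u) = (LINT z:(*v) B ` S|lebesgue. ?g z)" if B: "B \<in> G" for B
  proof -
    have inv: "invertible (jac x)" if "x \<in> (*v) B ` S" for x
      using that regB[OF B] jac_invertible by blast
    show "set_integrable lebesgue (\<theta> ` S) F \<longleftrightarrow> set_integrable lebesgue ((*v) B ` S) ?g"
      "(LINT u:\<theta> ` S|lebesgue. F u) = (LINT z:(*v) B ` S|lebesgue. ?g z)"
      using change_of_variables_complex[where F = F, OF meas[OF B] \<theta>_deriv inv injB[OF B]]
      unfolding imB[OF B] jacobian_det_eq by simp_all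
  qed
  let ?U = "\<Union>B\<in>G. (*v) B ` S"
  have UD: "?U \<subseteq> D" using S(2) GD by blast
  have nD: "set_integrable lebesgue ?U ?g \<longleftrightarrow> set_integrable lebesgue D ?g"
      "(LINT z:?U|lebesgue. ?g z) = (LINT z:D|lebesgue. ?g z)"
    by (rule set_integral_negligible_diff[OF UD S(6)])+
  have "\<theta> ` D - \<theta> ` S \<subseteq> \<theta> ` (D - ?U)"
  proof
    fix u assume u: "u \<in> \<theta> ` D - \<theta> ` S"
    then obtain z where z: "z \<in> D" "u = \<theta> z" by blast
    have "z \<notin> ?U"
    proof
      assume "z \<in> ?U"
      then obtain B s where "B \<in> G" "s \<in> S" "z = B *v s" by blast
      then show False using u z \<theta>_invariant[of B s] by auto
    qed
    then show "u \<in> \<theta> ` (D - ?U)" using z by blast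
  qed
  moreover have "negligible (\<theta> ` (D - ?U))"
  proof (rule negligible_differentiable_image_negligible[OF _ S(6)])
    show "\<theta> differentiable_on (D - ?U)"
      unfolding differentiable_on_def differentiable_def
      using \<theta>_deriv has_derivative_at_withinI by blast
  qed simp
  ultimately have nt: "negligible (\<theta> ` D - \<theta> ` S)" by (rule negligible_subset[rotated])
  have nS: "set_integrable lebesgue (\<theta> ` S) F \<longleftrightarrow> set_integrable lebesgue (\<theta> ` D) F"
      "(LINT u:\<theta> ` S|lebesgue. F u) = (LINT u:\<theta> ` D|lebesgue. F u)"
    by (rule set_integral_negligible_diff[OF image_mono[OF S(2)] nt])+
  have iff: "set_integrable lebesgue (\<theta> ` S) F \<longleftrightarrow> set_integrable lebesgue ?U ?g"
  proof
    assume "set_integrable lebesgue (\<theta> ` S) F"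
    then show "set_integrable lebesgue ?U ?g"
      using cov(1) meas fin by (intro set_integrable_UN) auto
  next
    assume "set_integrable lebesgue ?U ?g"
    then have "set_integrable lebesgue ((*v) (mat 1) ` S) ?g"
      by (rule set_integrable_subset) (use S(1) one_in in auto)
    then show "set_integrable lebesgue (\<theta> ` S) F" using cov(1)[OF one_in] by blast
  qed
  show main: "set_integrable lebesgue (\<theta> ` D) F \<longleftrightarrow> set_integrable lebesgue D ?g"
    using iff nS(1) nD(1) by blast
  show "(LINT z:D|lebesgue. ?g z) = of_nat (card G) * (LINT u:\<theta> ` D|lebesgue. F u)"
  proof (cases "set_integrable lebesgue D ?g")
    case True
    then have i: "set_integrable lebesgue ((*v) B ` S) ?g" if "B \<in> G" for B
      using cov(1)[OF that] iff nD(1) by blast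
    have "(LINT z:?U|lebesgue. ?g z) = (\<Sum>B\<in>G. LINT z:(*v) B ` S|lebesgue. ?g z)"
      by (rule set_integral_finite_Union[OF fin S(5) i meas])
    also have "\<dots> = (\<Sum>B\<in>G. LINT u:\<theta> ` S|lebesgue. F u)"
      by (intro sum.cong refl cov(2)[symmetric])
    finally show ?thesis unfolding nD(2) nS(2) by simp
  next
    case False
    then have "\<not> set_integrable lebesgue (\<theta> ` D) F" using main by blast
    with False show ?thesis
      unfolding set_integrable_def set_lebesgue_integral_def
      by (simp add: not_integrable_integral_eq)
  qed
qed

end

section \<open>The Bergman space of the quotient\<close>

locale reflection_quotient = reflection_group G \<rho> a l + basic_map G \<theta>
  for G :: "(complex^'d^'d) set" and \<rho> a l and \<theta> :: "complex^'d \<Rightarrow> complex^'d" +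
  fixes \<Omega> :: "(complex^'d) set" and \<omega>t :: "complex^'d \<Rightarrow> real"
  assumes open_\<Omega>: "open \<Omega>" and nonempty_\<Omega>: "\<Omega> \<noteq> {}" and bounded_\<Omega>: "bounded \<Omega>"
    and G\<Omega>: "\<And>A z. A \<in> G \<Longrightarrow> z \<in> \<Omega> \<Longrightarrow> A *v z \<in> \<Omega>"
    and cont_\<omega>t: "continuous_on (\<theta> ` \<Omega>) \<omega>t" and pos_\<omega>t: "\<And>u. u \<in> \<theta> ` \<Omega> \<Longrightarrow> \<omega>t u > 0"
begin

abbreviation "\<omega> \<equiv> \<omega>t \<circ> \<theta>"
abbreviation "\<omega>\<rho> \<equiv> rep_weight G \<Omega> \<theta> L \<omega>t"

lemma measure_\<Omega>: "0 < measure lebesgue \<Omega>"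
proof -
  have "\<Omega> \<in> lmeasurable" using open_\<Omega> bounded_\<Omega> by (simp add: lmeasurable_open)
  moreover have "\<not> negligible \<Omega>" using open_not_negligible[OF open_\<Omega> nonempty_\<Omega>] .
  ultimately show ?thesis by (simp add: negligible_iff_measure zero_less_measure_iff)
qed

sublocale weighted_domain \<Omega> \<Omega> \<omega>
proof
  show "0 < measure lebesgue \<Omega>" by (rule measure_\<Omega>)
  show "open \<Omega>" by (rule open_\<Omega>)
  show "continuous_on \<Omega> \<omega>" by (rule continuous_on_compose[OF \<theta>_continuous cont_\<omega>t])
  show "\<omega> z > 0" if "z \<in> \<Omega>" for z using pos_\<omega>t that by simp
qed

abbreviation "R \<equiv> relative_invariant_subspace G \<rho> (dV \<Omega>) \<Omega> \<omega>"
abbreviation "A2q \<equiv> bergman_space (dV \<Omega>) (\<theta> ` \<Omega>) \<omega>\<rho>"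
abbreviation "ipq \<equiv> bergman_inner (dV \<Omega>) (\<theta> ` \<Omega>) \<omega>\<rho>"

lemma G\<Omega>_iff: "A \<in> G \<Longrightarrow> A *v z \<in> \<Omega> \<longleftrightarrow> z \<in> \<Omega>"
  using G\<Omega>[of A z] G\<Omega>[OF iv_in, of A "A *v z"] iv_mult_vec(1)[of A z] by auto

lemma R_iff: "f \<in> R \<longleftrightarrow> f \<in> A2 \<and> (\<forall>A\<in>G. \<forall>z\<in>\<Omega>. f (A *v z) = \<rho> A * f z)"
  unfolding relative_invariant_subspace_def by (auto simp: act_fun_eq)

lemma R_A2: "f \<in> R \<Longrightarrow> f \<in> A2" and R_invariant: "f \<in> R \<Longrightarrow> A \<in> G \<Longrightarrow> z \<in> \<Omega> \<Longrightarrow> f (A *v z) = \<rho> A * f z"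
  by (auto simp: R_iff)

lemma R_add: "f \<in> R \<Longrightarrow> g \<in> R \<Longrightarrow> (\<lambda>z. f z + g z) \<in> R"
  by (simp add: R_iff space_add distrib_left)

lemma R_scale: "f \<in> R \<Longrightarrow> (\<lambda>z. c * f z) \<in> R"
  by (simp add: R_iff space_scale mult.left_commute)

lemma R_null: "(\<lambda>z. 0) \<in> R"
  by (simp add: R_iff space_null)

lemma R_diff: "f \<in> R \<Longrightarrow> g \<in> R \<Longrightarrow> (\<lambda>z. f z - g z) \<in> R"
  by (simp add: R_iff space_diff right_diff_distrib)

lemma regular_off_hyperplanes:
  assumes reg: "regular z" shows "\<theta> z \<notin> \<theta> ` \<Union>hyps"
proof
  assume "\<theta> z \<in> \<theta> ` \<Union>hyps"
  then obtain H y where y: "H \<in> hyps" "y \<in> H" "\<theta> z = \<theta> y" by blast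
  obtain \<sigma> where \<sigma>: "\<sigma> \<in> G" "complex_reflection \<sigma>" "H = {z. (mat 1 - \<sigma>) *v z = 0}"
    using y(1) unfolding reflecting_hyperplanes_def by blast
  obtain A where A: "A \<in> G" "y = A *v z" by (rule \<theta>_separates_orbits[OF y(3) that])
  have "\<sigma> *v (A *v z) = A *v z"
    using y(2) \<sigma>(3) A(2) by (simp add: matrix_vector_mult_diff_rdistrib)
  then have "(iv A ** (\<sigma> ** A)) *v z = z" by (simp add: mult_vec_assoc iv_mult_vec[OF A(1)])
  then have "iv A ** (\<sigma> ** A) = mat 1"
    using reg mult_in[OF iv_in[OF A(1)] mult_in[OF \<sigma>(1) A(1)]] unfolding regular_def by blast
  then have "A ** (iv A ** (\<sigma> ** A)) ** iv A = A ** iv A" by simp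
  moreover have "A ** (iv A ** (\<sigma> ** A)) ** iv A = \<sigma>"
    using iv_mult[OF A(1)] by (metis matrix_mul_assoc matrix_mul_lid matrix_mul_rid)
  ultimately have "\<sigma> = mat 1" using iv_mult[OF A(1)] by simp
  then show False using \<sigma>(2) unfolding complex_reflection_def by (simp add: rank_zero)
qed

text \<open>The weight is defined by a choice of preimage. Any other choice lies in the same orbit, where \<open>|L|\<close> and the modulus of the
  Jacobian determinant take the same values.\<close>

lemma weight_regular:
  assumes z: "z \<in> \<Omega>" and reg: "regular z"
  shows "\<omega>\<rho> (\<theta> z) = (cmod (L z))\<^sup>2 / (cmod (jacobian_det \<theta> z))\<^sup>2 * \<omega>t (\<theta> z)"
proof -
  define y where "y = (SOME y. y \<in> \<Omega> \<and> \<theta> y = \<theta> z)"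
  have y: "y \<in> \<Omega>" "\<theta> y = \<theta> z"
    using someI[of "\<lambda>y. y \<in> \<Omega> \<and> \<theta> y = \<theta> z" z] z unfolding y_def by auto
  obtain A where A: "A \<in> G" "y = A *v z" by (rule \<theta>_separates_orbits[OF y(2)[symmetric] that])
  have "cmod (L y) = cmod (L z)"
    by (simp add: A L_semi_invariant norm_mult \<rho>_norm)
  moreover have "cmod (jacobian_det \<theta> y) = cmod (jacobian_det \<theta> z)"
    by (simp add: A jacobian_det_norm)
  ultimately show ?thesis
    unfolding rep_weight_def using z regular_off_hyperplanes[OF reg]
    by (simp add: Let_def flip: y_def)
qed

text \<open>The Jacobian in the weight cancels against the one from the change of variables.\<close>

lemma weighted_integral_over_quotient:
  fixes Q :: "complex^'d \<Rightarrow> complex"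
  shows "set_integrable lebesgue (\<theta> ` \<Omega>) (\<lambda>u. Q u * of_real (\<omega>\<rho> u)) \<longleftrightarrow>
      set_integrable lebesgue \<Omega> (\<lambda>z. Q (\<theta> z) * of_real ((cmod (L z))\<^sup>2 * \<omega> z))" (is "_ \<longleftrightarrow> set_integrable _ _ ?q")
    and "(LINT z:\<Omega>|lebesgue. Q (\<theta> z) * of_real ((cmod (L z))\<^sup>2 * \<omega> z)) =
      of_nat (card G) * (LINT u:\<theta> ` \<Omega>|lebesgue. Q u * of_real (\<omega>\<rho> u))"
proof -
  let ?g = "\<lambda>z. of_real ((cmod (jacobian_det \<theta> z))\<^sup>2) * (Q (\<theta> z) * of_real (\<omega>\<rho> (\<theta> z)))"
  let ?S = "\<Omega> - {z. \<Delta> (\<theta> z) = 0}"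
  have n: "negligible (\<Omega> - ?S)" by (rule negligible_subset[OF negligible_discriminant]) auto
  have S: "?S \<subseteq> \<Omega>" by blast
  have "?g z = ?q z" if "z \<in> ?S" for z
  proof -
    have reg: "regular z" using that \<Delta>_regular by blast
    have "jacobian_det \<theta> z \<noteq> 0"
      using jac_invertible[OF reg] by (simp add: jacobian_det_eq invertible_det_nz)
    then have X: "(cmod (jacobian_det \<theta> z))\<^sup>2 * \<omega>\<rho> (\<theta> z) = (cmod (L z))\<^sup>2 * \<omega> z"
      using weight_regular[OF _ reg] that by simp
    have "?g z = Q (\<theta> z) * of_real ((cmod (jacobian_det \<theta> z))\<^sup>2 * \<omega>\<rho> (\<theta> z))"
      by (simp only: of_real_mult mult.left_commute)
    then show ?thesis by (simp only: X)
  qed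
  then have e: "(\<lambda>z. indicator ?S z *\<^sub>R ?g z) = (\<lambda>z. indicator ?S z *\<^sub>R ?q z)"
    by (auto simp: fun_eq_iff indicator_def)
  have c: "set_integrable lebesgue ?S ?g \<longleftrightarrow> set_integrable lebesgue ?S ?q"
      "(LINT z:?S|lebesgue. ?g z) = (LINT z:?S|lebesgue. ?q z)"
    unfolding set_integrable_def set_lebesgue_integral_def e by (rule refl)+
  note d = set_integral_negligible_diff[OF S n] and o = integral_over_quotient[OF open_\<Omega> G\<Omega>, where F = "\<lambda>u. Q u * of_real (\<omega>\<rho> u)"]
  show "set_integrable lebesgue (\<theta> ` \<Omega>) (\<lambda>u. Q u * of_real (\<omega>\<rho> u)) \<longleftrightarrow> set_integrable lebesgue \<Omega> ?q"
    using o(1) d(1)[of ?g] d(1)[of ?q] c(1) by blast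
  show "(LINT z:\<Omega>|lebesgue. ?q z) = of_nat (card G) * (LINT u:\<theta> ` \<Omega>|lebesgue. Q u * of_real (\<omega>\<rho> u))"
    using o(2) d(2)[of ?g] d(2)[of ?q] c(2) by simp
qed

text \<open>The unitary map onto the relative invariants. The square root compensates for the \<open>|G|\<close> preimages of a generic point, and
  functions in a Bergman space are \<open>0\<close> outside the domain.\<close>

definition lift :: "(complex^'d \<Rightarrow> complex) \<Rightarrow> complex^'d \<Rightarrow> complex" where
  "lift h z = (if z \<in> \<Omega> then L z * h (\<theta> z) / of_real (sqrt (card G)) else 0)"

abbreviation "s \<equiv> complex_of_real (sqrt (card G))"

lemma s: "s \<noteq> 0" "s * s = of_nat (card G)" "cnj s = s" "cmod s ^ 2 = card G"
  using card_pos by (auto simp flip: of_real_mult)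

lemma set_integrable_of_real_iff:
  "set_integrable lebesgue A f \<longleftrightarrow> set_integrable lebesgue A (\<lambda>x. complex_of_real (f x))"
  for f :: "complex^'d \<Rightarrow> real"
  using set_integral_bounded_linear_iso(1)[OF bounded_linear_of_real bounded_linear_Re, of lebesgue A f] by simp

lemma lift_integrable:
  "set_integrable (dV \<Omega>) (\<theta> ` \<Omega>) (\<lambda>u. (cmod (h u))\<^sup>2 * \<omega>\<rho> u) \<longleftrightarrow>
    set_integrable lebesgue \<Omega> (\<lambda>z. (cmod (lift h z))\<^sup>2 * \<omega> z)"
proof -
  have "set_integrable (dV \<Omega>) (\<theta> ` \<Omega>) (\<lambda>u. (cmod (h u))\<^sup>2 * \<omega>\<rho> u) \<longleftrightarrow>
      set_integrable lebesgue (\<theta> ` \<Omega>) (\<lambda>u. complex_of_real ((cmod (h u))\<^sup>2) * of_real (\<omega>\<rho> u))"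
    unfolding set_integral_dV(1)[OF measure_\<Omega>] set_integrable_of_real_iff by simp
  also have "\<dots> \<longleftrightarrow> set_integrable lebesgue \<Omega> (\<lambda>z. complex_of_real ((cmod (h (\<theta> z)))\<^sup>2) * of_real ((cmod (L z))\<^sup>2 * \<omega> z))"
    by (rule weighted_integral_over_quotient(1))
  also have "\<dots> \<longleftrightarrow> set_integrable lebesgue \<Omega> (\<lambda>z. real (card G) * ((cmod (lift h z))\<^sup>2 * \<omega> z))"
  proof -
    have "(cmod (h (\<theta> z)))\<^sup>2 * ((cmod (L z))\<^sup>2 * \<omega> z) = real (card G) * ((cmod (lift h z))\<^sup>2 * \<omega> z)" if "z \<in> \<Omega>" for z
      using that card_pos by (simp add: lift_def norm_mult norm_divide power_mult_distrib power_divide)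
    then have "(\<lambda>z. indicator \<Omega> z *\<^sub>R ((cmod (h (\<theta> z)))\<^sup>2 * ((cmod (L z))\<^sup>2 * \<omega> z))) =
        (\<lambda>z. indicator \<Omega> z *\<^sub>R (real (card G) * ((cmod (lift h z))\<^sup>2 * \<omega> z)))"
      by (auto simp: fun_eq_iff indicator_def)
    then show ?thesis
      unfolding of_real_mult[symmetric] set_integrable_of_real_iff[symmetric]
      unfolding set_integrable_def by (simp only:)
  qed
  also have "\<dots> \<longleftrightarrow> set_integrable lebesgue \<Omega> (\<lambda>z. (cmod (lift h z))\<^sup>2 * \<omega> z)"
    using card_pos by simp
  finally show ?thesis .
qed

lemma lift_inner: "ip (lift h) (lift k) = ipq h k"
proof -
  let ?Q = "\<lambda>u. h u * cnj (k u)"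
  have "(\<lambda>z. indicator \<Omega> z *\<^sub>R (lift h z * cnj (lift k z) * of_real (\<omega> z))) =
      (\<lambda>z. indicator \<Omega> z *\<^sub>R ((1 / of_nat (card G)) * (?Q (\<theta> z) * of_real ((cmod (L z))\<^sup>2 * \<omega> z))))"
  proof
    fix z
    show "indicator \<Omega> z *\<^sub>R (lift h z * cnj (lift k z) * of_real (\<omega> z)) =
      indicator \<Omega> z *\<^sub>R ((1 / of_nat (card G)) * (?Q (\<theta> z) * of_real ((cmod (L z))\<^sup>2 * \<omega> z)))"
    proof (cases "z \<in> \<Omega>")
      case True
      have "lift h z * cnj (lift k z) = (L z * cnj (L z)) * ?Q (\<theta> z) / (s * s)"
        using True by (simp add: lift_def s(3))
      also have "\<dots> = (1 / of_nat (card G)) * (?Q (\<theta> z) * of_real ((cmod (L z))\<^sup>2))"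
        by (simp only: s(2) complex_norm_square) simp
      finally show ?thesis by simp
    qed simp
  qed
  then have "(LINT z:\<Omega>|lebesgue. lift h z * cnj (lift k z) * of_real (\<omega> z)) =
      (LINT z:\<Omega>|lebesgue. (1 / of_nat (card G)) * (?Q (\<theta> z) * of_real ((cmod (L z))\<^sup>2 * \<omega> z)))"
    unfolding set_lebesgue_integral_def by (simp only:)
  also have "\<dots> = (1 / of_nat (card G)) * (LINT z:\<Omega>|lebesgue. ?Q (\<theta> z) * of_real ((cmod (L z))\<^sup>2 * \<omega> z))"
    by (rule set_integral_mult_right)
  also have "\<dots> = (LINT u:\<theta> ` \<Omega>|lebesgue. ?Q u * of_real (\<omega>\<rho> u))"
    unfolding weighted_integral_over_quotient(2)[of ?Q] using card_pos by simp
  finally show ?thesis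
    unfolding bergman_inner_def set_integral_dV(2)[OF measure_\<Omega>] by simp
qed

lemma quotient_holomorphic_compose:
  assumes "holomorphic_several h (\<theta> ` \<Omega>)" shows "holomorphic_several (\<lambda>z. h (\<theta> z)) \<Omega>"
  by (rule holomorphic_several_compose[OF assms \<theta>_holomorphic]) simp

lemma lift_in_R: assumes h: "h \<in> A2q" shows "lift h \<in> R"
proof -
  have hol: "holomorphic_several h (\<theta> ` \<Omega>)" using h by (simp add: bergman_space_def)
  have "holomorphic_several (\<lambda>z. L z * h (\<theta> z) * (1 / s)) \<Omega>"
    by (intro holomorphic_several_mult L_holomorphic quotient_holomorphic_compose hol) simp
  then have "holomorphic_several (lift h) \<Omega>"
    by (rule holomorphic_several_transform[OF _ open_\<Omega>]) (simp add: lift_def)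
  moreover have "set_integrable lebesgue \<Omega> (\<lambda>z. (cmod (lift h z))\<^sup>2 * \<omega> z)"
    using h lift_integrable[of h] by (simp add: bergman_space_def)
  ultimately have "lift h \<in> A2" unfolding space_iff by (simp add: lift_def)
  moreover have "lift h (A *v z) = \<rho> A * lift h z" if "A \<in> G" "z \<in> \<Omega>" for A z
    using that G\<Omega>[OF that] by (simp add: lift_def L_semi_invariant \<theta>_invariant)
  ultimately show ?thesis by (simp add: R_iff)
qed

text \<open>The polynomial \<open>L\<close> is nonzero on a dense set.\<close>

lemma lift_injective:
  assumes h: "h \<in> A2q" and k: "k \<in> A2q" and eq: "lift h = lift k" shows "h = k"
proof
  fix u
  show "h u = k u"
  proof (cases "u \<in> \<theta> ` \<Omega>")
    case False
    then show ?thesis using h k by (simp add: bergman_space_def)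
  next
    case True
    then obtain z where z: "z \<in> \<Omega>" "u = \<theta> z" by blast
    obtain v where v: "\<And>p. \<forall>\<^sub>F t in at 0. L (p + t *s v) \<noteq> 0" using L_generic_direction by blast
    have "h (\<theta> z) = k (\<theta> z)"
    proof (rule continuous_eq_on_line[where v = v, OF open_\<Omega> z(1)])
      show "continuous_on \<Omega> (\<lambda>z. h (\<theta> z))" "continuous_on \<Omega> (\<lambda>z. k (\<theta> z))"
        using h k by (auto intro!: holomorphic_several_continuous_on quotient_holomorphic_compose simp: bergman_space_def)
      show "\<forall>\<^sub>F t in at 0. z + t *s v \<in> \<Omega> \<longrightarrow> h (\<theta> (z + t *s v)) = k (\<theta> (z + t *s v))"
        using v[of z]
      proof eventually_elim
        case (elim t)
        let ?x = "z + t *s v"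
        show ?case
        proof
          assume "?x \<in> \<Omega>"
          then have "L ?x * h (\<theta> ?x) / s = L ?x * k (\<theta> ?x) / s"
            using fun_cong[OF eq, of ?x] by (simp only: lift_def if_True)
          then have "L ?x * h (\<theta> ?x) = L ?x * k (\<theta> ?x)"
            unfolding divide_cancel_right using s(1) by blast
          then show "h (\<theta> ?x) = k (\<theta> ?x)" using elim unfolding mult_cancel_left by blast
        qed
      qed
    qed
    then show ?thesis using z(2) by simp
  qed
qed

text \<open>The quotient by \<open>L\<close> is constant on the orbits, so it descends to a function on the image of \<open>\<theta>\<close>.\<close>

lemma lift_surjective: assumes f: "f \<in> R" shows "\<exists>h\<in>A2q. lift h = f"
proof -
  obtain g where g: "holomorphic_several g \<Omega>" "\<And>z. z \<in> \<Omega> \<Longrightarrow> f z = L z * g z"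
    "\<And>A z. A \<in> G \<Longrightarrow> z \<in> \<Omega> \<Longrightarrow> g (A *v z) = g z"
    by (rule relative_invariant_divisible[OF open_\<Omega> G\<Omega> space_holomorphic[OF R_A2[OF f]] R_invariant[OF f] that])
  define h where "h u = (if u \<in> \<theta> ` \<Omega> then s * g (SOME z. z \<in> \<Omega> \<and> \<theta> z = u) else 0)" for u
  have h\<theta>: "h (\<theta> z) = s * g z" if z: "z \<in> \<Omega>" for z
  proof -
    define y where "y = (SOME y. y \<in> \<Omega> \<and> \<theta> y = \<theta> z)"
    have y: "y \<in> \<Omega>" "\<theta> y = \<theta> z"
      using someI[of "\<lambda>y. y \<in> \<Omega> \<and> \<theta> y = \<theta> z" z] z unfolding y_def by auto
    obtain A where A: "A \<in> G" "y = A *v z" by (rule \<theta>_separates_orbits[OF y(2)[symmetric] that])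
    have "g y = g z" using g(3)[OF A(1) z] A(2) by simp
    then show ?thesis unfolding h_def using z by (simp flip: y_def)
  qed
  have lift: "lift h = f"
  proof
    fix z show "lift h z = f z"
      using s(1) h\<theta>[of z] g(2)[of z] space_zero[OF R_A2[OF f], of z] by (simp add: lift_def)
  qed
  have "holomorphic_several h (\<theta> ` \<Omega>)"
    by (rule invariant_holomorphic_descends[OF open_\<Omega> holomorphic_several_cmult[OF g(1), of s] h\<theta>])
  moreover have "set_integrable (dV \<Omega>) (\<theta> ` \<Omega>) (\<lambda>u. (cmod (h u))\<^sup>2 * \<omega>\<rho> u)"
    unfolding lift_integrable lift by (rule space_integrable[OF R_A2[OF f]])
  moreover have "\<forall>u. u \<notin> \<theta> ` \<Omega> \<longrightarrow> h u = 0" by (simp add: h_def)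
  ultimately have "h \<in> A2q" by (simp add: bergman_space_def)
  with lift show ?thesis by blast
qed

lemma lift_add: "lift (\<lambda>u. h u + k u) = (\<lambda>z. lift h z + lift k z)"
  and lift_scale: "lift (\<lambda>u. c * h u) = (\<lambda>z. c * lift h z)"
  by (auto simp: lift_def fun_eq_iff add_divide_distrib distrib_left)

lemma A2q_add: assumes "h \<in> A2q" "k \<in> A2q" shows "(\<lambda>u. h u + k u) \<in> A2q"
proof -
  have "set_integrable lebesgue \<Omega> (\<lambda>z. (cmod (lift (\<lambda>u. h u + k u) z))\<^sup>2 * \<omega> z)"
    unfolding lift_add using assms by (intro space_integrable space_add R_A2 lift_in_R)
  then have "set_integrable (dV \<Omega>) (\<theta> ` \<Omega>) (\<lambda>u. (cmod (h u + k u))\<^sup>2 * \<omega>\<rho> u)"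
    using lift_integrable[of "\<lambda>u. h u + k u"] by simp
  then show ?thesis using assms by (simp add: bergman_space_def holomorphic_several_add)
qed

lemma A2q_scale: assumes "h \<in> A2q" shows "(\<lambda>u. c * h u) \<in> A2q"
proof -
  have "set_integrable lebesgue \<Omega> (\<lambda>z. (cmod (lift (\<lambda>u. c * h u) z))\<^sup>2 * \<omega> z)"
    unfolding lift_scale using assms by (intro space_integrable space_scale R_A2 lift_in_R)
  then have "set_integrable (dV \<Omega>) (\<theta> ` \<Omega>) (\<lambda>u. (cmod (c * h u))\<^sup>2 * \<omega>\<rho> u)"
    using lift_integrable[of "\<lambda>u. c * h u"] by simp
  then show ?thesis using assms by (simp add: bergman_space_def holomorphic_several_cmult)
qed

lemma lift_bij: "bij_betw lift A2q R"
  unfolding bij_betw_def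
proof
  show "inj_on lift A2q" by (rule inj_onI) (rule lift_injective)
  show "lift ` A2q = R"
  proof
    show "lift ` A2q \<subseteq> R" by (rule image_subsetI) (rule lift_in_R)
    show "R \<subseteq> lift ` A2q"
    proof
      fix f assume "f \<in> R"
      from lift_surjective[OF this] show "f \<in> lift ` A2q" by (elim bexE) (rule image_eqI, simp_all)
    qed
  qed
qed

definition descend :: "(complex^'d \<Rightarrow> complex) \<Rightarrow> complex^'d \<Rightarrow> complex" where
  "descend = inv_into A2q lift"

lemma descend_bij: "bij_betw descend R A2q"
  unfolding descend_def by (rule bij_betw_inv_into[OF lift_bij])

lemma lift_descend: "f \<in> R \<Longrightarrow> lift (descend f) = f"
  unfolding descend_def by (rule bij_betw_inv_into_right[OF lift_bij])

lemma descend_lift: "h \<in> A2q \<Longrightarrow> descend (lift h) = h"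
  unfolding descend_def by (rule bij_betw_inv_into_left[OF lift_bij])

lemma descend_in: "f \<in> R \<Longrightarrow> descend f \<in> A2q"
  by (rule bij_betw_apply[OF descend_bij])

lemma descend_add: assumes "f \<in> R" "g \<in> R"
  shows "descend (\<lambda>z. f z + g z) = (\<lambda>u. descend f u + descend g u)"
  using descend_lift[OF A2q_add[OF descend_in[OF assms(1)] descend_in[OF assms(2)]]]
  by (simp add: lift_add lift_descend assms)

lemma descend_scale: assumes "f \<in> R"
  shows "descend (\<lambda>z. c * f z) = (\<lambda>u. c * descend f u)"
  using descend_lift[OF A2q_scale[OF descend_in[OF assms], of c]]
  by (simp add: lift_scale lift_descend assms)

theorem isometric_isomorphism: "isometrically_isomorphic R ip A2q ipq"
  unfolding isometrically_isomorphic_def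
proof (intro exI conjI ballI allI)
  show "bij_betw descend R A2q" by (rule descend_bij)
  show "descend (\<lambda>z. f z + g z) = (\<lambda>z. descend f z + descend g z)" if "f \<in> R" "g \<in> R" for f g
    by (rule descend_add[OF that])
  show "descend (\<lambda>z. c * f z) = (\<lambda>z. c * descend f z)" if "f \<in> R" for c f
    by (rule descend_scale[OF that])
  show "ipq (descend f) (descend g) = ip f g" if "f \<in> R" "g \<in> R" for f g
    using that by (simp add: lift_descend flip: lift_inner)
qed

subsection \<open>The reproducing kernel\<close>

text \<open>Also at a zero of \<open>l\<^sub>\<rho>\<close> the value of \<open>f / l\<^sub>\<rho>\<close> is bounded in terms of the norm of \<open>f\<close>, by Cauchy's estimate on a
  circle on which \<open>l\<^sub>\<rho>\<close> has no zeros.\<close>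

lemma descend_bound: assumes w: "w \<in> \<Omega>"
  shows "\<exists>C. \<forall>f\<in>R. (cmod (descend f (\<theta> w)))\<^sup>2 \<le> C * sqnorm f"
proof -
  obtain v where v: "\<And>p. \<forall>\<^sub>F t in at 0. L (p + t *s v) \<noteq> 0" using L_generic_direction by blast
  have "\<forall>\<^sub>F t in at 0. w + t *s v \<in> \<Omega> \<and> L (w + t *s v) \<noteq> 0"
    using v[of w] line_eventually_in_open[OF open_\<Omega> w] by eventually_elim simp
  then obtain d where d: "d > 0" "\<And>t. t \<noteq> 0 \<Longrightarrow> cmod t < d \<Longrightarrow> w + t *s v \<in> \<Omega> \<and> L (w + t *s v) \<noteq> 0"
    unfolding eventually_at by (auto simp: dist_norm)
  define r where "r = d / 2"
  have r: "r > 0" "r < d" using d(1) by (auto simp: r_def)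
  have in\<Omega>: "w + t *s v \<in> \<Omega>" if "cmod t < d" for t
    using d(2)[of t] that w by (cases "t = 0") auto
  let ?K = "(\<lambda>t. w + t *s v) ` sphere 0 r"
  have K: "compact ?K" by (intro compact_continuous_image continuous_intros compact_sphere)
  have K\<Omega>: "?K \<subseteq> \<Omega>" using in\<Omega> r by auto
  have LK: "L y \<noteq> 0" if y: "y \<in> ?K" for y
  proof -
    obtain t where t: "cmod t = r" "y = w + t *s v" using y by auto
    then have "t \<noteq> 0" using r(1) by auto
    then show ?thesis using d(2)[of t] t r(2) by simp
  qed
  have "?K \<noteq> {}" using r(1) by (simp add: not_less)
  moreover have "continuous_on ?K (\<lambda>y. cmod (L y))"
    by (intro continuous_intros holomorphic_several_continuous_on L_holomorphic)
  ultimately obtain y0 where y0: "y0 \<in> ?K" "\<And>y. y \<in> ?K \<Longrightarrow> cmod (L y0) \<le> cmod (L y)"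
    using continuous_attains_inf[OF K] by blast
  have m: "cmod (L y0) > 0" using LK[OF y0(1)] by simp
  obtain C where C: "\<And>f y. f \<in> A2 \<Longrightarrow> y \<in> ?K \<Longrightarrow> (cmod (f y))\<^sup>2 \<le> C * sqnorm f"
    using compact_bound[OF K K\<Omega>] by blast
  have "(cmod (descend f (\<theta> w)))\<^sup>2 \<le> (real (card G) * C / (cmod (L y0))\<^sup>2) * sqnorm f" if f: "f \<in> R" for f
  proof -
    let ?h = "descend f"
    have hol\<Omega>: "holomorphic_several (\<lambda>z. ?h (\<theta> z)) \<Omega>"
      using descend_in[OF f] by (intro quotient_holomorphic_compose) (simp add: bergman_space_def)
    have hol: "(\<lambda>t. ?h (\<theta> (w + t *s v))) holomorphic_on cball 0 r"
      by (rule holomorphic_several_line[OF hol\<Omega>]) (use in\<Omega> r in auto)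
    define B where "B = sqrt (real (card G) * (C * sqnorm f) / (cmod (L y0))\<^sup>2)"
    have val: "cmod (?h (\<theta> y)) \<le> B" if y: "y \<in> ?K" for y
    proof -
      have y\<Omega>: "y \<in> \<Omega>" using y K\<Omega> by blast
      have "f y = L y * ?h (\<theta> y) / s"
        using fun_cong[OF lift_descend[OF f], of y] y\<Omega> by (simp add: lift_def)
      then have "?h (\<theta> y) * L y = s * f y" using s(1) by (simp add: field_simps)
      then have "(cmod (?h (\<theta> y)))\<^sup>2 * (cmod (L y))\<^sup>2 = real (card G) * (cmod (f y))\<^sup>2"
        by (metis norm_mult power_mult_distrib s(4))
      also have "\<dots> \<le> real (card G) * (C * sqnorm f)"
        by (intro mult_left_mono C[OF R_A2[OF f] y]) simp
      finally have "(cmod (?h (\<theta> y)))\<^sup>2 * (cmod (L y))\<^sup>2 \<le> real (card G) * (C * sqnorm f)" .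
      moreover have "(cmod (?h (\<theta> y)))\<^sup>2 * (cmod (L y0))\<^sup>2 \<le> (cmod (?h (\<theta> y)))\<^sup>2 * (cmod (L y))\<^sup>2"
        by (intro mult_left_mono power_mono y0(2) y) auto
      ultimately have "(cmod (?h (\<theta> y)))\<^sup>2 * (cmod (L y0))\<^sup>2 \<le> real (card G) * (C * sqnorm f)" by linarith
      then have "(cmod (?h (\<theta> y)))\<^sup>2 \<le> real (card G) * (C * sqnorm f) / (cmod (L y0))\<^sup>2"
        using m by (simp add: pos_le_divide_eq)
      then show ?thesis unfolding B_def by (rule real_le_rsqrt)
    qed
    have "cmod ((deriv ^^ 0) (\<lambda>t. ?h (\<theta> (w + t *s v))) 0) \<le> fact 0 * B / r ^ 0"
    proof (rule Cauchy_inequality)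
      show "(\<lambda>t. ?h (\<theta> (w + t *s v))) holomorphic_on ball 0 r"
        using hol by (rule holomorphic_on_subset) auto
      show "continuous_on (cball 0 r) (\<lambda>t. ?h (\<theta> (w + t *s v)))"
        using hol by (rule holomorphic_on_imp_continuous_on)
      show "cmod (?h (\<theta> (w + t *s v))) \<le> B" if "cmod (0 - t) = r" for t
        by (rule val) (use that in auto)
    qed (rule r(1))
    then have le: "cmod (?h (\<theta> w)) \<le> B" by simp
    have "0 \<le> (cmod (f y0))\<^sup>2" by simp
    then have nn: "0 \<le> C * sqnorm f" using C[OF R_A2[OF f] y0(1)] by linarith
    have "0 \<le> real (card G) * (C * sqnorm f)" by (rule mult_nonneg_nonneg[OF of_nat_0_le_iff nn])
    then have "B\<^sup>2 = real (card G) * (C * sqnorm f) / (cmod (L y0))\<^sup>2"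
      unfolding B_def by (intro real_sqrt_pow2 divide_nonneg_nonneg) auto
    then show ?thesis using power_mono[OF le norm_ge_zero, of 2] by simp
  qed
  then show ?thesis by blast
qed

abbreviation "Kq u \<equiv> (\<lambda>v. bergman_kernel (dV \<Omega>) (\<theta> ` \<Omega>) \<omega>\<rho> v u)"

text \<open>The weight of the quotient can degenerate near the image of the hyperplanes. So the representers are found in \<open>R\<close>, which is closed
  under pointwise limits in \<open>A2\<close>, and transported by the isometry.\<close>

theorem quotient_kernel_reproducing:
  assumes w: "w \<in> \<Omega>"
  shows "Kq (\<theta> w) \<in> A2q" and "h \<in> A2q \<Longrightarrow> h (\<theta> w) = ipq h (Kq (\<theta> w))"
proof -
  obtain C where C: "\<And>f. f \<in> R \<Longrightarrow> (cmod (descend f (\<theta> w)))\<^sup>2 \<le> C * sqnorm f"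
    using descend_bound[OF w] by blast
  have "\<exists>k\<in>R. \<forall>f\<in>R. descend f (\<theta> w) = ip f k"
  proof (rule riesz[where C = C])
    show "g \<in> R" if fR: "\<And>n::nat. f n \<in> R" and g: "g \<in> A2" and lim: "\<And>z. z \<in> \<Omega> \<Longrightarrow> (\<lambda>n. f n z) \<longlonglongrightarrow> g z" for f g
    proof -
      have "g (A *v z) = \<rho> A * g z" if A: "A \<in> G" and z: "z \<in> \<Omega>" for A z
      proof (rule LIMSEQ_unique[OF lim[OF G\<Omega>[OF A z]]])
        show "(\<lambda>n. f n (A *v z)) \<longlonglongrightarrow> \<rho> A * g z"
          unfolding R_invariant[OF fR A z] by (intro tendsto_mult_left lim z)
      qed
      then show ?thesis using g by (simp add: R_iff)
    qed
  qed (auto simp: R_null R_add R_scale descend_add descend_scale C intro: R_A2)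
  then obtain k0 where k0: "k0 \<in> R" "\<And>f. f \<in> R \<Longrightarrow> descend f (\<theta> w) = ip f k0" by blast
  have k: "descend k0 \<in> A2q" by (rule descend_in[OF k0(1)])
  have rep: "h (\<theta> w) = ipq h (descend k0)" if h: "h \<in> A2q" for h
    using k0(2)[OF lift_in_R[OF h]] by (simp add: descend_lift[OF h] lift_descend[OF k0(1)] flip: lift_inner)
  have unique: "k' = descend k0" if k': "k' \<in> A2q \<and> (\<forall>h\<in>A2q. h (\<theta> w) = ipq h k')" for k'
  proof (rule lift_injective[OF conjunct1[OF k'] k], rule representer_unique)
    have e: "ip f (lift k') = ip f (lift (descend k0))" if f: "f \<in> R" for f
      using k' rep descend_in[OF f] lift_descend[OF f] by (metis lift_inner)
    show "ip (\<lambda>z. lift k' z - lift (descend k0) z) (lift k') =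
        ip (\<lambda>z. lift k' z - lift (descend k0) z) (lift (descend k0))"
      by (rule e[OF R_diff[OF lift_in_R[OF conjunct1[OF k']] lift_in_R[OF k]]])
  qed (rule R_A2[OF lift_in_R[OF conjunct1[OF k']]], rule R_A2[OF lift_in_R[OF k]])
  have "(THE k. k \<in> A2q \<and> (\<forall>h\<in>A2q. h (\<theta> w) = ipq h k)) = descend k0"
    by (rule the_equality) (rule conjI[OF k ballI[OF rep]], assumption, rule unique)
  then have Kq: "Kq (\<theta> w) = descend k0" unfolding bergman_kernel_def .
  show "Kq (\<theta> w) \<in> A2q" unfolding Kq by (rule k)
  show "h (\<theta> w) = ipq h (Kq (\<theta> w))" if "h \<in> A2q" unfolding Kq by (rule rep[OF that])
qed

lemma group_image_\<Omega>: assumes A: "A \<in> G" shows "(*v) A ` \<Omega> = \<Omega>"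
proof
  show "(*v) A ` \<Omega> \<subseteq> \<Omega>" using G\<Omega>[OF A] by blast
  show "\<Omega> \<subseteq> (*v) A ` \<Omega>"
  proof
    fix z assume "z \<in> \<Omega>"
    then show "z \<in> (*v) A ` \<Omega>"
      using G\<Omega>[OF iv_in[OF A]] by (intro image_eqI[of _ _ "iv A *v z"]) (simp_all add: iv_mult_vec[OF A])
  qed
qed

lemma compose_group_A2:
  assumes A: "A \<in> G" and f: "f \<in> A2" shows "(\<lambda>z. f (A *v z)) \<in> A2"
proof -
  have "holomorphic_several (\<lambda>z. f (A *v z)) \<Omega>"
  proof (rule holomorphic_several_compose[OF space_holomorphic[OF f]])
    show "holomorphic_several (\<lambda>z. (A *v z) $ i) \<Omega>" for i
      using holomorphic_several_matrix[of A 0 i] by simp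
  qed (simp add: group_image_\<Omega>[OF A])
  moreover have "\<forall>z. z \<notin> \<Omega> \<longrightarrow> f (A *v z) = 0"
    using space_zero[OF f] G\<Omega>_iff[OF A] by blast
  moreover have "set_integrable lebesgue \<Omega> (\<lambda>z. (cmod (f (A *v z)))\<^sup>2 * \<omega> z)"
  proof -
    have "set_integrable lebesgue ((*v) A ` \<Omega>) (\<lambda>z. complex_of_real ((cmod (f z))\<^sup>2 * \<omega> z))"
      unfolding group_image_\<Omega>[OF A] using space_integrable[OF f] by (simp only: set_integrable_of_real_iff)
    then have "set_integrable lebesgue \<Omega> (\<lambda>z. complex_of_real ((cmod (f (A *v z)))\<^sup>2 * \<omega> (A *v z)))"
      using set_integral_matrix(1)[OF _ invertible[OF A] det_norm[OF A]] open_\<Omega> by simp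
    then show ?thesis by (simp only: set_integrable_of_real_iff[symmetric] o_def \<theta>_invariant[OF A])
  qed
  ultimately show ?thesis by (simp add: space_iff)
qed

lemma ip_compose_group:
  assumes A: "A \<in> G" shows "ip (\<lambda>z. f (A *v z)) (\<lambda>z. g (A *v z)) = ip f g"
proof -
  have "(LINT z:\<Omega>|lebesgue. f z * cnj (g z) * of_real (\<omega> z)) =
      (LINT z:\<Omega>|lebesgue. f (A *v z) * cnj (g (A *v z)) * of_real (\<omega> z))"
    using set_integral_matrix(2)[OF _ invertible[OF A] det_norm[OF A], of \<Omega> "\<lambda>z. f z * cnj (g z) * of_real (\<omega> z)"]
      open_\<Omega> by (simp add: group_image_\<Omega>[OF A] \<theta>_invariant[OF A])
  then show ?thesis
    unfolding bergman_inner_def set_integral_dV(2)[OF measure_\<Omega>] by simp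
qed

abbreviation "K w \<equiv> (\<lambda>z. bergman_kernel (dV \<Omega>) \<Omega> \<omega> z w)"

definition averaged_kernel :: "complex^'d \<Rightarrow> complex^'d \<Rightarrow> complex" where
  "averaged_kernel w z = (\<Sum>A\<in>G. \<rho> (iv A) * K w (A *v z))"

lemma A2_sum:
  assumes "finite I" "\<And>i. i \<in> I \<Longrightarrow> f i \<in> A2" "h \<in> A2"
  shows "(\<lambda>z. \<Sum>i\<in>I. c i * f i z) \<in> A2 \<and> ip h (\<lambda>z. \<Sum>i\<in>I. c i * f i z) = (\<Sum>i\<in>I. cnj (c i) * ip h (f i))"
  using assms(1,2)
proof (induction I)
  case empty
  show ?case
    unfolding sum.empty by (rule conjI[OF space_null]) (simp add: bergman_inner_def)
next
  case (insert i I)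
  have "(\<lambda>z. \<Sum>i\<in>I. c i * f i z) \<in> A2 \<and> ip h (\<lambda>z. \<Sum>i\<in>I. c i * f i z) = (\<Sum>i\<in>I. cnj (c i) * ip h (f i))"
    by (rule insert.IH) (rule insert.prems, rule insertI2)
  note IH = conjunct1[OF this] conjunct2[OF this]
  have fi: "(\<lambda>z. c i * f i z) \<in> A2" by (rule space_scale[OF insert.prems[OF insertI1]])
  show ?case
    unfolding sum.insert[OF insert.hyps] ip_add_right[OF fi IH(1) assms(3)] IH(2) ip_scale_right
    by (rule conjI[OF space_add[OF fi IH(1)] refl])
qed

text \<open>The group preserves the inner product, so \<open>z \<mapsto> K w (A z)\<close> represents the evaluation at \<open>A\<inverse> w\<close>. On the relative invariants
  this is \<open>\<rho>(A)\<inverse>\<close> times the evaluation at \<open>w\<close>, and the coefficients of the average remove this factor.\<close>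

lemma averaged_kernel:
  assumes w: "w \<in> \<Omega>"
  shows "averaged_kernel w \<in> R" and "f \<in> R \<Longrightarrow> ip f (averaged_kernel w) = of_nat (card G) * f w"
proof -
  have Kw: "K w \<in> A2" "\<And>f. f \<in> A2 \<Longrightarrow> f w = ip f (K w)"
    by (rule bergman_kernel_reproducing[OF w], rule bergman_kernel_reproducing(2)[OF w])
  have KA: "(\<lambda>z. K w (A *v z)) \<in> A2" if "A \<in> G" for A
    by (rule compose_group_A2[OF that Kw(1)])
  have avg: "averaged_kernel w = (\<lambda>z. \<Sum>A\<in>G. \<rho> (iv A) * K w (A *v z))"
    by (simp add: averaged_kernel_def fun_eq_iff)
  have mem: "averaged_kernel w \<in> A2"
    unfolding avg by (rule conjunct1[OF A2_sum[where I = G and f = "\<lambda>A z. K w (A *v z)" and c = "\<lambda>A. \<rho> (iv A)", OF fin KA space_null]])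
  have "averaged_kernel w (C *v z) = \<rho> C * averaged_kernel w z" if C: "C \<in> G" for C z
  proof -
    have "\<rho> C * averaged_kernel w z = (\<Sum>A\<in>G. \<rho> C * (\<rho> (iv (A ** C)) * K w ((A ** C) *v z)))"
      unfolding averaged_kernel_def sum_distrib_left
      using sum.reindex_bij_betw[OF right_mult_bij[OF C], of "\<lambda>A. \<rho> C * (\<rho> (iv A) * K w (A *v z))"] by simp
    also have "\<dots> = (\<Sum>A\<in>G. \<rho> (iv A) * K w (A *v (C *v z)))"
    proof (intro sum.cong refl)
      fix A assume A: "A \<in> G"
      have AC: "A ** C \<in> G" by (rule mult_in[OF A C])
      have "\<rho> A * (\<rho> C * \<rho> (iv (A ** C))) = \<rho> A * \<rho> (iv A)"
        using \<rho>_iv(2)[OF AC] \<rho>_iv(2)[OF A] \<rho>_mult[OF A C] by (simp add: mult.assoc)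
      then have "\<rho> C * \<rho> (iv (A ** C)) = \<rho> (iv A)" using \<rho>_nz[OF A] by simp
      then show "\<rho> C * (\<rho> (iv (A ** C)) * K w ((A ** C) *v z)) = \<rho> (iv A) * K w (A *v (C *v z))"
        by (simp add: mult_vec_assoc flip: mult.assoc)
    qed
    finally show ?thesis by (simp add: averaged_kernel_def)
  qed
  then show "averaged_kernel w \<in> R" unfolding R_iff using mem by blast
  show "ip f (averaged_kernel w) = of_nat (card G) * f w" if f: "f \<in> R"
  proof -
    have fA: "f \<in> A2" by (rule R_A2[OF f])
    have "ip f (averaged_kernel w) = (\<Sum>A\<in>G. cnj (\<rho> (iv A)) * ip f (\<lambda>z. K w (A *v z)))"
      unfolding avg by (rule conjunct2[OF A2_sum[where I = G and f = "\<lambda>A z. K w (A *v z)" and c = "\<lambda>A. \<rho> (iv A)", OF fin KA fA]])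
    also have "\<dots> = (\<Sum>A\<in>G. f w)"
    proof (intro sum.cong refl)
      fix A assume A: "A \<in> G"
      let ?g = "\<lambda>z. f (iv A *v z)"
      have "ip f (\<lambda>z. K w (A *v z)) = ip (\<lambda>z. ?g (A *v z)) (\<lambda>z. K w (A *v z))"
        by (simp add: iv_mult_vec[OF A])
      also have "\<dots> = ip ?g (K w)" by (rule ip_compose_group[OF A])
      also have "\<dots> = ?g w" by (rule Kw(2)[OF compose_group_A2[OF iv_in[OF A] fA], symmetric])
      also have "\<dots> = \<rho> (iv A) * f w" by (rule R_invariant[OF f iv_in[OF A] w])
      finally show "cnj (\<rho> (iv A)) * ip f (\<lambda>z. K w (A *v z)) = f w"
        using \<rho>_cnj[OF A] \<rho>_iv(2)[OF A] by (simp flip: mult.assoc)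
    qed
    finally show ?thesis by simp
  qed
qed

text \<open>Both sides, as functions of \<open>z\<close>, are relative invariants which represent the same multiple of the evaluation at \<open>w\<close>.\<close>

theorem kernel_formula:
  assumes z: "z \<in> \<Omega>" and w: "w \<in> \<Omega>"
  shows "L z * cnj (L w) * Kq (\<theta> w) (\<theta> z) = averaged_kernel w z"
proof -
  let ?k = "lift (Kq (\<theta> w))"
  have k: "?k \<in> R" by (rule lift_in_R[OF quotient_kernel_reproducing(1)[OF w]])
  let ?P = "\<lambda>z. (s * cnj (L w)) * ?k z"
  have P: "?P \<in> R" by (rule R_scale[OF k])
  have S: "averaged_kernel w \<in> R" by (rule averaged_kernel(1)[OF w])
  have "ip f ?P = of_nat (card G) * f w" if f: "f \<in> R" for f
  proof -
    have "ip f ?k = descend f (\<theta> w)"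
      using quotient_kernel_reproducing(2)[OF w descend_in[OF f]] lift_inner[of "descend f" "Kq (\<theta> w)"]
      by (simp add: lift_descend[OF f])
    moreover have "s * f w = L w * descend f (\<theta> w)"
      using fun_cong[OF lift_descend[OF f], of w] w s(1) by (simp add: lift_def field_simps)
    ultimately have "ip f ?P = s * (s * f w)"
      by (simp only: ip_scale_right complex_cnj_mult complex_cnj_cnj s(3) mult.assoc)
    then show ?thesis by (simp only: mult.assoc[symmetric] s(2))
  qed
  then have same: "ip f ?P = ip f (averaged_kernel w)" if "f \<in> R" for f
    using averaged_kernel(2)[OF w that] that by simp
  have "?P = averaged_kernel w"
    by (rule representer_unique[OF R_A2[OF P] R_A2[OF S] same[OF R_diff[OF P S]]])
  from fun_cong[OF this, of z]
  have "(s * cnj (L w)) * ?k z = averaged_kernel w z" .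
  then show ?thesis using z s(1) by (simp add: lift_def mult_ac)
qed

theorem kernel_extends_quotient:
  "extends_quotient \<Omega> L
    (\<lambda>z w. \<Sum>A\<in>G. \<rho> (iv A) * bergman_kernel (dV \<Omega>) \<Omega> \<omega> (act (iv A) z) w)
    (\<lambda>z w. bergman_kernel (dV \<Omega>) (\<theta> ` \<Omega>) \<omega>\<rho> (\<theta> z) (\<theta> w))"
  unfolding extends_quotient_def
proof (intro conjI ballI impI)
  have hol: "holomorphic_several (\<lambda>z. Kq (\<theta> w) (\<theta> z)) \<Omega>" if "w \<in> \<Omega>" for w
    using quotient_kernel_reproducing(1)[OF that]
    by (intro quotient_holomorphic_compose) (simp add: bergman_space_def)
  show "holomorphic_several (\<lambda>z. Kq (\<theta> w) (\<theta> z)) \<Omega>" if "w \<in> \<Omega>" for w by (rule hol[OF that])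
  have sym: "cnj (Kq (\<theta> w) (\<theta> z)) = Kq (\<theta> z) (\<theta> w)" if z: "z \<in> \<Omega>" and w: "w \<in> \<Omega>" for z w
  proof -
    have "Kq (\<theta> w) (\<theta> z) = ipq (Kq (\<theta> w)) (Kq (\<theta> z))"
      by (rule quotient_kernel_reproducing(2)[OF z quotient_kernel_reproducing(1)[OF w]])
    moreover have "Kq (\<theta> z) (\<theta> w) = ipq (Kq (\<theta> z)) (Kq (\<theta> w))"
      by (rule quotient_kernel_reproducing(2)[OF w quotient_kernel_reproducing(1)[OF z]])
    moreover have "ipq (Kq (\<theta> z)) (Kq (\<theta> w)) = cnj (ipq (Kq (\<theta> w)) (Kq (\<theta> z)))"
      unfolding lift_inner[symmetric] by (rule ip_cnj)
    ultimately show ?thesis by simp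
  qed
  show "holomorphic_several (\<lambda>w. cnj (Kq (\<theta> w) (\<theta> z))) \<Omega>" if z: "z \<in> \<Omega>" for z
    by (rule holomorphic_several_transform[OF hol[OF z] open_\<Omega>]) (simp add: sym[OF z])
  show "Kq (\<theta> w) (\<theta> z) = 1 / (L z * cnj (L w)) *
      (\<Sum>A\<in>G. \<rho> (iv A) * bergman_kernel (dV \<Omega>) \<Omega> \<omega> (act (iv A) z) w)"
    if z: "z \<in> \<Omega>" and w: "w \<in> \<Omega>" and nz: "L z \<noteq> 0 \<and> L w \<noteq> 0" for z w
  proof -
    have "(\<Sum>A\<in>G. \<rho> (iv A) * bergman_kernel (dV \<Omega>) \<Omega> \<omega> (act (iv A) z) w) = averaged_kernel w z"
      unfolding averaged_kernel_def by (intro sum.cong) (simp_all add: act_iv)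
    then show ?thesis using kernel_formula[OF z w] nz by (simp add: field_simps)
  qed
qed

end

theorem theorem1p1:
  fixes G :: "(complex^'d^'d) set"
    and \<Omega> :: "(complex^'d) set"
    and \<theta> :: "complex^'d \<Rightarrow> complex^'d"
    and \<omega>t \<omega> \<omega>\<rho> :: "complex^'d \<Rightarrow> real"
    and \<rho> :: "complex^'d^'d \<Rightarrow> complex"
    and a :: "(complex^'d) set \<Rightarrow> complex^'d^'d"
    and l :: "(complex^'d) set \<Rightarrow> complex^'d \<Rightarrow> complex"
    and l\<rho> :: "complex^'d \<Rightarrow> complex"
  assumes "finite_reflection_group G"
    and "cdomain \<Omega>" and "bounded \<Omega>" and "invariant_set G \<Omega>"
    and "basic_polynomial_map G \<theta>"
    and "continuous_on (\<theta> ` \<Omega>) \<omega>t" and "\<And>u. u \<in> \<theta> ` \<Omega> \<Longrightarrow> \<omega>t u > 0"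
    and "\<omega> = \<omega>t \<circ> \<theta>"
    and "one_dim_rep G \<rho>"
    and "\<And>H. H \<in> reflecting_hyperplanes G \<Longrightarrow>
           a H \<in> G \<and> pointwise_stabilizer G H = generate GL {a H}"
    and "\<And>H. H \<in> reflecting_hyperplanes G \<Longrightarrow> linear_form (l H) \<and> {z. l H z = 0} = H"
    and "l\<rho> = rep_poly G a l \<rho>"
    and "\<omega>\<rho> = rep_weight G \<Omega> \<theta> l\<rho> \<omega>t"
  shows "isometrically_isomorphic
           (relative_invariant_subspace G \<rho> (dV \<Omega>) \<Omega> \<omega>) (bergman_inner (dV \<Omega>) \<Omega> \<omega>)
           (bergman_space (dV \<Omega>) (\<theta> ` \<Omega>) \<omega>\<rho>) (bergman_inner (dV \<Omega>) (\<theta> ` \<Omega>) \<omega>\<rho>) \<and>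
         extends_quotient \<Omega> l\<rho>
           (\<lambda>z w. \<Sum>\<sigma>\<in>G. \<rho> (inv\<^bsub>GL\<^esub> \<sigma>) *
              bergman_kernel (dV \<Omega>) \<Omega> \<omega> (act (inv\<^bsub>GL\<^esub> \<sigma>) z) w)
           (\<lambda>z w. bergman_kernel (dV \<Omega>) (\<theta> ` \<Omega>) \<omega>\<rho> (\<theta> z) (\<theta> w))"
proof -
  have G: "finite G" "subgroup G GL" "G = generate GL {A \<in> G. complex_reflection A}"
    using assms(1) unfolding finite_reflection_group_def by blast+
  interpret finite_matrix_group G by (rule finite_matrix_group.intro) (rule G)+
  have G\<Omega>: "A *v z \<in> \<Omega>" if "A \<in> G" "z \<in> \<Omega>" for A z
  proof -
    have "act (iv A) ` \<Omega> = \<Omega>" using assms(4) iv_in[OF that(1)] unfolding invariant_set_def by blast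
    then show ?thesis using that act_iv[OF that(1), of z] by (metis imageI)
  qed
  interpret reflection_quotient G \<rho> a l \<theta> \<Omega> \<omega>t
  proof unfold_locales
    show "open \<Omega>" "\<Omega> \<noteq> {}" using assms(2) unfolding cdomain_def by blast+
  qed (fact G(3) assms(3,5-7,9-11) G\<Omega>)+
  show ?thesis
    unfolding assms(8,12,13) using isometric_isomorphism kernel_extends_quotient by (rule conjI)
qed

end
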